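(* Let $\Omega\subset\mathbb R^2$ be a bounded polygonal Lipschitz domain, $f\in L^2(\Omega)$, $V:=H^2_0(\Omega)$, and let $u\in V$ be a regular solution to the stream function vorticity formulation $N(u)=0$ of the 2D Navier-Stokes equations, where $N(u;v)=a(u,v)-F(v)+\Gamma(u,u,v)$. Consider the conforming finite element problem of finding $u_C\in V_C=V_C(\mathcal T)$ with $N(u_C;v_C)=0$ for all $v_C\in V_C$. Then there exist positive $\epsilon,\delta,\rho$ and $C_{qo}$ such that the following holds for all $\mathcal T\in\mathbb T(\delta)$. (A) There exists a unique discrete solution $u_C\in V_C(\mathcal T)$ with $\||u-u_C\||\le\epsilon$. (B) For any initial iterate $u_C^{(0)}\in V_C(\mathcal T)$ with $\||u_C-u_C^{(0)}\||\le\rho$, the Newton scheme for the discrete problem converges quadratically to $u_C$. (C) $\displaystyle\||u-u_C\||\le C_{qo}\min_{v_C\in V_C(\mathcal T)}\||u-v_C\||.$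
   Context: For $\eta,\chi,\phi\in V$: $a(\eta,\chi):=\int_\Omega\Delta\eta\,\Delta\chi\,dx$, $\Gamma(\eta,\chi,\phi):=\int_\Omega\Delta\eta\big(\frac{\partial\chi}{\partial x_2}\frac{\partial\phi}{\partial x_1}-\frac{\partial\chi}{\partial x_1}\frac{\partial\phi}{\partial x_2}\big)dx$, $F(\phi):=\int_\Omega f\phi\,dx$, and $\||\bullet\||:=|\bullet|_{H^2(\Omega)}$ is the norm on $V$. A regular solution is $u\in V$ with $N(u)=0$ in $V^*$ such that $DN(u)\in L(V;V^* )$, $DN(u;\theta,\phi)=a(\theta,\phi)+\Gamma(u,\theta,\phi)+\Gamma(\theta,u,\phi)$, is bijective. $\mathbb T$ is a uniformly shape-regular family of regular triangulations of $\Omega$ into triangles, and $\mathbb T(\delta):=\{\mathcal T\in\mathbb T:\max_{K\in\mathcal T}\mathrm{diam}(K)\le\delta\}$. For $\mathcal T\in\mathbb T$, $V_C(\mathcal T)\subset C^1(\overline\Omega)\cap V$ is a standard conforming finite element space, always of the same type (e.g. the space associated with HCT or Argyris elements), with the standard approximation property $\min_{v_C\in V_C(\mathcal T)}\||z-v_C\||\le C h_{\max}^s\|z\|_{H^{2+s}(\Omega)}$ for $z\in V\cap H^{2+s}(\Omega)$, $h_{\max}:=\max_{K\in\mathcal T}\mathrm{diam}(K)$. Here $s\in(1/2,1]$ is the elliptic regularity index of $\Omega$: any $z\in V$ with $a(z,\bullet)\in H^{-1}(\Omega)$ satisfies $\|z\|_{H^{2+s}(\Omega)}\le C\|a(z,\bullet)\|_{H^{-1}(\Omega)}$.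 The Newton scheme computes $u_C^{(j+1)}=u_C^{(j)}-DN_h(u_C^{(j)})^{-1}N_h(u_C^{(j)})$ with $N_h:V_C\to V_C^*$, $N_h(v_C):=N(v_C;\bullet)|_{V_C}$. *)

theory Defs
  imports "HOL-Analysis.Analysis"
begin

text \<open>
  Elements of Lebesgue and Sobolev spaces on \<open>\<Omega>\<close> are represented by functions on the whole plane
  of which only the values in \<open>\<Omega>\<close> matter; two representatives describe the same element iff they
  agree almost everywhere in \<open>\<Omega>\<close>.
\<close>

type_synonym plane = "real^2"
type_synonym sfun = "plane \<Rightarrow> real"

definition ae_eq :: "plane set \<Rightarrow> sfun \<Rightarrow> sfun \<Rightarrow> bool" where
  "ae_eq \<Omega> u v \<longleftrightarrow> (AE x in lebesgue_on \<Omega>. u x = v x)"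

definition polygonal_lipschitz_domain :: "plane set \<Rightarrow> bool" where
  "polygonal_lipschitz_domain \<Omega> \<longleftrightarrow>
     open \<Omega> \<and> connected \<Omega> \<and> \<Omega> \<noteq> {} \<and> bounded \<Omega> \<and>
     (\<exists>S. finite S \<and> frontier \<Omega> = (\<Union>(a, b)\<in>S. closed_segment a b)) \<and>
     (\<forall>x\<in>frontier \<Omega>. \<exists>(R :: plane \<Rightarrow> plane) L \<gamma> r. orthogonal_transformation R \<and> L-lipschitz_on (UNIV :: real set) \<gamma> \<and> r > 0 \<and>
        \<Omega> \<inter> ball x r = {y \<in> ball x r. \<gamma> (R y $ 1) < R y $ 2})"


subsection \<open>Sobolev spaces\<close>

definition pdiff :: "2 \<Rightarrow> sfun \<Rightarrow> sfun" where
  "pdiff i \<phi> x = frechet_derivative \<phi> (at x) (axis i 1)"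

primrec pdiffs :: "2 list \<Rightarrow> sfun \<Rightarrow> sfun" where
  "pdiffs [] \<phi> = \<phi>"
| "pdiffs (i # is) \<phi> = pdiff i (pdiffs is \<phi>)"

definition test_functions :: "plane set \<Rightarrow> sfun set" where
  "test_functions \<Omega> =
     {\<phi>. (\<forall>is x. pdiffs is \<phi> differentiable (at x)) \<and>
         compact (closure {x. \<phi> x \<noteq> 0}) \<and> closure {x. \<phi> x \<noteq> 0} \<subseteq> \<Omega>}"

definition L2 :: "plane set \<Rightarrow> sfun set" where
  "L2 \<Omega> = {g. g \<in> borel_measurable (lebesgue_on \<Omega>) \<and> integrable (lebesgue_on \<Omega>) (\<lambda>x. (g x)\<^sup>2)}"

definition locally_integrable :: "plane set \<Rightarrow> sfun \<Rightarrow> bool" where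
  "locally_integrable \<Omega> g \<longleftrightarrow> (\<forall>K. compact K \<and> K \<subseteq> \<Omega> \<longrightarrow> g absolutely_integrable_on K)"

text \<open>Derivatives of order \<open>m\<close> are indexed by lists of \<open>m\<close> directions rather than by multi-indices.\<close>

definition has_weak_deriv :: "plane set \<Rightarrow> 2 list \<Rightarrow> sfun \<Rightarrow> sfun \<Rightarrow> bool" where
  "has_weak_deriv \<Omega> is u g \<longleftrightarrow>
     locally_integrable \<Omega> u \<and> locally_integrable \<Omega> g \<and>
     (\<forall>\<phi>\<in>test_functions \<Omega>.
        (LINT x|lebesgue_on \<Omega>. u x * pdiffs is \<phi> x) = (-1) ^ length is * (LINT x|lebesgue_on \<Omega>. g x * \<phi> x))"

text \<open>Determined only up to a null set; meaningful only if a weak derivative exists.\<close>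

definition weak_deriv :: "plane set \<Rightarrow> 2 list \<Rightarrow> sfun \<Rightarrow> sfun" where
  "weak_deriv \<Omega> is u = (SOME g. has_weak_deriv \<Omega> is u g)"

definition sobolev :: "plane set \<Rightarrow> nat \<Rightarrow> sfun set" where
  "sobolev \<Omega> m = {u \<in> L2 \<Omega>. \<forall>is. length is \<le> m \<longrightarrow> (\<exists>g\<in>L2 \<Omega>. has_weak_deriv \<Omega> is u g)}"

text \<open>
  The sum over lists makes \<open>sobolev_seminorm \<Omega> m u\<close> the \<open>L2\<close> norm of the Euclidean (Frobenius)
  length of the derivative tensor \<open>D\<^sup>m u\<close>: mixed derivatives are counted with multiplicity.
\<close>

definition sobolev_seminorm :: "plane set \<Rightarrow> nat \<Rightarrow> sfun \<Rightarrow> real" where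
  "sobolev_seminorm \<Omega> m u =
     sqrt (\<Sum>is\<in>{is. length is = m}. LINT x|lebesgue_on \<Omega>. (weak_deriv \<Omega> is u x)\<^sup>2)"

definition sobolev_norm :: "plane set \<Rightarrow> nat \<Rightarrow> sfun \<Rightarrow> real" where
  "sobolev_norm \<Omega> m u = sqrt (\<Sum>k\<le>m. (sobolev_seminorm \<Omega> k u)\<^sup>2)"

definition sobolev0 :: "plane set \<Rightarrow> nat \<Rightarrow> sfun set" where
  "sobolev0 \<Omega> m =
     {u \<in> sobolev \<Omega> m. \<forall>e>0. \<exists>\<phi>\<in>test_functions \<Omega>. sobolev_norm \<Omega> m (\<lambda>x. u x - \<phi> x) < e}"

text \<open>
  The Sobolev-Slobodeckij spaces of order \<open>m + s\<close> with \<open>0 < s \<le> 1\<close>: for \<open>s < 1\<close> by the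
  (squared) Gagliardo double integral of the derivatives of order \<open>m\<close>, for \<open>s = 1\<close> the
  integer-order space of order \<open>m + 1\<close>.
\<close>

definition gagliardo :: "plane set \<Rightarrow> real \<Rightarrow> sfun \<Rightarrow> ennreal" where
  "gagliardo \<Omega> s g =
     (\<integral>\<^sup>+x. (\<integral>\<^sup>+y. ennreal ((g x - g y)\<^sup>2 / norm (x - y) powr (2 + 2 * s)) \<partial>lebesgue_on \<Omega>) \<partial>lebesgue_on \<Omega>)"

definition sobolev_frac :: "plane set \<Rightarrow> nat \<Rightarrow> real \<Rightarrow> sfun set" where
  "sobolev_frac \<Omega> m s =
     (if s = 1 then sobolev \<Omega> (m + 1)
      else {u \<in> sobolev \<Omega> m. \<forall>is. length is = m \<longrightarrow> gagliardo \<Omega> s (weak_deriv \<Omega> is u) < \<infinity>})"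

definition sobolev_frac_norm :: "plane set \<Rightarrow> nat \<Rightarrow> real \<Rightarrow> sfun \<Rightarrow> real" where
  "sobolev_frac_norm \<Omega> m s u =
     (if s = 1 then sobolev_norm \<Omega> (m + 1) u
      else sqrt ((sobolev_norm \<Omega> m u)\<^sup>2 +
                 (\<Sum>is\<in>{is. length is = m}. enn2real (gagliardo \<Omega> s (weak_deriv \<Omega> is u)))))"


subsection \<open>Subspaces and duals\<close>

definition fun_subspace :: "sfun set \<Rightarrow> bool" where
  "fun_subspace W \<longleftrightarrow>
     (\<lambda>x. 0) \<in> W \<and> (\<forall>v\<in>W. \<forall>w\<in>W. \<forall>a b. (\<lambda>x. a * v x + b * w x) \<in> W)"

text \<open>
  A functional is represented by a function on all functions of type \<open>sfun\<close>; only its values on the space in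
  question matter. A bounded one automatically respects equality almost everywhere in \<open>\<Omega>\<close>.
\<close>

definition bounded_functionals :: "(sfun \<Rightarrow> real) \<Rightarrow> sfun set \<Rightarrow> (sfun \<Rightarrow> real) set" where
  "bounded_functionals nrm W =
     {l. (\<forall>v\<in>W. \<forall>w\<in>W. \<forall>a b. l (\<lambda>x. a * v x + b * w x) = a * l v + b * l w) \<and>
         (\<exists>C. \<forall>v\<in>W. \<bar>l v\<bar> \<le> C * nrm v)}"

definition dual_norm :: "(sfun \<Rightarrow> real) \<Rightarrow> sfun set \<Rightarrow> (sfun \<Rightarrow> real) \<Rightarrow> real" where
  "dual_norm nrm W l = (SUP v\<in>{v \<in> W. nrm v \<le> 1}. \<bar>l v\<bar>)"

abbreviation Hminus1 :: "plane set \<Rightarrow> (sfun \<Rightarrow> real) set" where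
  "Hminus1 \<Omega> \<equiv> bounded_functionals (sobolev_norm \<Omega> 1) (sobolev0 \<Omega> 1)"

abbreviation Hminus1_norm :: "plane set \<Rightarrow> (sfun \<Rightarrow> real) \<Rightarrow> real" where
  "Hminus1_norm \<Omega> \<equiv> dual_norm (sobolev_norm \<Omega> 1) (sobolev0 \<Omega> 1)"

abbreviation V :: "plane set \<Rightarrow> sfun set" where
  "V \<Omega> \<equiv> sobolev0 \<Omega> 2"

abbreviation energy_norm :: "plane set \<Rightarrow> sfun \<Rightarrow> real" where
  "energy_norm \<Omega> \<equiv> sobolev_seminorm \<Omega> 2"

text \<open>\<open>\<theta> \<mapsto> B \<theta>\<close> is a bounded linear operator from \<open>W \<subseteq> V\<close> to its dual.\<close>

definition bounded_op :: "plane set \<Rightarrow> sfun set \<Rightarrow> (sfun \<Rightarrow> sfun \<Rightarrow> real) \<Rightarrow> bool" where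
  "bounded_op \<Omega> W B \<longleftrightarrow>
     (\<forall>\<theta>\<in>W. B \<theta> \<in> bounded_functionals (energy_norm \<Omega>) W) \<and>
     (\<forall>\<theta>\<in>W. \<forall>\<theta>'\<in>W. \<forall>a b. \<forall>\<phi>\<in>W. B (\<lambda>x. a * \<theta> x + b * \<theta>' x) \<phi> = a * B \<theta> \<phi> + b * B \<theta>' \<phi>) \<and>
     (\<exists>C. \<forall>\<theta>\<in>W. \<forall>\<phi>\<in>W. \<bar>B \<theta> \<phi>\<bar> \<le> C * energy_norm \<Omega> \<theta> * energy_norm \<Omega> \<phi>)"

definition bijective_op :: "plane set \<Rightarrow> sfun set \<Rightarrow> (sfun \<Rightarrow> sfun \<Rightarrow> real) \<Rightarrow> bool" where
  "bijective_op \<Omega> W B \<longleftrightarrow>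
     (\<forall>l\<in>bounded_functionals (energy_norm \<Omega>) W. \<exists>\<theta>\<in>W. \<forall>\<phi>\<in>W. B \<theta> \<phi> = l \<phi>) \<and>
     (\<forall>\<theta>\<in>W. \<forall>\<theta>'\<in>W. (\<forall>\<phi>\<in>W. B \<theta> \<phi> = B \<theta>' \<phi>) \<longrightarrow> ae_eq \<Omega> \<theta> \<theta>')"


subsection \<open>Stream function vorticity formulation\<close>

definition laplace :: "plane set \<Rightarrow> sfun \<Rightarrow> sfun" where
  "laplace \<Omega> u x = weak_deriv \<Omega> [1, 1] u x + weak_deriv \<Omega> [2, 2] u x"

definition form_a :: "plane set \<Rightarrow> sfun \<Rightarrow> sfun \<Rightarrow> real" where
  "form_a \<Omega> \<eta> \<zeta> = (LINT x|lebesgue_on \<Omega>. laplace \<Omega> \<eta> x * laplace \<Omega> \<zeta> x)"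

definition form_Gamma :: "plane set \<Rightarrow> sfun \<Rightarrow> sfun \<Rightarrow> sfun \<Rightarrow> real" where
  "form_Gamma \<Omega> \<eta> \<zeta> \<phi> =
     (LINT x|lebesgue_on \<Omega>. laplace \<Omega> \<eta> x *
        (weak_deriv \<Omega> [2] \<zeta> x * weak_deriv \<Omega> [1] \<phi> x - weak_deriv \<Omega> [1] \<zeta> x * weak_deriv \<Omega> [2] \<phi> x))"

definition load :: "plane set \<Rightarrow> sfun \<Rightarrow> sfun \<Rightarrow> real" where
  "load \<Omega> f \<phi> = (LINT x|lebesgue_on \<Omega>. f x * \<phi> x)"

definition NS :: "plane set \<Rightarrow> sfun \<Rightarrow> sfun \<Rightarrow> sfun \<Rightarrow> real" where
  "NS \<Omega> f u v = form_a \<Omega> u v - load \<Omega> f v + form_Gamma \<Omega> u u v"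

definition DNS :: "plane set \<Rightarrow> sfun \<Rightarrow> sfun \<Rightarrow> sfun \<Rightarrow> real" where
  "DNS \<Omega> u \<theta> \<phi> = form_a \<Omega> \<theta> \<phi> + form_Gamma \<Omega> u \<theta> \<phi> + form_Gamma \<Omega> \<theta> u \<phi>"

definition regular_solution :: "plane set \<Rightarrow> sfun \<Rightarrow> sfun \<Rightarrow> bool" where
  "regular_solution \<Omega> f u \<longleftrightarrow>
     u \<in> V \<Omega> \<and> (\<forall>v\<in>V \<Omega>. NS \<Omega> f u v = 0) \<and>
     bounded_op \<Omega> (V \<Omega>) (DNS \<Omega> u) \<and> bijective_op \<Omega> (V \<Omega>) (DNS \<Omega> u)"

text \<open>\<open>a(z, \<cdot>)\<close> belongs to \<open>H\<^sup>-\<^sup>1\<close> iff it is the restriction to \<open>V\<close> of some \<open>l\<close> in \<open>H\<^sup>-\<^sup>1\<close>.\<close>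

definition elliptic_regularity :: "plane set \<Rightarrow> real \<Rightarrow> bool" where
  "elliptic_regularity \<Omega> s \<longleftrightarrow>
     (\<exists>C>0. \<forall>z\<in>V \<Omega>. \<forall>l\<in>Hminus1 \<Omega>. (\<forall>\<phi>\<in>V \<Omega>. form_a \<Omega> z \<phi> = l \<phi>) \<longrightarrow>
        z \<in> sobolev_frac \<Omega> 2 s \<and> sobolev_frac_norm \<Omega> 2 s z \<le> C * Hminus1_norm \<Omega> l)"


subsection \<open>Triangulations and conforming finite element spaces\<close>

definition regular_triangulation :: "plane set \<Rightarrow> plane set set \<Rightarrow> bool" where
  "regular_triangulation \<Omega> \<T> \<longleftrightarrow>
     triangulation \<T> \<and> (\<forall>K\<in>\<T>. 2 simplex K) \<and> \<Union>\<T> = closure \<Omega>"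

definition uniformly_shape_regular :: "plane set set set \<Rightarrow> bool" where
  "uniformly_shape_regular TT \<longleftrightarrow>
     (\<exists>\<kappa>>0. \<forall>\<T>\<in>TT. \<forall>K\<in>\<T>. \<exists>c. cball c (\<kappa> * diameter K) \<subseteq> K)"

definition hmax :: "plane set set \<Rightarrow> real" where
  "hmax \<T> = Max (diameter ` \<T>)"

definition fine_meshes :: "plane set set set \<Rightarrow> real \<Rightarrow> plane set set set" where
  "fine_meshes TT \<delta> = {\<T>\<in>TT. hmax \<T> \<le> \<delta>}"

definition C1_closure :: "plane set \<Rightarrow> sfun set" where
  "C1_closure \<Omega> =
     {v. continuous_on (closure \<Omega>) v \<and> (\<forall>x\<in>\<Omega>. v differentiable (at x)) \<and>
         (\<forall>i. \<exists>g. continuous_on (closure \<Omega>) g \<and> (\<forall>x\<in>\<Omega>. g x = pdiff i v x))}"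

text \<open>
  \<open>P K\<close> is the space of shape functions on the triangle \<open>K\<close>. That neither \<open>P\<close> nor the bound
  \<open>n\<close> on the number of local degrees of freedom depends on the triangulation says that the
  elements are always of the same type (\<open>n = 12\<close> for HCT, \<open>n = 21\<close> for Argyris). No
  unisolvent degrees of freedom are fixed, so \<open>VC \<T>\<close> is only required to be a subspace of the
  functions that are elementwise in \<open>P K\<close> (for Argyris it is a proper one).
  Discrete functions are extended by zero outside the closure of \<open>\<Omega>\<close>, so that two of them are
  equal almost everywhere in \<open>\<Omega>\<close> only if they are equal.
\<close>

definition conforming_fe_family ::
    "plane set \<Rightarrow> plane set set set \<Rightarrow> (plane set set \<Rightarrow> sfun set) \<Rightarrow> bool" where
  "conforming_fe_family \<Omega> TT VC \<longleftrightarrow>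
     (\<exists>(n::nat) P. (\<forall>K. \<exists>b. P K = {(\<lambda>x. \<Sum>i<n. c i * b i x) | c. True}) \<and>
        (\<forall>\<T>\<in>TT. fun_subspace (VC \<T>) \<and> VC \<T> \<subseteq> C1_closure \<Omega> \<inter> V \<Omega> \<and>
           (\<forall>v\<in>VC \<T>. (\<forall>x. x \<notin> closure \<Omega> \<longrightarrow> v x = 0) \<and> (\<forall>K\<in>\<T>. \<exists>p\<in>P K. \<forall>x\<in>K. v x = p x))))"

text \<open>The infimum is a minimum for the finite-dimensional spaces considered here.\<close>

definition best_approx :: "plane set \<Rightarrow> sfun set \<Rightarrow> sfun \<Rightarrow> real" where
  "best_approx \<Omega> W z = (INF v\<in>W. energy_norm \<Omega> (\<lambda>x. z x - v x))"

definition approximation_property ::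
    "plane set \<Rightarrow> real \<Rightarrow> plane set set set \<Rightarrow> (plane set set \<Rightarrow> sfun set) \<Rightarrow> bool" where
  "approximation_property \<Omega> s TT VC \<longleftrightarrow>
     (\<exists>C>0. \<forall>\<T>\<in>TT. \<forall>z\<in>V \<Omega> \<inter> sobolev_frac \<Omega> 2 s.
        best_approx \<Omega> (VC \<T>) z \<le> C * hmax \<T> powr s * sobolev_frac_norm \<Omega> 2 s z)"

definition discrete_solution :: "plane set \<Rightarrow> sfun \<Rightarrow> sfun set \<Rightarrow> sfun \<Rightarrow> bool" where
  "discrete_solution \<Omega> f W w \<longleftrightarrow> w \<in> W \<and> (\<forall>v\<in>W. NS \<Omega> f w v = 0)"


subsection \<open>Newton scheme\<close>

text \<open>The inverse of the discrete derivative at \<open>w\<close>, to be used only where that is bijective.\<close>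

definition DNS_inv :: "plane set \<Rightarrow> sfun set \<Rightarrow> sfun \<Rightarrow> (sfun \<Rightarrow> real) \<Rightarrow> sfun" where
  "DNS_inv \<Omega> W w l = (THE \<theta>. \<theta> \<in> W \<and> (\<forall>\<phi>\<in>W. DNS \<Omega> w \<theta> \<phi> = l \<phi>))"

primrec newton :: "plane set \<Rightarrow> sfun \<Rightarrow> sfun set \<Rightarrow> sfun \<Rightarrow> nat \<Rightarrow> sfun" where
  "newton \<Omega> f W w0 0 = w0"
| "newton \<Omega> f W w0 (Suc j) =
     (\<lambda>x. newton \<Omega> f W w0 j x - DNS_inv \<Omega> W (newton \<Omega> f W w0 j) (NS \<Omega> f (newton \<Omega> f W w0 j)) x)"

definition converges_quadratically :: "plane set \<Rightarrow> (nat \<Rightarrow> sfun) \<Rightarrow> sfun \<Rightarrow> bool" where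
  "converges_quadratically \<Omega> X w \<longleftrightarrow>
     (\<lambda>j. energy_norm \<Omega> (\<lambda>x. w x - X j x)) \<longlonglongrightarrow> 0 \<and>
     (\<exists>C>0. \<forall>j. energy_norm \<Omega> (\<lambda>x. w x - X (Suc j) x) \<le> C * (energy_norm \<Omega> (\<lambda>x. w x - X j x))\<^sup>2)"

definition newton_converges :: "plane set \<Rightarrow> sfun \<Rightarrow> sfun set \<Rightarrow> sfun \<Rightarrow> sfun \<Rightarrow> bool" where
  "newton_converges \<Omega> f W w0 w \<longleftrightarrow>
     (\<forall>j. newton \<Omega> f W w0 j \<in> W \<and> bijective_op \<Omega> W (DNS \<Omega> (newton \<Omega> f W w0 j))) \<and>
     converges_quadratically \<Omega> (newton \<Omega> f W w0) w"

end

theory Submission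
  imports Defs "HOL-Library.Function_Algebras"
begin

text \<open>
  The form \<open>DN(u)\<close> is bounded below on \<open>V\<close>, since it is bijective. To transfer this to the
  discrete spaces, write \<open>DN(u; \<theta>, \<bullet>) = a(\<theta> + T \<theta>, \<bullet>)\<close> with \<open>a(T \<theta>, \<bullet>) = \<Gamma>(u, \<theta>, \<bullet>) + \<Gamma>(\<theta>, u, \<bullet>)\<close>.
  If \<open>u\<close> is replaced by a nearby test function \<open>\<psi>\<close>, the right-hand side is an \<open>H\<^sup>-\<^sup>1\<close> functional
  with norm at most a multiple of that of \<open>\<theta>\<close>, so elliptic regularity and the approximation property
  bring \<open>V\<^sub>C\<close> uniformly close to \<open>T \<theta>\<close> on fine meshes. Testing with functions of \<open>V\<^sub>C\<close> then loses
  little, and a discrete inf-sup condition holds uniformly. Existence is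
  the Banach fixed point theorem for the simplified Newton map, uniqueness, quasi-optimality and the
  quadratic convergence of the Newton scheme follow from the inf-sup condition because \<open>N\<close> is quadratic.

  All function spaces are handled as spaces of representatives with a semi-inner product: functions
  that agree almost everywhere are not identified, and only in \<open>V\<^sub>C\<close> is the seminorm definite.
\<close>

section \<open>Semi-Hilbert spaces\<close>

text \<open>The obstacle is that \<Gamma>(u, \<theta>, .) is a priori only a functional on V:
  \<Delta>u lies in L^2 and the gradient of \<theta> in every L^p with p finite, but not in
  L^\<infinity>, so their product need not be square integrable and cannot be paired with the
  gradient of an arbitrary H^1 function. A test function in place of u puts a bounded factor into
  each product, and the error made is small in operator norm by an L^4 bound for gradients. The same
  device approximates u itself, for no regularity of u beyond V enters. The form a can serve as
  inner product because integrating by parts twice turns the integral of (\<Delta>v)^2 over \<Omega>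
  into the squared H^2 seminorm for v in V. The constants of the discrete part all come from one
  smallness condition, 8 G \<epsilon> \<le> \<beta>, where G bounds \<Gamma>: within distance 2
  \<epsilon> of u the inf-sup constant stays above \<beta>/2, and the quadratic remainders of N can
  be absorbed into the left-hand side.\<close>

instantiation "fun" :: (type, real_vector) real_vector
begin

definition scaleR_fun :: "real \<Rightarrow> ('a \<Rightarrow> 'b) \<Rightarrow> 'a \<Rightarrow> 'b" where
  "scaleR_fun c f = (\<lambda>x. c *\<^sub>R f x)"

instance
  by standard (simp_all add: scaleR_fun_def fun_eq_iff scaleR_add_right scaleR_add_left)

end

lemma scaleR_fun_apply [simp]: "(c *\<^sub>R f) x = c *\<^sub>R f x"
  by (simp add: scaleR_fun_def)

text \<open>Two scalars as in \<open>bounded_functionals\<close>, and only on \<open>W\<close>: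
  forms are total functions whose values off the space carry no meaning.\<close>

definition linear_form :: "'v::real_vector set \<Rightarrow> ('v \<Rightarrow> real) \<Rightarrow> bool" where
  "linear_form W l \<longleftrightarrow> (\<forall>x\<in>W. \<forall>y\<in>W. \<forall>a b. l (a *\<^sub>R x + b *\<^sub>R y) = a * l x + b * l y)"

lemma linear_form_simps:
  assumes "linear_form W l" "subspace W" "x \<in> W" "y \<in> W"
  shows "l (x + y) = l x + l y" "l (x - y) = l x - l y" "l (c *\<^sub>R x) = c * l x" "l 0 = 0"
proof -
  have *: "l (a *\<^sub>R x + b *\<^sub>R y) = a * l x + b * l y" for a b
    using assms by (auto simp: linear_form_def)
  show "l (x + y) = l x + l y" using *[of 1 1] by simp
  show "l (x - y) = l x - l y" using *[of 1 "-1"] by simp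
  show "l (c *\<^sub>R x) = c * l x" using *[of c 0] by simp
  show "l 0 = 0" using *[of 0 0] by simp
qed

lemma sum_fun_apply: "(\<Sum>i\<in>I. f i) x = (\<Sum>i\<in>I. f i x)"
  by (induction I rule: infinite_finite_induct) auto

text \<open>An injective linear map between spaces of the same finite dimension is onto. With a
  basis \<open>B\<close> of \<open>W\<close>, a functional is stored as the vector of its values on
  \<open>B\<close>, so the dual sits in a span of at most \<open>card B\<close> vectors, while an
  injective map sends \<open>B\<close> to \<open>card B\<close> independent ones. Solvability on
  \<open>W\<close> is reduced to uniqueness in this way.\<close>

lemma finite_dim_surj:
  fixes A :: "'v::real_vector \<Rightarrow> 'v \<Rightarrow> real"
  assumes W: "subspace W" "W \<subseteq> span S" "finite S"
    and lin: "\<And>\<theta>. \<theta> \<in> W \<Longrightarrow> linear_form W (A \<theta>)"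
    and lin': "\<And>\<phi>. \<phi> \<in> W \<Longrightarrow> linear_form W (\<lambda>\<theta>. A \<theta> \<phi>)"
    and inj: "\<And>\<theta>. \<theta> \<in> W \<Longrightarrow> (\<And>\<phi>. \<phi> \<in> W \<Longrightarrow> A \<theta> \<phi> = 0) \<Longrightarrow> \<theta> = 0"
    and l: "linear_form W l"
  shows "\<exists>\<theta>\<in>W. \<forall>\<phi>\<in>W. A \<theta> \<phi> = l \<phi>"
proof -
  obtain B where B: "B \<subseteq> W" "independent B" "W \<subseteq> span B"
    using maximal_independent_subset by blast
  have finB: "finite B"
    using independent_span_bound[OF W(3) B(2)] B(1) W(2) by auto
  have spanB: "span B = W" using B span_minimal[OF B(1) W(1)] by auto
  have W0: "0 \<in> W" using W(1) by (rule subspace_0)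
  \<comment> \<open>Coordinates of \<open>g\<close> on the basis, cut off outside \<open>B\<close>
    so that all of them lie in the span of finitely many unit vectors.\<close>
  define F where "F g b = (if b \<in> B then g b else (0::real))" for g b
  obtain T where T: "linear T" "\<And>b. b \<in> B \<Longrightarrow> T b = F (A b)"
    using linear_independent_extend[OF B(2), of "\<lambda>b. F (A b)"] by blast
  have TF: "T \<theta> = F (A \<theta>)" if "\<theta> \<in> W" for \<theta>
  proof -
    have "subspace {\<theta>\<in>W. T \<theta> = F (A \<theta>)}"
      unfolding subspace_def
    proof (safe)
      show "0 \<in> W" by (rule W0)
      have "A 0 b = 0" if "b \<in> B" for b
        using linear_form_simps(4)[OF lin' W(1) W0 W0] that B(1) by auto
      then show "T 0 = F (A 0)" using T(1) by (auto simp: linear_0 F_def fun_eq_iff)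
    next
      fix x y assume xy: "x \<in> W" "T x = F (A x)" "y \<in> W" "T y = F (A y)"
      then show "x + y \<in> W" using W(1) by (auto intro: subspace_add)
      have "A (x + y) b = A x b + A y b" if "b \<in> B" for b
        using linear_form_simps(1)[OF lin' W(1) xy(1,3)] that B(1) by auto
      then show "T (x + y) = F (A (x + y))" using xy by (auto simp: linear_add[OF T(1)] F_def fun_eq_iff)
    next
      fix x c assume x: "x \<in> W" "T x = F (A x)"
      then show "c *\<^sub>R x \<in> W" using W(1) by (auto intro: subspace_scale)
      have "A (c *\<^sub>R x) b = c * A x b" if "b \<in> B" for b
        using linear_form_simps(3)[OF lin' W(1) x(1) x(1)] that B(1) by auto
      then show "T (c *\<^sub>R x) = F (A (c *\<^sub>R x))" using x by (auto simp: linear_scale[OF T(1)] F_def fun_eq_iff)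
    qed
    then have "span B \<subseteq> {\<theta>\<in>W. T \<theta> = F (A \<theta>)}" using T(2) B(1) by (intro span_minimal) auto
    then show ?thesis using that spanB by auto
  qed
  have ext: "\<forall>\<phi>\<in>W. g \<phi> = h \<phi>" if g: "linear_form W g" and h: "linear_form W h" and eq: "F g = F h" for g h
  proof -
    have "subspace {\<phi>\<in>W. g \<phi> = h \<phi>}"
      unfolding subspace_def using linear_form_simps[OF g W(1)] linear_form_simps[OF h W(1)] W0 W(1)
      by (auto intro: subspace_add subspace_scale)
    moreover have "B \<subseteq> {\<phi>\<in>W. g \<phi> = h \<phi>}" using eq B(1) by (auto simp: F_def fun_eq_iff split: if_splits)
    ultimately have "span B \<subseteq> {\<phi>\<in>W. g \<phi> = h \<phi>}" by (intro span_minimal)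
    then show ?thesis using spanB by auto
  qed
  have "inj_on T (span B)"
  proof (rule inj_onI)
    fix x y assume xy: "x \<in> span B" "y \<in> span B" "T x = T y"
    then have d: "x - y \<in> W" using spanB W(1) by (auto intro: subspace_diff)
    have "F (A (x - y)) = F (\<lambda>_. 0)"
      using TF[OF d] xy(3) by (simp add: linear_diff[OF T(1)] F_def fun_eq_iff)
    then have "\<forall>\<phi>\<in>W. A (x - y) \<phi> = 0"
      using ext[OF lin[OF d], of "\<lambda>_. 0"] by (simp add: linear_form_def)
    then show "x = y" using inj[OF d] by simp
  qed
  then have indT: "independent (T ` B)" and cardT: "card (T ` B) = card B"
    by (rule linear_independent_injective_image[OF T(1) B(2)], rule card_image[OF inj_on_subset[OF _ span_superset]])
  define E where "E = (\<lambda>b x. if x = b then 1 else (0::real)) ` B"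
  have spanE: "F g \<in> span E" for g
  proof -
    have "F g = (\<Sum>b\<in>B. g b *\<^sub>R (\<lambda>x. if x = b then 1 else 0))"
    proof
      fix x
      show "F g x = (\<Sum>b\<in>B. g b *\<^sub>R (\<lambda>x. if x = b then 1 else 0)) x"
        using finB by (simp add: sum_fun_apply F_def if_distrib sum.delta' cong: if_cong)
    qed
    also have "\<dots> \<in> span E" by (intro span_sum span_scale span_base) (auto simp: E_def)
    finally show ?thesis .
  qed
  have finE: "finite E" "card E \<le> card B" unfolding E_def using finB by (auto intro: card_image_le)
  have TE: "T ` B \<subseteq> span E" using T(2) spanE by auto
  \<comment> \<open>Otherwise there would be \<open>card B + 1\<close> independent vectors in the
    span of \<open>E\<close>, which has at most \<open>card B\<close> elements.\<close>
  have "F l \<in> span (T ` B)"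
  proof (rule ccontr)
    assume n: "F l \<notin> span (T ` B)"
    then have "independent (insert (F l) (T ` B))" using indT by (simp add: independent_insertI)
    moreover have "insert (F l) (T ` B) \<subseteq> span E" using TE spanE by auto
    ultimately have "card (insert (F l) (T ` B)) \<le> card E"
      using independent_span_bound[OF finE(1)] by blast
    moreover have "F l \<notin> T ` B" using n span_base[of "F l" "T ` B"] by auto
    ultimately show False using finB finE(2) cardT by simp
  qed
  then obtain \<theta> where \<theta>: "\<theta> \<in> W" "T \<theta> = F l"
    using linear_span_image[OF T(1), of B] spanB by auto
  have "\<forall>\<phi>\<in>W. A \<theta> \<phi> = l \<phi>" using ext[OF lin[OF \<theta>(1)] l] TF[OF \<theta>(1)] \<theta>(2) by simp
  then show ?thesis using \<theta>(1) by blast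
qed

locale semi_hilbert =
  fixes V :: "'v::real_vector set" and ip :: "'v \<Rightarrow> 'v \<Rightarrow> real"
  assumes subspace_V: "subspace V"
    and ip_add: "x \<in> V \<Longrightarrow> y \<in> V \<Longrightarrow> z \<in> V \<Longrightarrow> ip (x + y) z = ip x z + ip y z"
    and ip_scale: "x \<in> V \<Longrightarrow> z \<in> V \<Longrightarrow> ip (c *\<^sub>R x) z = c * ip x z"
    and ip_sym: "x \<in> V \<Longrightarrow> z \<in> V \<Longrightarrow> ip x z = ip z x"
    and ip_nonneg: "x \<in> V \<Longrightarrow> 0 \<le> ip x x"
    and ip_complete: "(\<And>n. X n \<in> V) \<Longrightarrow>
       (\<And>e. e > 0 \<Longrightarrow> \<exists>N. \<forall>m\<ge>N. \<forall>n\<ge>N. sqrt (ip (X m - X n) (X m - X n)) < e) \<Longrightarrow>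
       \<exists>x\<in>V. (\<lambda>n::nat. sqrt (ip (X n - x) (X n - x))) \<longlonglongrightarrow> 0"
begin

definition nrm :: "'v \<Rightarrow> real" where "nrm x = sqrt (ip x x)"

lemma V_zero [simp]: "0 \<in> V"
  and V_add [intro, simp]: "x \<in> V \<Longrightarrow> y \<in> V \<Longrightarrow> x + y \<in> V"
  and V_diff [intro, simp]: "x \<in> V \<Longrightarrow> y \<in> V \<Longrightarrow> x - y \<in> V"
  and V_minus [intro, simp]: "x \<in> V \<Longrightarrow> - x \<in> V"
  and V_scale [intro, simp]: "x \<in> V \<Longrightarrow> c *\<^sub>R x \<in> V"
  using subspace_V by (auto intro: subspace_0 subspace_add subspace_diff subspace_scale subspace_neg)

lemma ip_diff: "x \<in> V \<Longrightarrow> y \<in> V \<Longrightarrow> z \<in> V \<Longrightarrow> ip (x - y) z = ip x z - ip y z"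
  using ip_add[of x "(-1) *\<^sub>R y" z] ip_scale[of y z "-1"] by auto

lemma ip_add_right: "x \<in> V \<Longrightarrow> y \<in> V \<Longrightarrow> z \<in> V \<Longrightarrow> ip z (x + y) = ip z x + ip z y"
  by (metis V_add ip_add ip_sym)

lemma ip_diff_right: "x \<in> V \<Longrightarrow> y \<in> V \<Longrightarrow> z \<in> V \<Longrightarrow> ip z (x - y) = ip z x - ip z y"
  by (metis V_diff ip_diff ip_sym)

lemma ip_scale_right: "x \<in> V \<Longrightarrow> z \<in> V \<Longrightarrow> ip z (c *\<^sub>R x) = c * ip z x"
  by (metis V_scale ip_scale ip_sym)

lemma ip_zero [simp]: "z \<in> V \<Longrightarrow> ip 0 z = 0" "z \<in> V \<Longrightarrow> ip z 0 = 0"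
  using ip_scale[of 0 z 0] ip_scale_right[of 0 z 0] by auto

lemmas ip_simps = ip_add ip_diff ip_scale ip_add_right ip_diff_right ip_scale_right

lemma nrm_nonneg [simp]: "x \<in> V \<Longrightarrow> 0 \<le> nrm x"
  by (simp add: nrm_def ip_nonneg)

lemma nrm_sq: "x \<in> V \<Longrightarrow> (nrm x)\<^sup>2 = ip x x"
  by (simp add: nrm_def ip_nonneg)

lemma nrm_zero [simp]: "nrm 0 = 0"
  by (simp add: nrm_def)

lemma nrm_scale: "x \<in> V \<Longrightarrow> nrm (c *\<^sub>R x) = \<bar>c\<bar> * nrm x"
  by (simp add: nrm_def ip_scale ip_scale_right V_scale real_sqrt_mult flip: mult.assoc power2_eq_square)

lemma nrm_minus_commute: "x \<in> V \<Longrightarrow> y \<in> V \<Longrightarrow> nrm (x - y) = nrm (y - x)"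
  using nrm_scale[of "x - y" "-1"] by (simp add: V_diff)

text \<open>The quadratic \<open>ip (x - t *\<^sub>R y) (x - t *\<^sub>R y)\<close> in
  \<open>t\<close> is nonnegative. As \<open>ip\<close> is only semidefinite,
  \<open>ip y y = 0\<close> does not give \<open>y = 0\<close>; the quadratic is then affine in
  \<open>t\<close>, which forces \<open>ip x y = 0\<close>.\<close>

lemma cauchy_schwarz:
  assumes "x \<in> V" "y \<in> V"
  shows "\<bar>ip x y\<bar> \<le> nrm x * nrm y"
proof -
  have *: "0 \<le> ip x x - 2 * t * ip x y + t\<^sup>2 * ip y y" for t
  proof -
    have "0 \<le> ip (x - t *\<^sub>R y) (x - t *\<^sub>R y)" using assms by (intro ip_nonneg) auto
    also have "\<dots> = ip x x - 2 * t * ip x y + t\<^sup>2 * ip y y"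
      using assms by (simp add: ip_simps V_diff V_scale ip_sym[of y x] algebra_simps power2_eq_square)
    finally show ?thesis .
  qed
  have "(ip x y)\<^sup>2 \<le> ip x x * ip y y"
  proof (cases "ip y y = 0")
    case True
    have "ip x y = 0"
    proof (rule ccontr)
      assume "ip x y \<noteq> 0"
      \<comment> \<open>This value of \<open>t\<close> would give the nonnegative quadratic the
        value -1.\<close>
      then show False using *[of "(ip x x + 1) / (2 * ip x y)"] True by simp
    qed
    then show ?thesis using True by simp
  next
    case False
    then have pos: "ip y y > 0" using ip_nonneg[OF assms(2)] by simp
    show ?thesis using *[of "ip x y / ip y y"] pos
      by (simp add: field_simps power2_eq_square)
  qed
  then have "sqrt ((ip x y)\<^sup>2) \<le> sqrt (ip x x * ip y y)" by (rule real_sqrt_le_mono)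
  then show ?thesis by (simp add: nrm_def real_sqrt_mult)
qed

lemma nrm_triangle:
  assumes "x \<in> V" "y \<in> V"
  shows "nrm (x + y) \<le> nrm x + nrm y"
proof (rule power2_le_imp_le)
  have "(nrm (x + y))\<^sup>2 = (nrm x)\<^sup>2 + 2 * ip x y + (nrm y)\<^sup>2"
    using assms by (simp add: nrm_sq V_add ip_simps ip_sym[of y x])
  also have "\<dots> \<le> (nrm x + nrm y)\<^sup>2"
    using cauchy_schwarz[OF assms] by (simp add: power2_sum)
  finally show "(nrm (x + y))\<^sup>2 \<le> (nrm x + nrm y)\<^sup>2" .
qed (use assms in simp)

lemma nrm_triangle_diff:
  assumes "x \<in> V" "y \<in> V"
  shows "nrm (x - y) \<le> nrm x + nrm y"
  using nrm_triangle[of x "(-1) *\<^sub>R y"] nrm_scale[of y "-1"] assms by auto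

lemma nrm_triangle_mid:
  assumes "x \<in> V" "y \<in> V" "z \<in> V"
  shows "nrm (x - z) \<le> nrm (x - y) + nrm (y - z)"
  using nrm_triangle[of "x - y" "y - z"] assms by auto

lemma complete_nrm:
  assumes "\<And>n. X n \<in> V" "\<And>e. e > 0 \<Longrightarrow> \<exists>N. \<forall>m\<ge>N. \<forall>n\<ge>N. nrm (X m - X n) < e"
  shows "\<exists>x\<in>V. (\<lambda>n::nat. nrm (X n - x)) \<longlonglongrightarrow> 0"
  using ip_complete[of X] assms unfolding nrm_def by blast

lemma ip_tendsto:
  assumes "\<And>n. X n \<in> V" "x \<in> V" "y \<in> V" "(\<lambda>n::nat. nrm (X n - x)) \<longlonglongrightarrow> 0"
  shows "(\<lambda>n. ip (X n) y) \<longlonglongrightarrow> ip x y"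
proof (rule LIM_zero_cancel, rule Lim_null_comparison)
  show "\<forall>\<^sub>F n in sequentially. norm (ip (X n) y - ip x y) \<le> nrm (X n - x) * nrm y"
    by (rule always_eventually) (use cauchy_schwarz[of "X _ - x" y] assms in \<open>auto simp flip: ip_diff\<close>)
  show "(\<lambda>n. nrm (X n - x) * nrm y) \<longlonglongrightarrow> 0"
    using tendsto_mult_left_zero[OF assms(4)] by simp
qed

text \<open>\<open>Z\<close> is not assumed closed, so the minimiser of the distance is only a limit
  of elements of \<open>Z\<close>. This suffices for both uses: the kernel of a bounded functional,
  and the range of an adjoint that is to be shown dense.\<close>

lemma projection:
  assumes Z: "subspace Z" "Z \<subseteq> V" and x: "x \<in> V"
  shows "\<exists>p\<in>V. (\<exists>z. (\<forall>n::nat. z n \<in> Z) \<and> (\<lambda>n. nrm (z n - p)) \<longlonglongrightarrow> 0) \<and> (\<forall>y\<in>Z. ip (x - p) y = 0)"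
proof -
  define q where "q z = ip (x - z) (x - z)" for z
  define d where "d = (INF z\<in>Z. q z)"
  have ZV: "z \<in> V" if "z \<in> Z" for z using that Z by auto
  have bdd: "bdd_below (q ` Z)"
    by (rule bdd_belowI[of _ 0]) (use ZV x in \<open>auto simp: q_def intro!: ip_nonneg\<close>)
  have Zne: "Z \<noteq> {}" using Z(1) subspace_0 by auto
  have d_le: "d \<le> q z" if "z \<in> Z" for z unfolding d_def using bdd that by (rule cINF_lower)
  have "\<exists>z\<in>Z. q z < d + 1 / (real n + 1)" for n
  proof -
    have "Inf (q ` Z) < d + 1 / (real n + 1)" unfolding d_def by simp
    then show ?thesis using cInf_lessD[of "q ` Z"] Zne by blast
  qed
  then obtain z where z: "z n \<in> Z" "q (z n) < d + 1 / (real n + 1)" for n by metis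
  note zV = ZV[OF z(1)]
  \<comment> \<open>Parallelogram identity: the midpoint is again in \<open>Z\<close>, so its
    squared distance to \<open>x\<close> is at least \<open>d\<close>, and a minimising sequence is
    Cauchy.\<close>
  have par: "ip (z m - z n) (z m - z n) \<le> 2 / (real m + 1) + 2 / (real n + 1)" for m n
  proof -
    have mid: "(1/2) *\<^sub>R (z m + z n) \<in> Z" using z(1) Z(1) by (intro subspace_scale subspace_add)
    have "ip (z m - z n) (z m - z n) = 2 * q (z m) + 2 * q (z n) - 4 * q ((1/2) *\<^sub>R (z m + z n))"
      using zV x unfolding q_def
      by (simp add: ip_simps V_diff V_add V_scale ip_sym[of "z n" "z m"] ip_sym[of x "z m"] ip_sym[of x "z n"] algebra_simps)
    then show ?thesis using z(2)[of m] z(2)[of n] d_le[OF mid] by simp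
  qed
  have "\<exists>N. \<forall>m\<ge>N. \<forall>n\<ge>N. nrm (z m - z n) < e" if "e > 0" for e
  proof -
    obtain N where N: "4 / e\<^sup>2 < real N" using reals_Archimedean2 by blast
    have "nrm (z m - z n) < e" if "m \<ge> N" "n \<ge> N" for m n
    proof -
      have e2: "4 / e\<^sup>2 < real N + 1" using N by simp
      have "2 / (real m + 1) + 2 / (real n + 1) \<le> 2 / (real N + 1) + 2 / (real N + 1)"
        using that by (intro add_mono divide_left_mono) auto
      also have "\<dots> = 4 / (real N + 1)" by simp
      also have "\<dots> < e\<^sup>2" using e2 \<open>e > 0\<close> by (simp add: field_simps)
      finally have "ip (z m - z n) (z m - z n) < e\<^sup>2" using par[of m n] by simp
      then have "sqrt (ip (z m - z n) (z m - z n)) < sqrt (e\<^sup>2)" by (rule real_sqrt_less_mono)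
      then show ?thesis using \<open>e > 0\<close> by (simp add: nrm_def)
    qed
    then show ?thesis by blast
  qed
  from complete_nrm[OF zV this] obtain p where p: "p \<in> V" "(\<lambda>n. nrm (z n - p)) \<longlonglongrightarrow> 0" by auto
  \<comment> \<open>First variation: \<open>z n + t *\<^sub>R y\<close> is a competitor in
    \<open>Z\<close>, and the defect 1 / (n + 1) of \<open>z n\<close> disappears in the
    limit.\<close>
  have le: "2 * t * ip (x - p) y \<le> t\<^sup>2 * ip y y" if y: "y \<in> Z" for y t
  proof -
    have yV: "y \<in> V" using ZV y .
    have "2 * t * (ip x y - ip (z n) y) - t\<^sup>2 * ip y y \<le> 1 / (real n + 1)" for n
    proof -
      have "z n + t *\<^sub>R y \<in> Z" using z(1) y Z(1) by (intro subspace_scale subspace_add)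
      then have "d \<le> q (z n + t *\<^sub>R y)" by (rule d_le)
      also have "\<dots> = q (z n) - 2 * t * (ip x y - ip (z n) y) + t\<^sup>2 * ip y y"
        using zV[of n] yV x unfolding q_def
        by (simp add: ip_simps V_diff V_add V_scale ip_sym[of y x] ip_sym[of y "z n"] ip_sym[of "z n" x] algebra_simps power2_eq_square)
      finally show ?thesis using z(2)[of n] by simp
    qed
    moreover have "(\<lambda>n. 2 * t * (ip x y - ip (z n) y) - t\<^sup>2 * ip y y) \<longlonglongrightarrow> 2 * t * (ip x y - ip p y) - t\<^sup>2 * ip y y"
      by (intro tendsto_intros ip_tendsto zV p yV)
    moreover have "(\<lambda>n. 1 / (real n + 1)) \<longlonglongrightarrow> 0" using LIMSEQ_inverse_real_of_nat by (simp add: inverse_eq_divide add.commute)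
    ultimately have "2 * t * (ip x y - ip p y) - t\<^sup>2 * ip y y \<le> 0"
      by (intro LIMSEQ_le[of _ _ "\<lambda>n. 1 / (real n + 1)"]) auto
    then show ?thesis using x p(1) yV by (simp add: ip_diff)
  qed
  have "ip (x - p) y = 0" if y: "y \<in> Z" for y
  proof (cases "ip y y = 0")
    case True
    then show ?thesis using le[OF y, of "ip (x - p) y"] by (auto simp: mult_le_0_iff)
  next
    case False
    then have pos: "ip y y > 0" using ip_nonneg[OF ZV[OF y]] by simp
    have "2 * (ip (x - p) y)\<^sup>2 \<le> (ip (x - p) y)\<^sup>2"
      using le[OF y, of "ip (x - p) y / ip y y"] pos by (simp add: field_simps power2_eq_square)
    then show ?thesis by simp
  qed
  then show ?thesis using p z by blast
qed

lemma linear_form_ip: "x \<in> V \<Longrightarrow> W \<subseteq> V \<Longrightarrow> linear_form W (ip x)"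
  unfolding linear_form_def by (auto simp: ip_simps subset_iff V_scale)

text \<open>The representative is a multiple of the component \<open>y\<close> of some
  \<open>x\<close> orthogonal to the kernel. Boundedness is used twice: it keeps the limit
  \<open>p\<close> in the kernel, and it gives \<open>ip y y\<close> \<noteq> 0 although
  \<open>ip\<close> is only semidefinite.\<close>

lemma riesz:
  assumes l: "linear_form V l" and bd: "\<And>x. x \<in> V \<Longrightarrow> \<bar>l x\<bar> \<le> C * nrm x"
  shows "\<exists>z\<in>V. \<forall>x\<in>V. ip z x = l x"
proof (cases "\<forall>x\<in>V. l x = 0")
  case True
  then show ?thesis by (intro bexI[of _ 0]) auto
next
  case False
  then obtain x where x: "x \<in> V" "l x \<noteq> 0" by auto
  note ls = linear_form_simps[OF l subspace_V]
  define Z where "Z = {z \<in> V. l z = 0}"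
  have Z: "subspace Z" "Z \<subseteq> V" unfolding Z_def subspace_def using ls(4)[OF V_zero V_zero] by (auto simp: ls(1,3))
  obtain p z where p: "p \<in> V" "\<And>n::nat. z n \<in> Z" "(\<lambda>n. nrm (z n - p)) \<longlonglongrightarrow> 0" and orth: "\<And>y. y \<in> Z \<Longrightarrow> ip (x - p) y = 0"
    using projection[OF Z x(1)] by blast
  have zV: "z n \<in> V" "l (z n) = 0" for n using p(2) by (auto simp: Z_def)
  have "(\<lambda>n. C * nrm (z n - p)) \<longlonglongrightarrow> 0" using tendsto_mult_right_zero[OF p(3)] by simp
  moreover have "\<bar>l p\<bar> \<le> C * nrm (z n - p)" for n
    using bd[of "z n - p"] zV p(1) by (auto simp: ls)
  ultimately have lp: "l p = 0"
    using LIMSEQ_le_const[of "\<lambda>n. C * nrm (z n - p)" 0 "\<bar>l p\<bar>"] by auto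
  define y where "y = x - p"
  have y: "y \<in> V" "l y = l x" using x p lp by (auto simp: y_def ls)
  \<comment> \<open>The combination \<open>l x *\<^sub>R v - l v *\<^sub>R y\<close> lies in the
    kernel, hence is orthogonal to \<open>y\<close>.\<close>
  have key: "ip y v * l x = l v * ip y y" if v: "v \<in> V" for v
  proof -
    have "l x *\<^sub>R v - l v *\<^sub>R y \<in> Z"
      using v y ls(2)[of "l x *\<^sub>R v" "l v *\<^sub>R y"] ls(3)[OF v v] ls(3)[OF y(1) y(1)]
      by (auto simp: Z_def)
    then have "ip y (l x *\<^sub>R v - l v *\<^sub>R y) = 0" using orth by (simp add: y_def)
    then show ?thesis using v y by (simp add: ip_simps V_scale algebra_simps)
  qed
  have "ip y y \<noteq> 0"
  proof
    assume 0: "ip y y = 0"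
    have "\<bar>l y\<bar> \<le> C * nrm y" by (rule bd[OF y(1)])
    then show False using 0 y x by (simp add: nrm_def)
  qed
  then show ?thesis using key y x
    by (intro bexI[of _ "(l x / ip y y) *\<^sub>R y"] ballI) (auto simp: ip_scale field_simps)
qed

text \<open>A gliding hump: if the estimate fails along unit vectors \<open>e n\<close>, the sum of
  \<open>\<plusminus>(1/3)^n *\<^sub>R e n\<close>, with signs avoiding cancellation, represents a functional outside the range.\<close>

lemma adjoint_bounded_below:
  assumes surj: "\<And>s. s \<in> V \<Longrightarrow> \<exists>\<theta>\<in>V. \<forall>\<phi>\<in>V. B \<theta> \<phi> = ip s \<phi>"
    and lin: "\<And>\<theta>. \<theta> \<in> V \<Longrightarrow> linear_form V (B \<theta>)"
  shows "\<exists>C. \<forall>\<phi>\<in>V. \<forall>c\<ge>0. (\<forall>\<theta>\<in>V. \<bar>B \<theta> \<phi>\<bar> \<le> c * nrm \<theta>) \<longrightarrow> nrm \<phi> \<le> C * c"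
proof (rule ccontr)
  assume neg: "\<not> ?thesis"
  \<comment> \<open>The ratio 1/9 is the square of the ratio 1/3 of the coefficients: along
    \<open>e n\<close> the form \<open>B \<theta>\<close> decays faster than the n-th coefficient,
    for every fixed \<theta>.\<close>
  have "\<exists>e\<in>V. nrm e = 1 \<and> (\<forall>\<theta>\<in>V. \<bar>B \<theta> e\<bar> \<le> (1/9)^n * nrm \<theta>)" for n :: nat
  proof -
    from neg obtain \<phi> c where \<phi>: "\<phi> \<in> V" "\<And>\<theta>. \<theta> \<in> V \<Longrightarrow> \<bar>B \<theta> \<phi>\<bar> \<le> c * nrm \<theta>" "9^n * c < nrm \<phi>" "c \<ge> 0"
      by (metis not_le)
    have "0 \<le> 9 ^ n * c" using \<phi>(4) by simp
    then have pos: "nrm \<phi> > 0" using \<phi>(3) by linarith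
    have "\<bar>B \<theta> ((1 / nrm \<phi>) *\<^sub>R \<phi>)\<bar> \<le> (1/9)^n * nrm \<theta>" if \<theta>: "\<theta> \<in> V" for \<theta>
    proof -
      have "\<bar>B \<theta> ((1 / nrm \<phi>) *\<^sub>R \<phi>)\<bar> = \<bar>B \<theta> \<phi>\<bar> / nrm \<phi>"
        using linear_form_simps(3)[OF lin[OF \<theta>] subspace_V \<phi>(1) \<phi>(1)] pos by (simp add: abs_mult)
      also have "\<dots> \<le> c * nrm \<theta> / nrm \<phi>" using \<phi>(2)[OF \<theta>] pos by (simp add: divide_right_mono)
      also have "\<dots> = (c / nrm \<phi>) * nrm \<theta>" by simp
      also have "\<dots> \<le> (1/9)^n * nrm \<theta>"
        using \<phi>(3) pos \<theta> by (intro mult_right_mono) (auto simp: field_simps power_divide)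
      finally show ?thesis .
    qed
    then show ?thesis using \<phi>(1) pos by (intro bexI[of _ "(1 / nrm \<phi>) *\<^sub>R \<phi>"]) (auto simp: nrm_scale)
  qed
  then obtain e where e: "\<And>n. e n \<in> V" "\<And>n. nrm (e n) = 1" "\<And>n \<theta>. \<theta> \<in> V \<Longrightarrow> \<bar>B \<theta> (e n)\<bar> \<le> (1/9)^n * nrm \<theta>"
    by metis
  \<comment> \<open>The sign follows that of \<open>ip t (e n)\<close>, so adding the new multiple
    of \<open>e n\<close> cannot reduce the component along \<open>e n\<close>.\<close>
  define s where "s = rec_nat 0 (\<lambda>n t. t + (if ip t (e n) \<ge> 0 then (1/3)^n else - ((1/3)^n)) *\<^sub>R e n)"
  have s0: "s 0 = 0" and sS: "s (Suc n) = s n + (if ip (s n) (e n) \<ge> 0 then (1/3)^n else - ((1/3)^n)) *\<^sub>R e n" for n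
    by (simp_all add: s_def)
  have sV: "s n \<in> V" for n by (induction n) (auto simp: s0 sS e(1) simp del: if_split intro!: V_add V_scale)
  have step: "nrm (s (Suc n) - s n) = (1/3)^n" for n by (simp add: sS nrm_scale e)
  have tail: "nrm (s (n + k) - s n) \<le> (3/2) * (1/3)^n - (3/2) * (1/3)^(n+k)" for n k
  proof (induction k)
    case (Suc k)
    have "nrm (s (n + Suc k) - s n) \<le> nrm (s (Suc (n + k)) - s (n + k)) + nrm (s (n + k) - s n)"
      using nrm_triangle_mid sV by simp
    then show ?case using Suc step[of "n + k"] by simp
  qed simp
  have tail': "nrm (s m - s n) \<le> (3/2) * (1/3)^n" if "m \<ge> n" for m n
  proof -
    have "nrm (s m - s n) \<le> (3/2) * (1/3)^n - (3/2) * (1/3)^m"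
      using tail[of n "m - n"] le_add_diff_inverse[OF that] by metis
    moreover have "0 \<le> (1/3::real)^m" by simp
    ultimately show ?thesis by linarith
  qed
  have "\<exists>N. \<forall>m\<ge>N. \<forall>n\<ge>N. nrm (s m - s n) < d" if "d > 0" for d
  proof -
    obtain N where N: "(1/3::real)^N < d / 3" using real_arch_pow_inv[of "d/3" "1/3"] \<open>d > 0\<close> by auto
    have "nrm (s m - s n) < d" if "m \<ge> N" "n \<ge> N" for m n
    proof -
      have "nrm (s m - s n) \<le> nrm (s m - s N) + nrm (s N - s n)" using nrm_triangle_mid sV by simp
      also have "nrm (s N - s n) = nrm (s n - s N)" using nrm_minus_commute sV by simp
      finally show ?thesis using tail'[OF that(1)] tail'[OF that(2)] N by simp
    qed
    then show ?thesis by blast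
  qed
  from complete_nrm[OF sV this] obtain t where t: "t \<in> V" "(\<lambda>n. nrm (s n - t)) \<longlonglongrightarrow> 0" by auto
  have lim: "nrm (t - s n) \<le> (3/2) * (1/3)^n" for n
  proof -
    have "(\<lambda>m. nrm (s m - t) + (3/2) * (1/3)^n) \<longlonglongrightarrow> 0 + (3/2) * (1/3)^n" by (intro tendsto_intros t)
    moreover have "nrm (t - s n) \<le> nrm (s m - t) + (3/2) * (1/3)^n" if "m \<ge> n" for m
      using nrm_triangle_mid[of t "s m" "s n"] nrm_minus_commute[of t "s m"] tail'[OF that] sV t by simp
    ultimately show ?thesis
      using LIMSEQ_le_const[of "\<lambda>m. nrm (s m - t) + (3/2) * (1/3)^n" "(3/2) * (1/3)^n" "nrm (t - s n)"] by auto
  qed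
  \<comment> \<open>The n-th step leaves a component of size at least (1/3)^n along
    \<open>e n\<close>; all later steps together have norm at most (3/2) (1/3)^(n+1), which is half
    of it.\<close>
  have big: "(1/3)^n / 2 \<le> \<bar>ip t (e n)\<bar>" for n
  proof -
    have "ip (s (Suc n)) (e n) = ip (s n) (e n) + (if ip (s n) (e n) \<ge> 0 then (1/3)^n else - ((1/3)^n)) * ip (e n) (e n)"
      using sV e(1) by (simp add: sS ip_simps V_scale)
    moreover have "ip (e n) (e n) = 1" using e nrm_sq[of "e n"] by simp
    ultimately have "(1/3)^n \<le> \<bar>ip (s (Suc n)) (e n)\<bar>" by auto
    moreover have "\<bar>ip t (e n) - ip (s (Suc n)) (e n)\<bar> \<le> (3/2) * (1/3)^(Suc n)"
      using cauchy_schwarz[of "t - s (Suc n)" "e n"] lim[of "Suc n"] sV t e by (simp add: ip_diff V_diff)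
    moreover have "(1/3::real)^(Suc n) = (1/3)^n / 3" by simp
    ultimately show ?thesis by linarith
  qed
  obtain \<theta> where \<theta>: "\<theta> \<in> V" "\<And>\<phi>. \<phi> \<in> V \<Longrightarrow> B \<theta> \<phi> = ip t \<phi>" using surj[OF t(1)] by auto
  \<comment> \<open>With q = (1/3)^n, testing with \<open>e n\<close> gives q/2 \<le> q^2
    \<open>nrm \<theta>\<close>, which fails once q is below this threshold.\<close>
  have "\<exists>n. (1/3::real)^n < 1 / (2 * (nrm \<theta> + 1))"
    by (rule real_arch_pow_inv) (use nrm_nonneg[OF \<theta>(1)] in simp_all)
  then obtain n where n: "(1/3::real)^n < 1 / (2 * (nrm \<theta> + 1))" by blast
  define q where "q = (1/3::real)^n"
  have "q < 1 / (2 * (nrm \<theta> + 1))" using n unfolding q_def .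
  moreover have "0 < 2 * (nrm \<theta> + 1)" using nrm_nonneg[OF \<theta>(1)] by simp
  ultimately have q: "q > 0" "q * (2 * (nrm \<theta> + 1)) < 1"
    by (simp_all only: pos_less_divide_eq) (simp add: q_def)
  have q9: "(1/9::real)^n = q * q" by (simp add: q_def flip: power_mult_distrib)
  have "q / 2 \<le> \<bar>ip t (e n)\<bar>" using big[of n] unfolding q_def .
  also have "\<dots> \<le> q * q * nrm \<theta>" using e(3)[OF \<theta>(1), of n] \<theta>(2)[OF e(1)[of n]] unfolding q9 by simp
  finally have "q * (1 / 2) \<le> q * (q * nrm \<theta>)" by (simp add: mult.assoc)
  then have "1 / 2 \<le> q * nrm \<theta>" using q(1) by (simp only: mult_le_cancel_left_pos)
  then show False using q by (simp add: distrib_left)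
qed

text \<open>\<open>Z\<close> is the range of the adjoint. Anything orthogonal to \<open>Z\<close> is
  annihilated by \<open>B\<close>, so by injectivity \<open>Z\<close> is dense for the seminorm. On
  \<open>Z\<close> the adjoint has a bounded inverse by \<open>adjoint_bounded_below\<close>, and
  this bound passes to \<open>B\<close> by approximating \<open>x\<close> itself from
  \<open>Z\<close> and pairing with \<open>x\<close>.\<close>

lemma bounded_inverse:
  assumes surj: "\<And>s. s \<in> V \<Longrightarrow> \<exists>\<theta>\<in>V. \<forall>\<phi>\<in>V. B \<theta> \<phi> = ip s \<phi>"
    and lin: "\<And>\<theta>. \<theta> \<in> V \<Longrightarrow> linear_form V (B \<theta>)"
    and lin': "\<And>\<phi>. \<phi> \<in> V \<Longrightarrow> linear_form V (\<lambda>\<theta>. B \<theta> \<phi>)"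
    and bd: "\<And>\<theta> \<phi>. \<theta> \<in> V \<Longrightarrow> \<phi> \<in> V \<Longrightarrow> \<bar>B \<theta> \<phi>\<bar> \<le> M * nrm \<theta> * nrm \<phi>"
    and inj: "\<And>\<theta>. \<theta> \<in> V \<Longrightarrow> (\<And>\<phi>. \<phi> \<in> V \<Longrightarrow> B \<theta> \<phi> = 0) \<Longrightarrow> nrm \<theta> = 0"
  shows "\<exists>\<beta>>0. \<forall>x\<in>V. \<forall>c\<ge>0. (\<forall>\<phi>\<in>V. \<bar>B x \<phi>\<bar> \<le> c * nrm \<phi>) \<longrightarrow> \<beta> * nrm x \<le> c"
proof -
  obtain C0 where C0: "\<And>\<phi> c. \<phi> \<in> V \<Longrightarrow> c \<ge> 0 \<Longrightarrow> (\<forall>\<theta>\<in>V. \<bar>B \<theta> \<phi>\<bar> \<le> c * nrm \<theta>) \<Longrightarrow> nrm \<phi> \<le> C0 * c"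
    using adjoint_bounded_below[OF surj lin] by blast
  define C where "C = \<bar>C0\<bar> + 1"
  have C: "C > 0" by (simp add: C_def)
  define Z where "Z = {z \<in> V. \<exists>\<phi>\<in>V. \<forall>\<theta>\<in>V. B \<theta> \<phi> = ip \<theta> z}"
  have Z: "Z \<subseteq> V" "subspace Z"
  proof -
    show "Z \<subseteq> V" by (auto simp: Z_def)
    have 0: "B \<theta> 0 = 0" if "\<theta> \<in> V" for \<theta> using linear_form_simps(4)[OF lin[OF that] subspace_V V_zero V_zero] .
    have 1: "B \<theta> (x + y) = B \<theta> x + B \<theta> y" "B \<theta> (c *\<^sub>R x) = c * B \<theta> x"
      if "\<theta> \<in> V" "x \<in> V" "y \<in> V" for \<theta> x y c using linear_form_simps[OF lin[OF that(1)] subspace_V that(2,3)] by auto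
    show "subspace Z"
      unfolding subspace_def Z_def
    proof (safe)
      show "\<exists>\<phi>\<in>V. \<forall>\<theta>\<in>V. B \<theta> \<phi> = ip \<theta> 0" by (rule bexI[of _ 0]) (auto simp: 0)
    next
      fix x y a b assume "x \<in> V" "a \<in> V" "\<forall>\<theta>\<in>V. B \<theta> a = ip \<theta> x" "y \<in> V" "b \<in> V" "\<forall>\<theta>\<in>V. B \<theta> b = ip \<theta> y"
      then show "\<exists>\<phi>\<in>V. \<forall>\<theta>\<in>V. B \<theta> \<phi> = ip \<theta> (x + y)"
        by (intro bexI[of _ "a + b"]) (auto simp: 1 ip_simps)
    next
      fix x a c assume "x \<in> V" "a \<in> V" "\<forall>\<theta>\<in>V. B \<theta> a = ip \<theta> x"
      then show "\<exists>\<phi>\<in>V. \<forall>\<theta>\<in>V. B \<theta> \<phi> = ip \<theta> (c *\<^sub>R x)"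
        by (intro bexI[of _ "c *\<^sub>R a"]) (auto simp: 1 ip_simps)
    qed auto
  qed
  show ?thesis
  proof (intro exI[of _ "1 / C"] conjI ballI allI impI)
    fix x c assume x: "x \<in> V" and c0: "0 \<le> c" and c: "\<forall>\<phi>\<in>V. \<bar>B x \<phi>\<bar> \<le> c * nrm \<phi>"
    obtain p z where p: "p \<in> V" "\<And>n::nat. z n \<in> Z" "(\<lambda>n. nrm (z n - p)) \<longlonglongrightarrow> 0" and orth: "\<And>y. y \<in> Z \<Longrightarrow> ip (x - p) y = 0"
      using projection[OF Z(2,1) x] by blast
    have xp: "x - p \<in> V" using x p by auto
    \<comment> \<open>The Riesz representative of \<theta> \<mapsto>
      \<open>B \<theta> \<phi>\<close> belongs to \<open>Z\<close>, to which \<open>x - p\<close> is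
      orthogonal.\<close>
    have "B (x - p) \<phi> = 0" if \<phi>: "\<phi> \<in> V" for \<phi>
    proof -
      obtain y where y: "y \<in> V" "\<And>\<theta>. \<theta> \<in> V \<Longrightarrow> ip y \<theta> = B \<theta> \<phi>"
        using riesz[OF lin'[OF \<phi>], of "M * nrm \<phi>"] bd[OF _ \<phi>] by (auto simp: mult_ac)
      then have "y \<in> Z" using \<phi> by (auto simp: Z_def ip_sym)
      from orth[OF this] show ?thesis using y xp ip_sym by metis
    qed
    then have null: "nrm (x - p) = 0" using inj[OF xp] by blast
    have zV: "z n \<in> V" for n using p(2) Z(1) by auto
    have zx: "(\<lambda>n. nrm (z n - x)) \<longlonglongrightarrow> 0"
    proof (rule Lim_null_comparison[OF _ p(3)])
      show "\<forall>\<^sub>F n in sequentially. norm (nrm (z n - x)) \<le> nrm (z n - p)"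
        using nrm_triangle_mid[OF zV p(1) x] null nrm_minus_commute[OF x p(1)] zV x by (auto simp: V_diff)
    qed
    \<comment> \<open>\<open>z n\<close> comes from some \<phi> with norm at most
      \<open>C * nrm (z n)\<close>, and the assumed bound on \<open>B x\<close> is applied to this
      \<phi>.\<close>
    have est: "ip (z n) x \<le> c * C * nrm (z n)" for n
    proof -
      obtain \<phi> where \<phi>: "\<phi> \<in> V" "\<And>\<theta>. \<theta> \<in> V \<Longrightarrow> B \<theta> \<phi> = ip \<theta> (z n)" using p(2)[of n] by (auto simp: Z_def)
      have "\<forall>\<theta>\<in>V. \<bar>B \<theta> \<phi>\<bar> \<le> nrm (z n) * nrm \<theta>" using cauchy_schwarz[OF _ zV] \<phi>(2) by (simp add: mult.commute)
      then have 1: "nrm \<phi> \<le> C * nrm (z n)"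
        using C0[OF \<phi>(1), of "nrm (z n)"] nrm_nonneg[OF zV] unfolding C_def by (smt (verit) mult_right_mono)
      have c\<phi>: "\<bar>B x \<phi>\<bar> \<le> c * nrm \<phi>" using c \<phi>(1) by auto
      have "ip (z n) x = B x \<phi>" using \<phi>(2)[OF x] ip_sym[OF zV x] by simp
      also have "\<dots> \<le> c * nrm \<phi>" using c\<phi> by simp
      also have "\<dots> \<le> c * (C * nrm (z n))"
        using 1 c0 by (simp add: mult_left_mono)
      finally show ?thesis by simp
    qed
    have l1: "(\<lambda>n. ip (z n) x) \<longlonglongrightarrow> ip x x" by (intro ip_tendsto zV x zx)
    have "(\<lambda>n. nrm (z n)) \<longlonglongrightarrow> nrm x"
    proof (rule LIM_zero_cancel, rule Lim_null_comparison[OF _ zx])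
      have "nrm (z n) \<le> nrm (z n - x) + nrm x" "nrm x \<le> nrm (z n - x) + nrm (z n)" for n
        using nrm_triangle[of "z n - x" x] nrm_triangle[of "x - z n" "z n"] nrm_minus_commute[OF x zV] x zV[of n] by auto
      then show "\<forall>\<^sub>F n in sequentially. norm (nrm (z n) - nrm x) \<le> nrm (z n - x)" by (auto simp: abs_le_iff algebra_simps)
    qed
    then have "(\<lambda>n. c * C * nrm (z n)) \<longlonglongrightarrow> c * C * nrm x" by (intro tendsto_intros)
    from LIMSEQ_le[OF l1 this] est have "(nrm x)\<^sup>2 \<le> c * C * nrm x" using x by (auto simp: nrm_sq)
    then show "1 / C * nrm x \<le> c"
    proof (cases "nrm x = 0")
      case True
      then show ?thesis using c0 by simp
    next
      case False
      then have "nrm x > 0" using nrm_nonneg[OF x] by linarith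
      with \<open>(nrm x)\<^sup>2 \<le> c * C * nrm x\<close> have "nrm x \<le> c * C" by (simp add: power2_eq_square)
      then show ?thesis using C by (simp add: field_simps)
    qed
  qed (use C in simp)
qed

end

section \<open>Quadratic problems and their Galerkin discretisation\<close>

locale ns_form = semi_hilbert V ip for V :: "'a::real_vector set" and ip +
  fixes \<Gamma> :: "'a \<Rightarrow> 'a \<Rightarrow> 'a \<Rightarrow> real" and F :: "'a \<Rightarrow> real" and G :: real
  assumes \<Gamma>_lin: "y \<in> V \<Longrightarrow> z \<in> V \<Longrightarrow> linear_form V (\<lambda>x. \<Gamma> x y z)"
      "x \<in> V \<Longrightarrow> z \<in> V \<Longrightarrow> linear_form V (\<lambda>y. \<Gamma> x y z)"
      "x \<in> V \<Longrightarrow> y \<in> V \<Longrightarrow> linear_form V (\<lambda>z. \<Gamma> x y z)"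
    and F_lin: "linear_form V F"
    and G_nonneg: "0 \<le> G"
    and \<Gamma>_bound: "x \<in> V \<Longrightarrow> y \<in> V \<Longrightarrow> z \<in> V \<Longrightarrow> \<bar>\<Gamma> x y z\<bar> \<le> G * nrm x * nrm y * nrm z"
begin

definition N :: "'a \<Rightarrow> 'a \<Rightarrow> real" where "N w v = ip w v - F v + \<Gamma> w w v"

definition DN :: "'a \<Rightarrow> 'a \<Rightarrow> 'a \<Rightarrow> real" where "DN w \<theta> \<phi> = ip \<theta> \<phi> + \<Gamma> w \<theta> \<phi> + \<Gamma> \<theta> w \<phi>"

lemma \<Gamma>_simps:
  assumes "x \<in> V" "x' \<in> V" "y \<in> V" "z \<in> V"
  shows "\<Gamma> (x + x') y z = \<Gamma> x y z + \<Gamma> x' y z" "\<Gamma> (x - x') y z = \<Gamma> x y z - \<Gamma> x' y z" "\<Gamma> (c *\<^sub>R x) y z = c * \<Gamma> x y z"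
    "\<Gamma> y (x + x') z = \<Gamma> y x z + \<Gamma> y x' z" "\<Gamma> y (x - x') z = \<Gamma> y x z - \<Gamma> y x' z" "\<Gamma> y (c *\<^sub>R x) z = c * \<Gamma> y x z"
    "\<Gamma> y z (x + x') = \<Gamma> y z x + \<Gamma> y z x'" "\<Gamma> y z (x - x') = \<Gamma> y z x - \<Gamma> y z x'" "\<Gamma> y z (c *\<^sub>R x) = c * \<Gamma> y z x"
  using linear_form_simps[OF \<Gamma>_lin(1) subspace_V assms(1,2)] linear_form_simps[OF \<Gamma>_lin(2) subspace_V assms(1,2)]
    linear_form_simps[OF \<Gamma>_lin(3) subspace_V assms(1,2)] assms by auto

lemma linear_form_DN:
  assumes "w \<in> V" "\<theta> \<in> V"
  shows "linear_form V (DN w \<theta>)" "linear_form V (\<lambda>x. DN w x \<theta>)"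
  using assms unfolding linear_form_def DN_def
  by (auto simp: ip_simps \<Gamma>_simps V_add V_scale algebra_simps)

lemma linear_form_N: "w \<in> V \<Longrightarrow> linear_form V (N w)"
  using linear_form_simps(1,3)[OF F_lin subspace_V]
  unfolding linear_form_def N_def
  by (auto simp: ip_simps \<Gamma>_simps V_add V_scale algebra_simps)

lemma linear_form_subset: "linear_form A l \<Longrightarrow> B \<subseteq> A \<Longrightarrow> linear_form B l"
  unfolding linear_form_def by blast

text \<open>The Taylor expansion is exact because \<open>N\<close> is quadratic in its first
  argument. Uniqueness, quasi-optimality, the Newton step and the fixed point equation all start
  from it, each with its own base point.\<close>

lemma N_expand:
  assumes "w \<in> V" "v \<in> V" "\<phi> \<in> V"
  shows "N w \<phi> = N v \<phi> + DN v (w - v) \<phi> + \<Gamma> (w - v) (w - v) \<phi>"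
  using assms unfolding N_def DN_def by (simp add: ip_simps \<Gamma>_simps V_diff algebra_simps)

lemma DN_bound:
  assumes "w \<in> V" "\<theta> \<in> V" "\<phi> \<in> V"
  shows "\<bar>DN w \<theta> \<phi>\<bar> \<le> (1 + 2 * G * nrm w) * nrm \<theta> * nrm \<phi>"
proof -
  have "\<bar>DN w \<theta> \<phi>\<bar> \<le> \<bar>ip \<theta> \<phi>\<bar> + \<bar>\<Gamma> w \<theta> \<phi>\<bar> + \<bar>\<Gamma> \<theta> w \<phi>\<bar>" unfolding DN_def by linarith
  also have "\<dots> \<le> nrm \<theta> * nrm \<phi> + G * nrm w * nrm \<theta> * nrm \<phi> + G * nrm \<theta> * nrm w * nrm \<phi>"
    using assms by (intro add_mono cauchy_schwarz \<Gamma>_bound)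
  finally show ?thesis by (simp add: algebra_simps)
qed

end

text \<open>\<open>S\<close> witnesses finite dimension. In \<open>infsup\<close> the supremum over
  test functions is replaced by its upper bounds \<open>c\<close>: the dual norm of
  \<open>DN u \<theta>\<close> on \<open>W\<close> is at least
  \<open>\<beta> * nrm \<theta>\<close>.\<close>

locale ns_discrete = ns_form V ip \<Gamma> F G
  for V :: "'v::real_vector set" and ip \<Gamma> F G +
  fixes W :: "'v set" and S :: "'v set" and u :: 'v and \<beta> :: real
  assumes W: "subspace W" "W \<subseteq> V" "W \<subseteq> span S" "finite S"
    and definite: "w \<in> W \<Longrightarrow> nrm w = 0 \<Longrightarrow> w = 0"
    and u: "u \<in> V" "v \<in> V \<Longrightarrow> N u v = 0"
    and \<beta>: "\<beta> > 0"
    and infsup: "\<theta> \<in> W \<Longrightarrow> c \<ge> 0 \<Longrightarrow> (\<And>\<phi>. \<phi> \<in> W \<Longrightarrow> \<bar>DN u \<theta> \<phi>\<bar> \<le> c * nrm \<phi>) \<Longrightarrow> \<beta> * nrm \<theta> \<le> c"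
begin

text \<open>Moving the base point of the derivative by 2 \<epsilon> costs 4 G \<epsilon> \<le>
  \<beta>/2, and a quadratic remainder at distance \<epsilon> costs at most \<beta>/8 times the
  error. Using \<open>G + 1\<close> keeps the quotient meaningful for \<open>G\<close> = 0.\<close>

definition \<epsilon> :: real where "\<epsilon> = \<beta> / (8 * (G + 1))"

lemma \<epsilon>: "\<epsilon> > 0" "8 * G * \<epsilon> \<le> \<beta>"
  using \<beta> G_nonneg by (auto simp: \<epsilon>_def field_simps)

lemma WV: "w \<in> W \<Longrightarrow> w \<in> V"
  using W(2) by auto

lemma W_closed: "0 \<in> W" "x \<in> W \<Longrightarrow> y \<in> W \<Longrightarrow> x + y \<in> W" "x \<in> W \<Longrightarrow> y \<in> W \<Longrightarrow> x - y \<in> W" "x \<in> W \<Longrightarrow> c *\<^sub>R x \<in> W"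
  using W(1) by (auto intro: subspace_0 subspace_add subspace_diff subspace_scale)

text \<open>\<open>DN\<close> is affine in its base point: passing from \<open>u\<close> to
  \<open>w\<close> changes it by two \<Gamma> terms of size at most 2 G \<epsilon> each, together at
  most half of \<beta>.\<close>

lemma infsup_near:
  assumes w: "w \<in> V" "nrm (w - u) \<le> 2 * \<epsilon>" and \<theta>: "\<theta> \<in> W" "c \<ge> 0"
    and bd: "\<And>\<phi>. \<phi> \<in> W \<Longrightarrow> \<bar>DN w \<theta> \<phi>\<bar> \<le> c * nrm \<phi>"
  shows "\<beta> / 2 * nrm \<theta> \<le> c"
proof -
  have "\<beta> * nrm \<theta> \<le> c + 4 * G * \<epsilon> * nrm \<theta>"
  proof (rule infsup)
    fix \<phi> assume \<phi>: "\<phi> \<in> W"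
    note V = w(1) u(1) WV[OF \<theta>(1)] WV[OF \<phi>]
    have "DN u \<theta> \<phi> = DN w \<theta> \<phi> - \<Gamma> (w - u) \<theta> \<phi> - \<Gamma> \<theta> (w - u) \<phi>"
      using V by (simp add: DN_def \<Gamma>_simps V_diff)
    then have "\<bar>DN u \<theta> \<phi>\<bar> \<le> \<bar>DN w \<theta> \<phi>\<bar> + \<bar>\<Gamma> (w - u) \<theta> \<phi>\<bar> + \<bar>\<Gamma> \<theta> (w - u) \<phi>\<bar>" by linarith
    also have "\<dots> \<le> c * nrm \<phi> + G * nrm (w - u) * nrm \<theta> * nrm \<phi> + G * nrm \<theta> * nrm (w - u) * nrm \<phi>"
      using V \<phi> by (intro add_mono bd \<Gamma>_bound V_diff) auto
    also have "\<dots> = c * nrm \<phi> + 2 * G * nrm \<theta> * nrm \<phi> * nrm (w - u)" by simp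
    also have "\<dots> \<le> c * nrm \<phi> + 2 * G * nrm \<theta> * nrm \<phi> * (2 * \<epsilon>)"
      using w(2) V G_nonneg by (intro add_left_mono mult_left_mono) auto
    finally show "\<bar>DN u \<theta> \<phi>\<bar> \<le> (c + 4 * G * \<epsilon> * nrm \<theta>) * nrm \<phi>" by (simp add: algebra_simps)
  qed (use \<theta> \<epsilon> G_nonneg WV in auto)
  moreover have "4 * G * \<epsilon> * nrm \<theta> \<le> \<beta> / 2 * nrm \<theta>"
    using \<epsilon>(2) WV[OF \<theta>(1)] by (intro mult_right_mono) auto
  ultimately show ?thesis by simp
qed

lemma DN_zero_imp:
  assumes "w \<in> V" "nrm (w - u) \<le> 2 * \<epsilon>" "\<theta> \<in> W" "\<And>\<phi>. \<phi> \<in> W \<Longrightarrow> DN w \<theta> \<phi> = 0"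
  shows "\<theta> = 0"
proof (rule definite[OF assms(3)])
  have "\<beta> / 2 * nrm \<theta> \<le> 0" using assms by (intro infsup_near) auto
  then show "nrm \<theta> = 0" using \<beta> nrm_nonneg[OF WV[OF assms(3)]] by (simp add: mult_le_0_iff)
qed

text \<open>The inf-sup condition gives uniqueness, and in finite dimension existence follows from
  it.\<close>

lemma DN_bij:
  assumes w: "w \<in> V" "nrm (w - u) \<le> 2 * \<epsilon>" and l: "linear_form W l"
  shows "\<exists>!\<theta>. \<theta> \<in> W \<and> (\<forall>\<phi>\<in>W. DN w \<theta> \<phi> = l \<phi>)"
proof -
  note lin = linear_form_subset[OF linear_form_DN(1)[OF w(1) WV] W(2)] linear_form_subset[OF linear_form_DN(2)[OF w(1) WV] W(2)]
  have "\<exists>\<theta>\<in>W. \<forall>\<phi>\<in>W. DN w \<theta> \<phi> = l \<phi>"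
    by (rule finite_dim_surj[OF W(1,3,4) lin]) (use DN_zero_imp[OF w] l in auto)
  moreover have "\<theta> = \<theta>'" if "\<theta> \<in> W" "\<forall>\<phi>\<in>W. DN w \<theta> \<phi> = l \<phi>" "\<theta>' \<in> W" "\<forall>\<phi>\<in>W. DN w \<theta>' \<phi> = l \<phi>" for \<theta> \<theta>'
  proof -
    have "\<theta> - \<theta>' = 0"
      by (rule DN_zero_imp[OF w]) (use that linear_form_simps(2)[OF lin(2) W(1)] in \<open>auto intro: W_closed\<close>)
    then show ?thesis by simp
  qed
  ultimately show ?thesis by blast
qed

text \<open>With e the distance of the two solutions, expansion at \<open>v\<close> gives \<beta>/2
  e \<le> G e^2 \<le> 2 G \<epsilon> e \<le> \<beta>/4 e, so e = 0.\<close>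

lemma discrete_unique:
  assumes w: "w \<in> W" "\<And>\<phi>. \<phi> \<in> W \<Longrightarrow> N w \<phi> = 0" "nrm (u - w) \<le> \<epsilon>"
    and v: "v \<in> W" "\<And>\<phi>. \<phi> \<in> W \<Longrightarrow> N v \<phi> = 0" "nrm (u - v) \<le> \<epsilon>"
  shows "w = v"
proof -
  note V = WV[OF w(1)] WV[OF v(1)] u(1)
  define e where "e = nrm (w - v)"
  have e0: "e \<ge> 0" unfolding e_def using V by auto
  have e2: "e \<le> 2 * \<epsilon>"
    using nrm_triangle_mid[of w u v] nrm_minus_commute[of w u] w(3) v(3) V by (simp add: e_def)
  have "\<beta> / 2 * nrm (w - v) \<le> G * e * e"
  proof (rule infsup_near[of v])
    fix \<phi> assume \<phi>: "\<phi> \<in> W"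
    have "DN v (w - v) \<phi> = - \<Gamma> (w - v) (w - v) \<phi>"
      using N_expand[OF V(1,2) WV[OF \<phi>]] w(2)[OF \<phi>] v(2)[OF \<phi>] by simp
    then show "\<bar>DN v (w - v) \<phi>\<bar> \<le> G * e * e * nrm \<phi>"
      using \<Gamma>_bound[of "w - v" "w - v" \<phi>] V WV[OF \<phi>] by (auto simp: e_def)
  qed (use V v w W_closed nrm_minus_commute[of v u] \<epsilon> G_nonneg e0 in auto)
  also have "\<dots> \<le> G * e * (2 * \<epsilon>)" using e2 e0 G_nonneg by (intro mult_left_mono) auto
  also have "\<dots> = (8 * G * \<epsilon>) * (e / 4)" by simp
  also have "\<dots> \<le> \<beta> * (e / 4)" using \<epsilon>(2) e0 by (intro mult_right_mono) auto
  finally have "\<beta> * e \<le> 0" by (simp add: e_def)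
  then have "e = 0" using \<beta> e0 by (simp add: mult_le_0_iff)
  then show ?thesis using definite[of "w - v"] W_closed(3)[OF w(1) v(1)] by (simp add: e_def)
qed

text \<open>Galerkin orthogonality holds up to a quadratic term: on \<open>W\<close>,
  \<open>DN u (w - u)\<close> equals minus \<Gamma>(w - u, w - u, .). This term is at most G
  \<epsilon> e \<le> \<beta> e / 8 and is absorbed; the factor 2 in the constant rounds up
  8/7.\<close>

lemma quasi_optimal:
  assumes w: "w \<in> W" "\<And>\<phi>. \<phi> \<in> W \<Longrightarrow> N w \<phi> = 0" "nrm (u - w) \<le> \<epsilon>" and v: "v \<in> W"
  shows "nrm (u - w) \<le> 2 * (1 + (1 + 2 * G * nrm u) / \<beta>) * nrm (u - v)"
proof -
  note V = WV[OF w(1)] WV[OF v(1)] u(1)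
  define M where "M = 1 + 2 * G * nrm u"
  define e where "e = nrm (u - w)"
  have M0: "M \<ge> 0" unfolding M_def using V G_nonneg by auto
  have e0: "e \<ge> 0" unfolding e_def using V by auto
  have ewu: "nrm (w - u) = e" unfolding e_def using V by (simp add: nrm_minus_commute)
  have "\<beta> * nrm (w - v) \<le> M * nrm (u - v) + G * e * e"
  proof (rule infsup)
    fix \<phi> assume \<phi>: "\<phi> \<in> W"
    note V = V WV[OF \<phi>]
    have "DN u (w - u) \<phi> = - \<Gamma> (w - u) (w - u) \<phi>"
      using N_expand[OF V(1,3,4)] w(2)[OF \<phi>] u(2) V by simp
    moreover have "DN u (w - v) \<phi> = DN u (w - u) \<phi> + DN u (u - v) \<phi>"
      using linear_form_simps(1)[OF linear_form_DN(2)[OF V(3,4)] subspace_V, of "w - u" "u - v"] V by auto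
    ultimately have "\<bar>DN u (w - v) \<phi>\<bar> \<le> \<bar>DN u (u - v) \<phi>\<bar> + \<bar>\<Gamma> (w - u) (w - u) \<phi>\<bar>" by linarith
    also have "\<dots> \<le> M * nrm (u - v) * nrm \<phi> + G * e * e * nrm \<phi>"
      using DN_bound[of u "u - v" \<phi>] \<Gamma>_bound[of "w - u" "w - u" \<phi>] V unfolding M_def ewu by (intro add_mono) auto
    finally show "\<bar>DN u (w - v) \<phi>\<bar> \<le> (M * nrm (u - v) + G * e * e) * nrm \<phi>" by (simp add: algebra_simps)
  qed (use V v w W_closed M0 G_nonneg e0 in auto)
  also have "G * e * e \<le> G * e * \<epsilon>" using w(3) e0 G_nonneg by (intro mult_left_mono) (auto simp: e_def)
  also have "\<dots> = (8 * G * \<epsilon>) * (e / 8)" by simp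
  also have "\<dots> \<le> \<beta> * (e / 8)" using \<epsilon>(2) e0 by (intro mult_right_mono) auto
  finally have "nrm (w - v) \<le> M / \<beta> * nrm (u - v) + e / 8" using \<beta> by (simp add: field_simps)
  moreover have "e \<le> nrm (u - v) + nrm (w - v)"
    using nrm_triangle_mid[of u v w] nrm_minus_commute[of v w] V by (simp add: e_def)
  ultimately have "e \<le> (1 + M / \<beta>) * nrm (u - v) + e / 8" by (simp add: algebra_simps)
  then have "e / 2 \<le> (1 + M / \<beta>) * nrm (u - v)" using e0 by linarith
  then show ?thesis unfolding e_def M_def by linarith
qed

text \<open>\<open>w - \<theta>\<close> is the Newton iterate. Since \<open>N uC\<close> vanishes on
  \<open>W\<close>, \<open>DN w\<close> sends the new error to minus the quadratic remainder of the
  expansion at \<open>w\<close>. The first estimate is the quadratic rate; the second one keeps the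
  iterates in the ball and makes them converge from any start in it.\<close>

lemma newton_step:
  assumes uC: "uC \<in> W" "\<And>\<phi>. \<phi> \<in> W \<Longrightarrow> N uC \<phi> = 0" "nrm (u - uC) \<le> \<epsilon>"
    and w: "w \<in> W" "nrm (uC - w) \<le> \<epsilon>"
    and \<theta>: "\<theta> \<in> W" "\<And>\<phi>. \<phi> \<in> W \<Longrightarrow> DN w \<theta> \<phi> = N w \<phi>"
  shows "nrm (uC - (w - \<theta>)) \<le> (2 * G / \<beta>) * (nrm (uC - w))\<^sup>2"
    "nrm (uC - (w - \<theta>)) \<le> nrm (uC - w) / 4"
proof -
  note V = WV[OF w(1)] WV[OF uC(1)] u(1) WV[OF \<theta>(1)]
  define e where "e = nrm (uC - w)"
  have e0: "e \<ge> 0" unfolding e_def using V by auto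
  have near: "nrm (w - u) \<le> 2 * \<epsilon>"
    using nrm_triangle_mid[of w uC u] nrm_minus_commute[of w uC] nrm_minus_commute[of u uC] V w(2) uC(3) by simp
  have "\<beta> / 2 * nrm (uC - (w - \<theta>)) \<le> G * e * e"
  proof (rule infsup_near[OF V(1) near])
    fix \<phi> assume \<phi>: "\<phi> \<in> W"
    have "DN w (uC - (w - \<theta>)) \<phi> = DN w (uC - w) \<phi> + DN w \<theta> \<phi>"
      using linear_form_simps(1)[OF linear_form_DN(2)[OF V(1) WV[OF \<phi>]] subspace_V, of "uC - w" \<theta>] V
      by (simp add: V_diff algebra_simps)
    also have "\<dots> = - \<Gamma> (uC - w) (uC - w) \<phi>"
      using N_expand[OF V(2,1) WV[OF \<phi>]] uC(2)[OF \<phi>] \<theta>(2)[OF \<phi>] by simp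
    finally show "\<bar>DN w (uC - (w - \<theta>)) \<phi>\<bar> \<le> G * e * e * nrm \<phi>"
      using \<Gamma>_bound[of "uC - w" "uC - w" \<phi>] V WV[OF \<phi>] by (auto simp: e_def)
  qed (use w uC \<theta> W_closed G_nonneg e0 in auto)
  then have "\<beta> * nrm (uC - (w - \<theta>)) \<le> 2 * G * e * e" by simp
  then show *: "nrm (uC - (w - \<theta>)) \<le> (2 * G / \<beta>) * (nrm (uC - w))\<^sup>2"
    using \<beta> by (simp add: field_simps e_def power2_eq_square)
  have "2 * G / \<beta> * e\<^sup>2 \<le> 2 * G / \<beta> * (\<epsilon> * e)"
    unfolding power2_eq_square using e0 w(2) G_nonneg \<beta> by (intro mult_left_mono mult_right_mono) (auto simp: e_def)
  also have "\<dots> = (8 * G * \<epsilon>) * (e / 4 / \<beta>)" by simp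
  also have "\<dots> \<le> \<beta> * (e / 4 / \<beta>)" using \<epsilon>(2) e0 \<beta> by (intro mult_right_mono) auto
  finally show "nrm (uC - (w - \<theta>)) \<le> nrm (uC - w) / 4" using * \<beta> by (simp add: e_def)
qed

text \<open>The limit exists in \<open>V\<close> but need not lie in \<open>W\<close>. Its
  orthogonal projection onto \<open>W\<close>, available from \<open>finite_dim_surj\<close>, is at
  least as close to every element of the sequence.\<close>

lemma W_complete:
  assumes X: "\<And>n. X n \<in> W" and cauchy: "\<And>d. d > 0 \<Longrightarrow> \<exists>k. \<forall>m\<ge>k. \<forall>n\<ge>k. nrm (X m - X n) < d"
  shows "\<exists>x\<in>W. (\<lambda>n::nat. nrm (X n - x)) \<longlonglongrightarrow> 0"
proof -
  have XV: "X n \<in> V" for n using X WV by blast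
  obtain y where y: "y \<in> V" "(\<lambda>n. nrm (X n - y)) \<longlonglongrightarrow> 0"
    using complete_nrm[OF XV cauchy] by blast
  have "\<exists>x\<in>W. \<forall>\<phi>\<in>W. ip x \<phi> = ip y \<phi>"
  proof (rule finite_dim_surj[OF W(1,3,4)])
    show "linear_form W (ip \<theta>)" if "\<theta> \<in> W" for \<theta> using linear_form_ip WV that W(2) by blast
    show "linear_form W (ip y)" using linear_form_ip y W(2) by blast
    show "linear_form W (\<lambda>\<theta>. ip \<theta> \<phi>)" if "\<phi> \<in> W" for \<phi>
      using WV that by (auto simp: linear_form_def ip_simps V_scale)
    show "\<theta> = 0" if "\<theta> \<in> W" "\<And>\<phi>. \<phi> \<in> W \<Longrightarrow> ip \<theta> \<phi> = 0" for \<theta>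
      using that definite by (simp add: nrm_def)
  qed
  then obtain x where x: "x \<in> W" "\<And>\<phi>. \<phi> \<in> W \<Longrightarrow> ip x \<phi> = ip y \<phi>" by blast
  have "nrm (X n - x) \<le> nrm (X n - y)" for n
  proof -
    have d: "X n - x \<in> W" using X x W_closed by auto
    have "(nrm (X n - x))\<^sup>2 = ip (X n - y) (X n - x)"
      using x(2)[OF d] XV WV[OF x(1)] y WV[OF d] by (simp add: nrm_sq ip_diff)
    also have "\<dots> \<le> nrm (X n - y) * nrm (X n - x)"
      using cauchy_schwarz[of "X n - y" "X n - x"] XV y WV[OF d] by (simp add: V_diff)
    finally show ?thesis using nrm_nonneg[OF WV[OF d]] nrm_nonneg[of "X n - y"] XV y
      by (cases "nrm (X n - x) = 0") (auto simp: power2_eq_square V_diff)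
  qed
  then show ?thesis using x(1) Lim_null_comparison[OF _ y(2), of "\<lambda>n. nrm (X n - x)"] nrm_nonneg XV WV[OF x(1)]
    by (intro bexI[of _ x]) (auto simp: V_diff)
qed

text \<open>The discrete solution is \<open>w0 + x\<close> with \<open>x\<close> the fixed point, in a small ball, of the
  simplified Newton map whose linear part is the derivative at \<open>u\<close>.\<close>

lemma discrete_exists:
  assumes w0: "w0 \<in> W" "nrm (u - w0) \<le> \<epsilon> / 2" "(1 + 2 * G * nrm u) * nrm (u - w0) \<le> \<beta> * \<epsilon> / 4"
  shows "\<exists>w\<in>W. (\<forall>\<phi>\<in>W. N w \<phi> = 0) \<and> nrm (u - w) \<le> \<epsilon>"
proof -
  define D where "D = {x \<in> W. nrm x \<le> \<epsilon> / 2}"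
  define e where "e x = w0 - u + x" for x
  \<comment> \<open>With e = w0 + x - u, the expansion at \<open>u\<close> turns
    \<open>N (w0 + x) = 0\<close> on \<open>W\<close> into \<open>DN u x = R x\<close>.\<close>
  define R where "R x \<phi> = - DN u (w0 - u) \<phi> - \<Gamma> (e x) (e x) \<phi>" for x \<phi>
  define T where "T x = (THE \<theta>. \<theta> \<in> W \<and> (\<forall>\<phi>\<in>W. DN u \<theta> \<phi> = R x \<phi>))" for x
  have w0V: "w0 \<in> V" "w0 - u \<in> V" using WV w0 u by auto
  have DV: "x \<in> W" "x \<in> V" if "x \<in> D" for x using that WV by (auto simp: D_def)
  have eV: "e x \<in> V" if "x \<in> V" for x using that w0V by (auto simp: e_def)
  have e_bd: "nrm (e x) \<le> \<epsilon>" if "x \<in> D" for x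
    using nrm_triangle[OF w0V(2) DV(2)[OF that]] nrm_minus_commute[OF u(1) w0V(1)] w0(2) that by (simp add: e_def D_def)
  have "linear_form V (R x)" if "x \<in> V" for x
    using linear_form_DN(1)[OF u(1) w0V(2)] eV[OF that]
    by (auto simp: linear_form_def R_def \<Gamma>_simps V_scale algebra_simps)
  then have Rlin: "linear_form W (R x)" if "x \<in> V" for x using that W(2) linear_form_subset by blast
  have "u \<in> V" "nrm (u - u) \<le> 2 * \<epsilon>" using u \<epsilon> by auto
  from theI'[OF DN_bij[OF this Rlin]] have T: "T x \<in> W" "\<And>\<phi>. \<phi> \<in> W \<Longrightarrow> DN u (T x) \<phi> = R x \<phi>" if "x \<in> V" for x
    using that unfolding T_def by blast+
  have T_ball: "T x \<in> D" if x: "x \<in> D" for x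
  proof -
    \<comment> \<open>Budget: \<beta> \<epsilon> / 4 for the distance from \<open>w0\<close> to
      \<open>u\<close> by assumption and \<beta> \<epsilon> / 8 for the remainder, against the
      \<beta> \<epsilon> / 2 that the ball of radius \<epsilon> / 2 allows.\<close>
    have "\<beta> * nrm (T x) \<le> \<beta> * \<epsilon> / 4 + G * \<epsilon> * \<epsilon>"
    proof (rule infsup[OF T(1)[OF DV(2)[OF x]]])
      fix \<phi> assume \<phi>: "\<phi> \<in> W"
      note V = w0V u(1) WV[OF \<phi>] eV[OF DV(2)[OF x]]
      have "\<bar>DN u (T x) \<phi>\<bar> \<le> \<bar>DN u (w0 - u) \<phi>\<bar> + \<bar>\<Gamma> (e x) (e x) \<phi>\<bar>"
        using T(2)[OF DV(2)[OF x] \<phi>] by (simp add: R_def)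
      also have "\<bar>DN u (w0 - u) \<phi>\<bar> \<le> (1 + 2 * G * nrm u) * nrm (u - w0) * nrm \<phi>"
        using DN_bound[of u "w0 - u" \<phi>] V nrm_minus_commute[of u w0] by simp
      also have "\<dots> \<le> \<beta> * \<epsilon> / 4 * nrm \<phi>" using w0(3) V by (intro mult_right_mono) auto
      also have "\<bar>\<Gamma> (e x) (e x) \<phi>\<bar> \<le> G * nrm (e x) * nrm (e x) * nrm \<phi>" using V by (intro \<Gamma>_bound)
      also have "\<dots> \<le> G * \<epsilon> * \<epsilon> * nrm \<phi>"
        using e_bd[OF x] V G_nonneg \<epsilon>(1) by (intro mult_right_mono mult_mono) auto
      finally show "\<bar>DN u (T x) \<phi>\<bar> \<le> (\<beta> * \<epsilon> / 4 + G * \<epsilon> * \<epsilon>) * nrm \<phi>" by (simp add: algebra_simps)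
    qed (use \<beta> \<epsilon> G_nonneg in auto)
    also have "G * \<epsilon> * \<epsilon> = (8 * G * \<epsilon>) * (\<epsilon> / 8)" by simp
    also have "\<dots> \<le> \<beta> * (\<epsilon> / 8)" using \<epsilon> by (intro mult_right_mono) auto
    finally have "\<beta> * nrm (T x) \<le> \<beta> * (\<epsilon> / 2)" using \<beta> \<epsilon> mult_pos_pos[OF \<beta> \<epsilon>(1)] by simp
    then have "nrm (T x) \<le> \<epsilon> / 2" using \<beta> by (simp only: mult_le_cancel_left_pos)
    then show ?thesis using T(1)[OF DV(2)[OF x]] by (simp add: D_def)
  qed
  have T_contr: "nrm (T x - T y) \<le> 1 / 4 * nrm (x - y)" if x: "x \<in> D" and y: "y \<in> D" for x y
  proof -
    note xy = DV(2)[OF x] DV(2)[OF y]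
    have exy: "e x - e y = x - y" by (simp add: e_def)
    have "\<beta> * nrm (T x - T y) \<le> 2 * G * \<epsilon> * nrm (x - y)"
    proof (rule infsup)
      fix \<phi> assume \<phi>: "\<phi> \<in> W"
      note V = xy eV[OF xy(1)] eV[OF xy(2)] WV[OF \<phi>] T(1)[THEN WV]
      have "DN u (T x - T y) \<phi> = DN u (T x) \<phi> - DN u (T y) \<phi>"
        by (rule linear_form_simps(2)[OF linear_form_DN(2)[OF u(1) WV[OF \<phi>]] subspace_V]) (use V in auto)
      also have "\<dots> = - (\<Gamma> (e x) (e x - e y) \<phi> + \<Gamma> (e x - e y) (e y) \<phi>)"
        using T(2)[OF _ \<phi>] V by (simp add: R_def \<Gamma>_simps)
      finally have "\<bar>DN u (T x - T y) \<phi>\<bar> \<le> \<bar>\<Gamma> (e x) (x - y) \<phi>\<bar> + \<bar>\<Gamma> (x - y) (e y) \<phi>\<bar>" unfolding exy by linarith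
      also have "\<dots> \<le> G * nrm (e x) * nrm (x - y) * nrm \<phi> + G * nrm (x - y) * nrm (e y) * nrm \<phi>"
        using V by (intro add_mono \<Gamma>_bound) auto
      also have "\<dots> \<le> G * \<epsilon> * nrm (x - y) * nrm \<phi> + G * nrm (x - y) * \<epsilon> * nrm \<phi>"
        using e_bd[OF x] e_bd[OF y] V G_nonneg \<epsilon>(1)
        by (intro add_mono mult_right_mono mult_left_mono) (auto simp: V_diff)
      finally show "\<bar>DN u (T x - T y) \<phi>\<bar> \<le> (2 * G * \<epsilon> * nrm (x - y)) * nrm \<phi>" by (simp add: algebra_simps)
    qed (use T(1) xy W_closed G_nonneg \<epsilon> in auto)
    also have "\<dots> = (8 * G * \<epsilon>) * (nrm (x - y) / 4)" by simp
    also have "\<dots> \<le> \<beta> * (nrm (x - y) / 4)" using \<epsilon> xy by (intro mult_right_mono) auto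
    finally show ?thesis using \<beta> by simp
  qed
  \<comment> \<open>\<open>nrm\<close> has no meaning outside \<open>V\<close>, whereas a metric
    must be nonnegative and symmetric for all arguments; hence the value 0 off
    \<open>W\<close>.\<close>
  define d where "d x y = (if x \<in> W \<and> y \<in> W then nrm (x - y) else 0)" for x y
  interpret M: Metric_space D d
  proof
    show "0 \<le> d x y" for x y using WV by (auto simp: d_def)
    show "d x y = d y x" for x y using WV nrm_minus_commute by (auto simp: d_def)
    show "d x y = 0 \<longleftrightarrow> x = y" if "x \<in> D" "y \<in> D" for x y
      using that definite[of "x - y"] W_closed(3) by (auto simp: d_def D_def)
    show "d x z \<le> d x y + d y z" if "x \<in> D" "y \<in> D" "z \<in> D" for x y z
      using that nrm_triangle_mid DV by (auto simp: d_def)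
  qed
  have dD: "d x y = nrm (x - y)" if "x \<in> D" "y \<in> D" for x y using that DV by (auto simp: d_def)
  have "M.mcomplete"
    unfolding M.mcomplete_def
  proof (intro allI impI)
    fix \<sigma> assume \<sigma>: "M.MCauchy \<sigma>"
    then have \<sigma>D: "\<sigma> n \<in> D" for n by (auto simp: M.MCauchy_def)
    have "\<exists>k. \<forall>m\<ge>k. \<forall>n\<ge>k. nrm (\<sigma> m - \<sigma> n) < r" if "r > 0" for r
      using \<sigma> that unfolding M.MCauchy_def by (metis dD \<sigma>D)
    from W_complete[OF DV(1)[OF \<sigma>D] this] obtain x where x: "x \<in> W" "(\<lambda>n. nrm (\<sigma> n - x)) \<longlonglongrightarrow> 0" by blast
    have "nrm x \<le> nrm (\<sigma> n - x) + \<epsilon> / 2" for n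
      using nrm_triangle_mid[of x "\<sigma> n" 0] nrm_minus_commute[of x "\<sigma> n"] WV[OF x(1)] DV(2)[OF \<sigma>D] \<sigma>D[of n]
      by (simp add: D_def)
    moreover have "(\<lambda>n. nrm (\<sigma> n - x) + \<epsilon> / 2) \<longlonglongrightarrow> 0 + \<epsilon> / 2" by (intro tendsto_intros x)
    ultimately have "nrm x \<le> \<epsilon> / 2" using LIMSEQ_le_const[of "\<lambda>n. nrm (\<sigma> n - x) + \<epsilon> / 2" "\<epsilon> / 2" "nrm x"] by auto
    then have xD: "x \<in> D" using x by (simp add: D_def)
    have "limitin M.mtopology \<sigma> x sequentially"
      using xD \<sigma>D x(2) by (simp add: M.limit_metric_sequentially dD LIMSEQ_iff) 
        (metis abs_of_nonneg DV(2) V_diff nrm_nonneg)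
    then show "\<exists>x. limitin M.mtopology \<sigma> x sequentially" by blast
  qed
  moreover have "D \<noteq> {}" using W_closed(1) \<epsilon>(1) by (auto simp: D_def intro!: exI[of _ 0])
  moreover have "T \<in> D \<rightarrow> D" using T_ball by auto
  moreover have "d (T x) (T y) \<le> 1/4 * d x y" if "x \<in> D" "y \<in> D" for x y
    using T_contr[OF that] T_ball that by (simp add: dD)
  moreover have one_div_four_less: "1/4 < (1::real)" by simp
  ultimately obtain x where x: "x \<in> D" "T x = x"
    using M.Banach_fixedpoint_thm[of T "1/4"] one_div_four_less by blast
  have "N (w0 + x) \<phi> = 0" if \<phi>: "\<phi> \<in> W" for \<phi>
  proof -
    have "w0 + x \<in> V" using w0V DV x by auto
    then have "N (w0 + x) \<phi> = DN u (e x) \<phi> + \<Gamma> (e x) (e x) \<phi>"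
      using N_expand[OF _ u(1) WV[OF \<phi>], of "w0 + x"] u(2)[OF WV[OF \<phi>]] by (simp add: e_def algebra_simps)
    also have "DN u (e x) \<phi> = DN u (w0 - u) \<phi> + DN u x \<phi>"
      unfolding e_def by (rule linear_form_simps(1)[OF linear_form_DN(2)[OF u(1) WV[OF \<phi>]] subspace_V]) (use w0V DV x in auto)
    also have "DN u x \<phi> = R x \<phi>" using T(2)[OF DV(2)[OF x(1)] \<phi>] x(2) by simp
    finally show ?thesis by (simp add: R_def)
  qed
  moreover have "nrm (u - (w0 + x)) \<le> \<epsilon>"
    using e_bd[OF x(1)] nrm_minus_commute[of u "w0 + x"] u w0V DV[OF x(1)] by (simp add: e_def V_add algebra_simps)
  ultimately show ?thesis using W_closed(2)[OF w0(1) DV(1)[OF x(1)]] by blast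
qed

end

section \<open>Test functions\<close>

lemma pdiff_eqI: "(f has_derivative f') (at x) \<Longrightarrow> pdiff i f x = f' (axis i 1)"
  unfolding pdiff_def by (simp add: frechet_derivative_at[symmetric])

lemma pdiff_works: "f differentiable (at x) \<Longrightarrow> (f has_derivative frechet_derivative f (at x)) (at x)"
  by (simp add: frechet_derivative_works[symmetric])

lemma pdiff_lin:
  assumes "f differentiable (at x)" "g differentiable (at x)"
  shows "pdiff i (\<lambda>x. a * f x + b * g x) x = a * pdiff i f x + b * pdiff i g x"
  using assms[THEN pdiff_works]
  by (intro pdiff_eqI[THEN trans]) (auto intro!: derivative_eq_intros simp: pdiff_def)

lemma pdiff_mult:
  assumes "f differentiable (at x)" "g differentiable (at x)"
  shows "pdiff i (\<lambda>x. f x * g x) x = f x * pdiff i g x + pdiff i f x * g x"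
  using assms[THEN pdiff_works]
  by (intro pdiff_eqI[THEN trans]) (auto intro!: derivative_eq_intros simp: pdiff_def)

lemma pdiff_line:
  assumes "f differentiable (at (x + t *\<^sub>R axis i 1))"
  shows "((\<lambda>t. f (x + t *\<^sub>R axis i 1)) has_real_derivative pdiff i f (x + t *\<^sub>R axis i 1)) (at t)"
proof -
  let ?D = "frechet_derivative f (at (x + t *\<^sub>R axis i 1))"
  have "((\<lambda>t. x + t *\<^sub>R axis i 1) has_derivative (\<lambda>h. h *\<^sub>R axis i 1)) (at t)"
    by (auto intro!: derivative_eq_intros)
  from has_derivative_compose[OF this pdiff_works[OF assms]]
  have "((\<lambda>t. f (x + t *\<^sub>R axis i 1)) has_derivative (\<lambda>h. ?D (h *\<^sub>R axis i 1))) (at t)" .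
  moreover have "?D (h *\<^sub>R axis i 1) = h * ?D (axis i 1)" for h
    using linear_frechet_derivative[OF assms] by (simp add: linear_cmul)
  ultimately show ?thesis by (simp add: has_field_derivative_def pdiff_def mult.commute[of _ "?D _"] )
qed

lemma pdiff_outside:
  assumes "x \<notin> closure {x. f x \<noteq> 0}"
  shows "pdiff i f x = 0"
proof -
  have "((\<lambda>x. 0) has_derivative (\<lambda>h. 0::real)) (at x)" by simp
  then have "(f has_derivative (\<lambda>h. 0)) (at x)"
    by (rule has_derivative_transform_within_open[OF _ open_Compl[OF closed_closure[of "{x. f x \<noteq> 0}"]]])
      (use assms closure_subset[of "{x. f x \<noteq> 0}"] in \<open>auto simp: subset_iff\<close>)
  then show ?thesis by (rule pdiff_eqI[THEN trans]) simp
qed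

lemma closure_support_pdiff: "closure {x. pdiff i f x \<noteq> 0} \<subseteq> closure {x. f x \<noteq> 0}"
  by (intro closure_minimal) (use pdiff_outside in blast, simp)

lemma closure_support_pdiffs: "closure {x. pdiffs is f x \<noteq> 0} \<subseteq> closure {x. f x \<noteq> 0}"
  by (induction "is") (use closure_support_pdiff in \<open>auto intro: subset_trans\<close>)

lemma pdiffs_append: "pdiffs is (pdiffs js f) = pdiffs (is @ js) f"
  by (induction "is") auto

lemma test_functions_pdiffs:
  assumes "\<phi> \<in> test_functions \<Omega>"
  shows "pdiffs is \<phi> \<in> test_functions \<Omega>"
proof -
  let ?K = "closure {x. \<phi> x \<noteq> 0}" and ?K' = "closure {x. pdiffs is \<phi> x \<noteq> 0}"
  have K: "compact ?K" "?K \<subseteq> \<Omega>" "\<And>is x. pdiffs is \<phi> differentiable (at x)"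
    using assms by (auto simp: test_functions_def)
  have "?K' = ?K \<inter> ?K'" using closure_support_pdiffs[of "is" \<phi>] by blast
  then have "compact ?K'" using compact_Int_closed[OF K(1) closed_closure] by metis
  then show ?thesis using K closure_support_pdiffs[of "is" \<phi>] unfolding test_functions_def
    by (auto simp: pdiffs_append)
qed

lemma test_functions_pdiff: "\<phi> \<in> test_functions \<Omega> \<Longrightarrow> pdiff i \<phi> \<in> test_functions \<Omega>"
  using test_functions_pdiffs[of \<phi> \<Omega> "[i]"] by simp

lemma test_function_differentiable: "\<phi> \<in> test_functions \<Omega> \<Longrightarrow> \<phi> differentiable (at x)"
  unfolding test_functions_def by clarsimp (metis pdiffs.simps(1))

lemma test_function_continuous: "\<phi> \<in> test_functions \<Omega> \<Longrightarrow> continuous_on A \<phi>"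
  by (meson continuous_at_imp_continuous_on differentiable_imp_continuous_within test_function_differentiable)

lemma pdiffs_lin:
  assumes "\<And>is x. pdiffs is \<phi> differentiable (at x)" "\<And>is x. pdiffs is \<psi> differentiable (at x)"
  shows "pdiffs is (\<lambda>x. a * \<phi> x + b * \<psi> x) = (\<lambda>x. a * pdiffs is \<phi> x + b * pdiffs is \<psi> x)"
proof (induction "is")
  case (Cons i "is")
  show ?case unfolding pdiffs.simps Cons.IH by (simp add: fun_eq_iff pdiff_lin assms)
qed simp

lemma test_functions_lin:
  assumes "\<phi> \<in> test_functions \<Omega>" "\<psi> \<in> test_functions \<Omega>"
  shows "(\<lambda>x. a * \<phi> x + b * \<psi> x) \<in> test_functions \<Omega>"
proof -
  have d: "\<And>is x. pdiffs is \<phi> differentiable (at x)" "\<And>is x. pdiffs is \<psi> differentiable (at x)"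
    using assms by (auto simp: test_functions_def)
  let ?C = "closure {x. \<phi> x \<noteq> 0} \<union> closure {x. \<psi> x \<noteq> 0}"
  have "{x. a * \<phi> x + b * \<psi> x \<noteq> 0} \<subseteq> ?C"
  proof
    fix x assume "x \<in> {x. a * \<phi> x + b * \<psi> x \<noteq> 0}"
    then have "x \<in> {x. \<phi> x \<noteq> 0} \<union> {x. \<psi> x \<noteq> 0}" by auto
    then show "x \<in> ?C" by (meson UnE UnI1 UnI2 closure_subset subsetD)
  qed
  then have sub: "closure {x. a * \<phi> x + b * \<psi> x \<noteq> 0} \<subseteq> ?C" by (intro closure_minimal) auto
  have C: "compact ?C" "?C \<subseteq> \<Omega>" using assms by (auto simp: test_functions_def)
  have "compact (closure {x. a * \<phi> x + b * \<psi> x \<noteq> 0})"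
    using compact_Int_closed[OF C(1) closed_closure[of "{x. a * \<phi> x + b * \<psi> x \<noteq> 0}"]] by (simp only: inf_absorb2[OF sub])
  then show ?thesis using C sub d unfolding test_functions_def
    by (auto simp: pdiffs_lin)
qed

lemma test_function_zero_outside: "\<phi> \<in> test_functions \<Omega> \<Longrightarrow> x \<notin> \<Omega> \<Longrightarrow> \<phi> x = 0"
  using closure_subset[of "{x. \<phi> x \<noteq> 0}"] by (auto simp: test_functions_def subset_iff)

section \<open>Functions of bounded support and integration by parts\<close>

definition bounded_support :: "(plane \<Rightarrow> real) \<Rightarrow> bool" where
  "bounded_support f \<longleftrightarrow> (\<exists>R. \<forall>x. norm x > R \<longrightarrow> f x = 0)"

lemma test_function_bounded_support:
  assumes "\<phi> \<in> test_functions \<Omega>"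
  shows "bounded_support \<phi>"
proof -
  have "bounded (closure {x. \<phi> x \<noteq> 0})" using assms by (auto simp: test_functions_def compact_imp_bounded)
  then obtain R where "\<And>x. x \<in> closure {x. \<phi> x \<noteq> 0} \<Longrightarrow> norm x \<le> R" by (auto simp: bounded_iff)
  then show ?thesis unfolding bounded_support_def using closure_subset[of "{x. \<phi> x \<noteq> 0}"]
    by (intro exI[of _ R]) (force simp: subset_iff)
qed

lemma bounded_support_mult:
  "bounded_support f \<Longrightarrow> bounded_support (\<lambda>x. g x * f x)"
  "bounded_support f \<Longrightarrow> bounded_support (\<lambda>x. f x * g x)"
  unfolding bounded_support_def by (auto; metis mult_zero_right mult_zero_left)+

lemma bounded_support_pdiff:
  assumes "bounded_support f"
  shows "bounded_support (pdiff i f)"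
proof -
  obtain R where R: "\<And>x. norm x > R \<Longrightarrow> f x = 0" using assms by (auto simp: bounded_support_def)
  have "{x. f x \<noteq> 0} \<subseteq> cball 0 R"
  proof
    fix x assume "x \<in> {x. f x \<noteq> 0}"
    then show "x \<in> cball 0 R" using R[of x] by (cases "norm x > R") auto
  qed
  then have "closure {x. f x \<noteq> 0} \<subseteq> cball 0 R" by (intro closure_minimal) auto
  then have "pdiff i f x = 0" if "norm x > R" for x using that by (intro pdiff_outside) auto
  then show ?thesis by (auto simp: bounded_support_def)
qed

lemma bounded_support_bounded:
  assumes "bounded_support f" "continuous_on UNIV f"
  obtains C where "C \<ge> 0" "\<And>x. \<bar>f x\<bar> \<le> C"
proof -
  obtain R where R: "\<And>x. norm x > R \<Longrightarrow> f x = 0" using assms by (auto simp: bounded_support_def)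
  have "compact (f ` cball 0 R)"
    using assms(2) by (intro compact_continuous_image) (auto intro: continuous_on_subset)
  then obtain C where "\<forall>y\<in>f ` cball 0 R. norm y \<le> C"
    using compact_imp_bounded bounded_iff by blast
  then have C: "\<And>x. x \<in> cball 0 R \<Longrightarrow> \<bar>f x\<bar> \<le> C" by simp
  have "\<bar>f x\<bar> \<le> max C 0" for x using C[of x] R[of x] by (cases "norm x > R") (auto simp: max_def)
  then show ?thesis using that[of "max C 0"] by auto
qed

lemma bounded_support_integrable:
  assumes "bounded_support f" "continuous_on UNIV f"
  shows "integrable lborel f"
proof -
  obtain R where R: "\<And>x. norm x > R \<Longrightarrow> f x = 0" using assms by (auto simp: bounded_support_def)
  obtain C where C: "C \<ge> 0" "\<And>x. \<bar>f x\<bar> \<le> C" using bounded_support_bounded[OF assms] by blast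
  have meas: "f \<in> borel_measurable lborel" using assms(2) by (simp add: borel_measurable_continuous_onI)
  show ?thesis
  proof (rule integrableI_bounded_set[where A = "cball 0 R" and B = C])
    show "emeasure lborel (cball 0 R :: plane set) < \<infinity>" using emeasure_lborel_cball_finite by simp
  qed (use meas C R in \<open>auto simp: not_le\<close>)
qed

text \<open>By translation invariance all difference quotients have integral zero.\<close>

lemma integral_pdiff_zero:
  assumes diff: "\<And>x. f differentiable (at x)" and cont: "continuous_on UNIV (pdiff i f)" and bs: "bounded_support f"
  shows "integral\<^sup>L lborel (pdiff i f) = 0"
proof -
  let ?e = "axis i 1 :: plane"
  define h where "h n = 1 / (real n + 1)" for n
  have h: "h n > 0" "h n \<le> 1" for n by (auto simp: h_def)
  have "h = (\<lambda>n. inverse (real (Suc n)))" by (auto simp: h_def inverse_eq_divide)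
  then have hl: "h \<longlonglongrightarrow> 0" using LIMSEQ_inverse_real_of_nat by simp
  have contf: "continuous_on UNIV f" by (meson continuous_at_imp_continuous_on differentiable_imp_continuous_within diff)
  have intf: "integrable lborel f" using bounded_support_integrable[OF bs contf] .
  obtain R where R: "\<And>x. norm x > R \<Longrightarrow> f x = 0" using bs by (auto simp: bounded_support_def)
  obtain C where C: "C \<ge> 0" "\<And>x. \<bar>pdiff i f x\<bar> \<le> C"
    using bounded_support_bounded[OF bounded_support_pdiff[OF bs] cont] by blast
  define s where "s n x = (f (h n *\<^sub>R ?e + x) - f x) / h n" for n x
  have int_shift: "integrable lborel (\<lambda>x. f (c + x))" "(LINT x|lborel. f (c + x)) = integral\<^sup>L lborel f" for c
  proof -
    have m: "(+) c \<in> measurable lborel borel" by simp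
    have mf: "f \<in> borel_measurable borel" using contf by (simp add: borel_measurable_continuous_onI)
    show "(LINT x|lborel. f (c + x)) = integral\<^sup>L lborel f"
      using integral_distr[OF m mf] by (simp add: lborel_distr_plus)
    show "integrable lborel (\<lambda>x. f (c + x))"
      using integrable_distr_eq[OF m mf] intf by (simp add: lborel_distr_plus)
  qed
  have s0: "integral\<^sup>L lborel (s n) = 0" for n
    unfolding s_def using int_shift intf by simp
  \<comment> \<open>Steps are at most 1, so all difference quotients vanish outside the ball of
    radius R + 1, and by the mean value theorem they are bounded by the supremum of the
    derivative.\<close>
  have "(\<lambda>n. integral\<^sup>L lborel (s n)) \<longlonglongrightarrow> integral\<^sup>L lborel (pdiff i f)"
  proof (rule integral_dominated_convergence[where w = "\<lambda>x. C * indicator (cball 0 (R + 1)) x"])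
    show "pdiff i f \<in> borel_measurable lborel" using cont by (simp add: borel_measurable_continuous_onI)
    have [measurable]: "f \<in> borel_measurable borel" using contf by (simp add: borel_measurable_continuous_onI)
    show "s n \<in> borel_measurable lborel" for n unfolding s_def by measurable
    show "integrable lborel (\<lambda>x::plane. C * indicator (cball 0 (R + 1)) x)"
      using emeasure_lborel_cball_finite[of "0::plane" "R + 1"]
      by (intro integrable_mult_right integrable_real_indicator) auto
    show "AE x in lborel. (\<lambda>n. s n x) \<longlonglongrightarrow> pdiff i f x"
    proof (rule AE_I2)
      fix x
      have "((\<lambda>t. f (x + t *\<^sub>R ?e)) has_real_derivative pdiff i f x) (at 0)"
        using pdiff_line[OF diff, where x = x and t = 0 and i = i] by simp
      then have "((\<lambda>t. (f (x + t *\<^sub>R ?e) - f x) / t) \<longlongrightarrow> pdiff i f x) (at 0)"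
        by (simp add: DERIV_def)
      moreover have "filterlim h (at 0) sequentially"
        unfolding filterlim_at using h hl by (auto simp: less_imp_neq[symmetric] eventuallyI)
      ultimately show "(\<lambda>n. s n x) \<longlonglongrightarrow> pdiff i f x"
        unfolding s_def by (auto dest: filterlim_compose simp: add.commute)
    qed
    show "AE x in lborel. norm (s n x) \<le> C * indicator (cball 0 (R + 1)) x" for n
    proof (rule AE_I2)
      fix x
      show "norm (s n x) \<le> C * indicator (cball 0 (R + 1)) x"
      proof (cases "norm x \<le> R + 1")
        case True
        have "\<exists>z. z > 0 \<and> z < h n \<and> f (x + h n *\<^sub>R ?e) - f (x + 0 *\<^sub>R ?e) = (h n - 0) * pdiff i f (x + z *\<^sub>R ?e)"
          using h by (intro MVT2) (auto intro!: pdiff_line diff)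
        then obtain z where "f (x + h n *\<^sub>R ?e) - f x = h n * pdiff i f (x + z *\<^sub>R ?e)" by auto
        then have "s n x = pdiff i f (x + z *\<^sub>R ?e)" using h[of n] by (simp add: s_def add.commute)
        then show ?thesis using C True by simp
      next
        case False
        have "norm x \<le> norm (h n *\<^sub>R ?e + x) + norm (h n *\<^sub>R ?e)"
          by (metis add_diff_cancel_left' norm_triangle_ineq4)
        moreover have "norm (h n *\<^sub>R ?e) \<le> 1" using h[of n] by simp
        ultimately have "norm (h n *\<^sub>R ?e + x) > R" using False by linarith
        then have "s n x = 0" using R False by (simp add: s_def)
        then show ?thesis using C by simp
      qed
    qed
  qed
  then show ?thesis using s0 by (simp add: LIMSEQ_const_iff)
qed

text \<open>The integral of the derivative of the product is zero. Only \<open>g\<close> has bounded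
  support; \<open>f\<close> may grow, as the coordinate function does in Poincare's
  inequality.\<close>

lemma integral_by_parts:
  assumes f: "\<And>x. f differentiable (at x)" "continuous_on UNIV (pdiff i f)"
    and g: "\<And>x. g differentiable (at x)" "continuous_on UNIV (pdiff i g)" and bs: "bounded_support g"
  shows "(LINT x|lborel. f x * pdiff i g x) = - (LINT x|lborel. pdiff i f x * g x)"
proof -
  have cf: "continuous_on UNIV f" "continuous_on UNIV g"
    by (meson continuous_at_imp_continuous_on differentiable_imp_continuous_within f(1) g(1))+
  have eq: "pdiff i (\<lambda>x. f x * g x) = (\<lambda>x. f x * pdiff i g x + pdiff i f x * g x)"
    using pdiff_mult f(1) g(1) by (auto simp: fun_eq_iff)
  have "integral\<^sup>L lborel (pdiff i (\<lambda>x. f x * g x)) = 0"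
    by (rule integral_pdiff_zero)
      (auto simp: eq f g bs intro!: continuous_intros cf bounded_support_mult(1)[OF bs] differentiable_mult)
  moreover have "integrable lborel (\<lambda>x. f x * pdiff i g x)" "integrable lborel (\<lambda>x. pdiff i f x * g x)"
    using f g cf
    by (auto intro!: bounded_support_integrable bounded_support_mult(1)[OF bs]
        bounded_support_mult(1)[OF bounded_support_pdiff[OF bs]] continuous_intros)
  ultimately show ?thesis unfolding eq by (simp add: Bochner_Integration.integral_add)
qed

text \<open>Schwarz's theorem, by the mean value theorem for the second-order difference.\<close>

lemma pdiff_commute:
  assumes d: "\<And>x. f differentiable (at x)" "\<And>x. pdiff i f differentiable (at x)" "\<And>x. pdiff j f differentiable (at x)"
    and c: "continuous_on UNIV (pdiff i (pdiff j f))" "continuous_on UNIV (pdiff j (pdiff i f))"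
  shows "pdiff i (pdiff j f) x = pdiff j (pdiff i f) x"
proof -
  \<comment> \<open>The second-order difference is symmetric in i and j. Used once for each order of
    the indices, this equates the two mixed derivatives at points that tend to \<open>x\<close> with
    \<open>h\<close>.\<close>
  have key: "\<exists>y. norm (y - x) \<le> 2 * h \<and> f (x + h *\<^sub>R axis i 1 + h *\<^sub>R axis j 1) - f (x + h *\<^sub>R axis i 1) - f (x + h *\<^sub>R axis j 1) + f x = h * h * pdiff j (pdiff i f) y"
    if h: "h > 0" and d: "\<And>x. f differentiable (at x)" "\<And>x. pdiff i f differentiable (at x)" for h i j
  proof -
    let ?g = "\<lambda>s. f (x + h *\<^sub>R axis j 1 + s *\<^sub>R axis i 1) - f (x + s *\<^sub>R axis i 1)"
    have "\<exists>s. s > 0 \<and> s < h \<and> ?g h - ?g 0 = (h - 0) * (pdiff i f (x + h *\<^sub>R axis j 1 + s *\<^sub>R axis i 1) - pdiff i f (x + s *\<^sub>R axis i 1))"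
      using h by (intro MVT2) (auto intro!: derivative_intros pdiff_line d)
    then obtain s where s: "s > 0" "s < h" "?g h - ?g 0 = h * (pdiff i f (x + h *\<^sub>R axis j 1 + s *\<^sub>R axis i 1) - pdiff i f (x + s *\<^sub>R axis i 1))" by auto
    let ?k = "\<lambda>t. pdiff i f (x + s *\<^sub>R axis i 1 + t *\<^sub>R axis j 1)"
    have "\<exists>t. t > 0 \<and> t < h \<and> ?k h - ?k 0 = (h - 0) * pdiff j (pdiff i f) (x + s *\<^sub>R axis i 1 + t *\<^sub>R axis j 1)"
      using h by (intro MVT2) (auto intro!: pdiff_line d)
    then obtain t where t: "t > 0" "t < h" "?k h - ?k 0 = h * pdiff j (pdiff i f) (x + s *\<^sub>R axis i 1 + t *\<^sub>R axis j 1)" by auto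
    have "norm (x + s *\<^sub>R axis i 1 + t *\<^sub>R axis j 1 - x) \<le> norm (s *\<^sub>R axis i (1::real) :: plane) + norm (t *\<^sub>R axis j (1::real) :: plane)"
      by (metis add_diff_cancel_left' add.assoc norm_triangle_ineq)
    also have "\<dots> \<le> 2 * h" using s t by simp
    finally have n: "norm (x + s *\<^sub>R axis i 1 + t *\<^sub>R axis j 1 - x) \<le> 2 * h" .
    have "f (x + h *\<^sub>R axis i 1 + h *\<^sub>R axis j 1) - f (x + h *\<^sub>R axis i 1) - f (x + h *\<^sub>R axis j 1) + f x = ?g h - ?g 0"
      by (simp add: add_ac)
    also have "\<dots> = h * (?k h - ?k 0)" unfolding s(3) by (simp add: add_ac)
    also have "\<dots> = h * h * pdiff j (pdiff i f) (x + s *\<^sub>R axis i 1 + t *\<^sub>R axis j 1)" unfolding t(3) by simp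
    finally show ?thesis using n by blast
  qed
  have ex: "\<exists>y z. norm (y - x) \<le> 2 * h \<and> norm (z - x) \<le> 2 * h \<and> pdiff i (pdiff j f) y = pdiff j (pdiff i f) z" if h: "h > 0" for h
    using key[OF h d(1,2), of j] key[OF h d(1,3), of i] h
    by (smt (verit) add.assoc add.commute mult_left_cancel mult_eq_0_iff)
  define h where "h n = 1 / (real n + 1)" for n
  have h: "h n > 0" for n by (simp add: h_def)
  have "h = (\<lambda>n. inverse (real (Suc n)))" by (auto simp: h_def inverse_eq_divide)
  then have hl: "h \<longlonglongrightarrow> 0" using LIMSEQ_inverse_real_of_nat by simp
  obtain y z where yz: "\<And>n. norm (y n - x) \<le> 2 * h n" "\<And>n. norm (z n - x) \<le> 2 * h n"
      "\<And>n. pdiff i (pdiff j f) (y n) = pdiff j (pdiff i f) (z n)"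
    using ex[OF h] by metis
  have lim: "w \<longlonglongrightarrow> x" if "\<And>n. norm (w n - x) \<le> 2 * h n" for w :: "nat \<Rightarrow> plane"
  proof (rule LIM_zero_cancel, rule Lim_null_comparison)
    show "\<forall>\<^sub>F n in sequentially. norm (w n - x) \<le> 2 * h n" using that by simp
    show "(\<lambda>n. 2 * h n) \<longlonglongrightarrow> 0" using tendsto_mult_right_zero[OF hl] by simp
  qed
  have "(\<lambda>n. pdiff i (pdiff j f) (y n)) \<longlonglongrightarrow> pdiff i (pdiff j f) x"
    using c(1) lim[OF yz(1)] by (simp add: continuous_on_eq_continuous_at isCont_tendsto_compose)
  moreover have "(\<lambda>n. pdiff j (pdiff i f) (z n)) \<longlonglongrightarrow> pdiff j (pdiff i f) x"
    using c(2) lim[OF yz(2)] by (simp add: continuous_on_eq_continuous_at isCont_tendsto_compose)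
  ultimately show ?thesis using yz(3) LIMSEQ_unique by simp
qed

lemma test_function_pdiff_commute:
  "\<phi> \<in> test_functions \<Omega> \<Longrightarrow> pdiff i (pdiff j \<phi>) = pdiff j (pdiff i \<phi>)"
  by (intro ext pdiff_commute)
    (auto intro: test_function_differentiable test_function_continuous test_functions_pdiff)

lemma test_function_by_parts:
  assumes "\<phi> \<in> test_functions \<Omega>" "\<psi> \<in> test_functions \<Omega>'"
  shows "(LINT x|lborel. \<phi> x * pdiff i \<psi> x) = - (LINT x|lborel. pdiff i \<phi> x * \<psi> x)"
  using assms
  by (intro integral_by_parts)
    (auto intro: test_function_differentiable test_function_continuous test_functions_pdiff test_function_bounded_support)

section \<open>Smooth bump functions on boxes\<close>

definition flat_exp :: "real poly \<Rightarrow> real \<Rightarrow> real" where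
  "flat_exp p t = (if t > 0 then poly p (1 / t) * exp (- (1 / t)) else 0)"

lemma poly_exp_tendsto_0: "((\<lambda>s. poly p s * exp (- s)) \<longlongrightarrow> (0::real)) at_top"
proof -
  have "((\<lambda>s. \<Sum>i\<le>degree p. coeff p i * (s ^ i / exp s)) \<longlongrightarrow> (\<Sum>i\<le>degree p. coeff p i * 0)) at_top"
    by (intro tendsto_intros tendsto_power_div_exp_0)
  moreover have "(\<lambda>s. \<Sum>i\<le>degree p. coeff p i * (s ^ i / exp s)) = (\<lambda>s. poly p s * exp (- s))"
    by (simp add: poly_altdef sum_distrib_right exp_minus divide_inverse mult.assoc)
  ultimately show ?thesis by simp
qed

text \<open>For t > 0 the derivative of p(1/t) exp(-1/t) is (1/t^2) (p - p')(1/t) exp(-1/t), which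
  has the same shape with the polynomial X^2 (p - p'). The family is thus closed under
  differentiation, so its members are smooth, also at 0.\<close>

lemma flat_exp_deriv:
  "(flat_exp p has_real_derivative flat_exp ([:0, 0, 1:] * (p - pderiv p)) t) (at t)"
proof -
  let ?q = "[:0, 0, 1:] * (p - pderiv p)"
  consider "t > 0" | "t < 0" | "t = 0" by linarith
  then show ?thesis
  proof cases
    case 1
    have "((\<lambda>t. poly p (1 / t) * exp (- (1 / t))) has_real_derivative flat_exp ?q t) (at t)"
      using 1 by (auto intro!: derivative_eq_intros DERIV_chain'[OF _ poly_DERIV]
          simp: flat_exp_def power2_eq_square field_simps)
    then show ?thesis
      by (rule has_field_derivative_transform_within_open[where S = "{0<..}"]) (use 1 in \<open>auto simp: flat_exp_def\<close>)
  next
    case 2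
    have "((\<lambda>t. 0) has_real_derivative flat_exp ?q t) (at t)" using 2 by (simp add: flat_exp_def)
    then show ?thesis
      by (rule has_field_derivative_transform_within_open[where S = "{..<0}"]) (use 2 in \<open>auto simp: flat_exp_def\<close>)
  next
    case 3
    \<comment> \<open>At 0 the right-hand difference quotient is again of the form q(1/h) exp(-1/h),
      with q = X p.\<close>
    have "((\<lambda>h. poly (pCons 0 p) (inverse h) * exp (- inverse h)) \<longlongrightarrow> 0) (at_right 0)"
      by (rule filterlim_compose[OF poly_exp_tendsto_0 filterlim_inverse_at_top_right])
    then have r: "((\<lambda>h. flat_exp p h / h) \<longlongrightarrow> 0) (at_right 0)"
      by (rule Lim_transform_eventually)
        (auto simp: eventually_at_right[OF zero_less_one] flat_exp_def field_simps intro!: exI[of _ 1])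
    have l: "((\<lambda>h. flat_exp p h / h) \<longlongrightarrow> 0) (at_left 0)"
      by (rule tendsto_eventually) (auto simp: eventually_at_left[of "-1"] flat_exp_def intro!: exI[of _ "-1"])
    have "((\<lambda>h. flat_exp p h / h) \<longlongrightarrow> 0) (at 0)" using r l by (simp add: filterlim_split_at)
    then show ?thesis using 3 by (simp add: DERIV_def flat_exp_def)
  qed
qed

text \<open>A class of functions closed under \<open>pdiff\<close>: differentiability of its members
  then gives smoothness of every order without any formula for iterated derivatives.\<close>

inductive_set smooth_bumps :: "sfun set" where
  base: "(\<lambda>x. flat_exp p (c + x \<bullet> v)) \<in> smooth_bumps"
| add: "f \<in> smooth_bumps \<Longrightarrow> g \<in> smooth_bumps \<Longrightarrow> (\<lambda>x. f x + g x) \<in> smooth_bumps"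
| mult: "f \<in> smooth_bumps \<Longrightarrow> g \<in> smooth_bumps \<Longrightarrow> (\<lambda>x. f x * g x) \<in> smooth_bumps"

lemma smooth_bumps_pdiff:
  assumes "f \<in> smooth_bumps"
  shows "(\<forall>x. f differentiable (at x)) \<and> (\<forall>i. pdiff i f \<in> smooth_bumps)"
  using assms
proof induction
  case (base p c v)
  let ?q = "[:0, 0, 1:] * (p - pderiv p)"
  have D: "((\<lambda>x. flat_exp p (c + x \<bullet> v)) has_derivative (\<lambda>h. flat_exp ?q (c + x \<bullet> v) * (h \<bullet> v))) (at x)" for x
  proof -
    have "((\<lambda>x. c + x \<bullet> v) has_derivative (\<lambda>h. h \<bullet> v)) (at x)" by (auto intro!: derivative_eq_intros)
    from has_derivative_compose[OF this flat_exp_deriv[unfolded has_field_derivative_def]]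
    show ?thesis by simp
  qed
  have "pdiff i (\<lambda>x. flat_exp p (c + x \<bullet> v)) = (\<lambda>x. flat_exp (smult (v $ i) ?q) (c + x \<bullet> v))" for i
    using pdiff_eqI[OF D] by (auto simp: fun_eq_iff flat_exp_def inner_axis' algebra_simps)
  then show ?case using D smooth_bumps.base by (auto simp: differentiable_def)
next
  case (add f g)
  have "pdiff i (\<lambda>x. f x + g x) = (\<lambda>x. pdiff i f x + pdiff i g x)" for i
    using pdiff_lin[of f _ g i 1 1] add by (auto simp: fun_eq_iff)
  then show ?case using add by (auto intro: smooth_bumps.add)
next
  case (mult f g)
  have "pdiff i (\<lambda>x. f x * g x) = (\<lambda>x. f x * pdiff i g x + pdiff i f x * g x)" for i
    using pdiff_mult[of f _ g i] mult by (auto simp: fun_eq_iff)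
  then show ?case using mult by (auto intro!: smooth_bumps.add smooth_bumps.mult)
qed

lemma smooth_bumps_pdiffs: "f \<in> smooth_bumps \<Longrightarrow> pdiffs is f \<in> smooth_bumps"
  by (induction "is") (auto simp: smooth_bumps_pdiff)

definition step :: "real \<Rightarrow> real" where "step t = flat_exp 1 t"

lemma step: "0 \<le> step t" "step t \<le> 1" "step t \<noteq> 0 \<longleftrightarrow> t > 0"
  by (auto simp: step_def flat_exp_def)

lemma step_tendsto: "(\<lambda>n. step (real n * t)) \<longlonglongrightarrow> (if t > 0 then 1 else 0)"
proof (cases "t > 0")
  case True
  have "(\<lambda>n. exp (- (1 / (real n * t)))) \<longlonglongrightarrow> exp (- 0)"
  proof (intro tendsto_intros)
    have "(\<lambda>n. inverse (real n) * (1 / t)) \<longlonglongrightarrow> 0 * (1 / t)"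
      by (intro tendsto_intros lim_inverse_n)
    then show "(\<lambda>n. 1 / (real n * t)) \<longlonglongrightarrow> 0" by (simp add: inverse_eq_divide)
  qed
  then have "(\<lambda>n. step (real n * t)) \<longlonglongrightarrow> exp (- 0)"
    by (rule Lim_transform_eventually)
      (use True in \<open>auto simp: step_def flat_exp_def eventually_sequentially intro!: exI[of _ 1]\<close>)
  then show ?thesis using True by simp
next
  case False
  then have "step (real n * t) = 0" for n
    by (auto simp: step_def flat_exp_def zero_less_mult_iff)
  then show ?thesis using False by simp
qed

text \<open>Four one-sided steps, one per side of the box. As \<open>n\<close> grows they steepen to
  the indicator of the open box while staying in [0, 1], so dominated convergence recovers box
  integrals from integrals against test functions.\<close>

definition box_bump :: "nat \<Rightarrow> plane \<Rightarrow> plane \<Rightarrow> sfun" where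
  "box_bump n l u x = (step (real n * (x $ 1 - l $ 1)) * step (real n * (u $ 1 - x $ 1))) *
     (step (real n * (x $ 2 - l $ 2)) * step (real n * (u $ 2 - x $ 2)))"

lemma box_bump_bounds: "0 \<le> box_bump n l u x" "box_bump n l u x \<le> 1"
  unfolding box_bump_def by (auto intro!: mult_nonneg_nonneg mult_le_one step)

lemma box_bump_support: "box_bump n l u x \<noteq> 0 \<Longrightarrow> x \<in> box l u"
  unfolding box_bump_def by (auto simp: step mem_box_cart forall_2 zero_less_mult_iff)

lemma box_bump_tendsto: "(\<lambda>n. box_bump n l u x) \<longlonglongrightarrow> indicator (box l u) x"
proof -
  have "(\<lambda>n. box_bump n l u x) \<longlonglongrightarrow>
     ((if x $ 1 - l $ 1 > 0 then 1 else 0) * (if u $ 1 - x $ 1 > 0 then 1 else 0)) *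
     ((if x $ 2 - l $ 2 > 0 then 1 else 0) * (if u $ 2 - x $ 2 > 0 then 1 else 0))"
    unfolding box_bump_def by (intro tendsto_mult step_tendsto)
  then show ?thesis by (simp add: indicator_def mem_box_cart forall_2 split: if_splits)
qed

lemma box_bump_smooth: "box_bump n l u \<in> smooth_bumps"
proof -
  have *: "(\<lambda>x. step (real n * (x $ i - a))) \<in> smooth_bumps" "(\<lambda>x. step (real n * (a - x $ i))) \<in> smooth_bumps" for i a
    using smooth_bumps.base[of 1 "- (real n * a)" "real n *\<^sub>R axis i 1"]
      smooth_bumps.base[of 1 "real n * a" "- (real n *\<^sub>R axis i 1)"]
    by (simp_all add: step_def inner_axis algebra_simps)
  show ?thesis unfolding box_bump_def[abs_def] by (intro smooth_bumps.mult *)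
qed

lemma box_bump_test_function:
  assumes "cbox l u \<subseteq> \<Omega>"
  shows "box_bump n l u \<in> test_functions \<Omega>"
proof -
  have "{x. box_bump n l u x \<noteq> 0} \<subseteq> cbox l u" using box_bump_support box_subset_cbox by blast
  then have sub: "closure {x. box_bump n l u x \<noteq> 0} \<subseteq> cbox l u" by (intro closure_minimal) auto
  have "compact (closure {x. box_bump n l u x \<noteq> 0})"
    using compact_Int_closed[OF compact_cbox[of l u] closed_closure[of "{x. box_bump n l u x \<noteq> 0}"]]
    by (simp only: inf_absorb2[OF sub])
  then show ?thesis using sub assms smooth_bumps_pdiff[OF smooth_bumps_pdiffs[OF box_bump_smooth]]
    by (auto simp: test_functions_def)
qed

section \<open>The fundamental lemma of the calculus of variations\<close>

lemma AE_zero_if_box_integrals_zero: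
  fixes f :: "'a::euclidean_space \<Rightarrow> real"
  assumes f: "integrable lborel f" and box: "\<And>a b. (LINT x:box a b|lborel. f x) = 0"
  shows "AE x in lborel. f x = 0"
proof -
  have int: "set_integrable lborel A f" if "A \<in> sets lborel" for A
    unfolding set_integrable_def using integrable_mult_indicator[OF that f] .
  have un: "(LINT x:(\<Union>i. A i)|lborel. f x) = 0"
    if "disjoint_family A" "\<And>i. A i \<in> sets lborel" "\<And>i. (LINT x:A i|lborel. f x) = 0" for A :: "nat \<Rightarrow> 'a set"
    using that by (subst lebesgue_integral_countable_add) (auto simp: disjoint_family_on_def intro!: int)
  \<comment> \<open>The whole space is exhausted by growing boxes; its integral is needed below to
    pass to complements.\<close>
  have UNIV: "(LINT x:UNIV|lborel. f x) = 0"
  proof -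
    let ?B = "\<lambda>n::nat. box (- (real n *\<^sub>R One)) (real n *\<^sub>R One) :: 'a set"
    have "(\<lambda>n. LINT x:?B n|lborel. f x) \<longlonglongrightarrow> (LINT x|lborel. f x)"
      unfolding set_lebesgue_integral_def
    proof (rule integral_dominated_convergence[where w = "\<lambda>x. norm (f x)"])
      show "f \<in> borel_measurable lborel" using f by auto
      show "integrable lborel (\<lambda>x. norm (f x))" using f by auto
      show "(\<lambda>x. indicat_real (?B n) x *\<^sub>R f x) \<in> borel_measurable lborel" for n
        using int[of "?B n"] unfolding set_integrable_def by auto
      show "AE x in lborel. norm (indicat_real (?B n) x *\<^sub>R f x) \<le> norm (f x)" for n
        by (auto simp: indicator_def)
      show "AE x in lborel. (\<lambda>n. indicat_real (?B n) x *\<^sub>R f x) \<longlonglongrightarrow> f x"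
      proof (rule AE_I2)
        fix x :: 'a
        have "x \<in> (\<Union>i. ?B i)" unfolding UN_box_eq_UNIV ..
        then obtain N where N: "x \<in> ?B N" by blast
        have "x \<in> ?B n" if "n \<ge> N" for n
        proof -
          have le: "real N \<le> real n" using that by simp
          have "\<forall>b\<in>Basis. - real N < x \<bullet> b \<and> x \<bullet> b < real N" using N by (simp add: mem_box)
          then have "\<forall>b\<in>Basis. - real n < x \<bullet> b \<and> x \<bullet> b < real n" using le by fastforce
          then show ?thesis by (simp add: mem_box)
        qed
        then have "\<forall>\<^sub>F n in sequentially. indicat_real (?B n) x *\<^sub>R f x = f x"
          by (auto simp: eventually_sequentially indicator_def)
        then show "(\<lambda>n. indicat_real (?B n) x *\<^sub>R f x) \<longlonglongrightarrow> f x" by (rule tendsto_eventually)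
      qed
    qed
    then show ?thesis using box by (simp add: LIMSEQ_const_iff set_lebesgue_integral_def)
  qed
  have "(LINT x:A|lborel. f x) = 0" if "A \<in> sets lborel" for A
  proof -
    have A: "A \<in> sigma_sets UNIV (range (\<lambda>(a, b). box a b :: 'a set))"
      using that by (simp add: borel_eq_box)
    have sets: "B \<in> sets lborel" if "B \<in> sigma_sets UNIV (range (\<lambda>(a, b). box a b :: 'a set))" for B
      using that by (simp add: borel_eq_box)
    \<comment> \<open>Open boxes are closed under intersection and generate the Borel sets, and the
      sets over which \<open>f\<close> integrates to zero form a Dynkin system.\<close>
    have IS: "Int_stable (range (\<lambda>(a, b). box a b :: 'a set))"
      by (auto simp: Int_stable_def box_Int_box)
    have "range (\<lambda>(a, b). box a b :: 'a set) \<subseteq> Pow UNIV" by simp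
    from IS this A show ?thesis
    proof (induction rule: sigma_sets_induct_disjoint)
      case (basic A) then show ?case using box by auto
    next
      case empty then show ?case by (simp add: set_lebesgue_integral_def)
    next
      case (compl A)
      have m: "A \<in> sets lborel" using sets[OF compl(1)] .
      have "(LINT x:A \<union> (UNIV - A)|lborel. f x) = (LINT x:A|lborel. f x) + (LINT x:(UNIV - A)|lborel. f x)"
        using m by (intro set_integral_Un int) auto
      then show ?case using compl UNIV by simp
    next
      case (union A) then show ?case using sets by (intro un) auto
    qed
  qed
  then show ?thesis
    using density_unique_real[OF f, of "\<lambda>_. 0"] by simp
qed

text \<open>Passing to a Borel representative of \<open>f\<close> changes none of the integrals over
  boxes.\<close>

lemma lebesgue_AE_zero_if_box_integrals_zero:
  fixes f :: "'a::euclidean_space \<Rightarrow> real"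
  assumes f: "integrable lebesgue f" and box: "\<And>a b. (LINT x:box a b|lebesgue. f x) = 0"
  shows "AE x in lebesgue. f x = 0"
proof -
  obtain g where g: "g \<in> borel_measurable lborel" "AE x in lborel. f x = g x"
    using completion_ex_borel_measurable_real[OF borel_measurable_integrable[OF f]] by blast
  have gc: "g \<in> borel_measurable lebesgue" using g(1) by (rule measurable_completion)
  have ae: "AE x in lebesgue. f x = g x" using g(2) by (rule AE_completion)
  have "integrable lebesgue g"
    using f integrable_cong_AE[OF borel_measurable_integrable[OF f] gc ae] by simp
  then have ig: "integrable lborel g" using g(1) by (simp add: integrable_completion)
  have "(LINT x:box a b|lborel. g x) = 0" for a b
  proof -
    have m: "(\<lambda>x. indicat_real (box a b) x *\<^sub>R g x) \<in> borel_measurable lborel" using g(1) by simp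
    have "(LINT x:box a b|lborel. g x) = (LINT x:box a b|lebesgue. g x)"
      unfolding set_lebesgue_integral_def using integral_completion[OF m] by simp
    also have "\<dots> = (LINT x:box a b|lebesgue. f x)"
      unfolding set_lebesgue_integral_def
      using ae measurable_completion[OF m] borel_measurable_integrable[OF f]
      by (intro integral_cong_AE) (auto intro!: borel_measurable_times borel_measurable_indicator)
    finally show ?thesis using box by simp
  qed
  from AE_completion[OF AE_zero_if_box_integrals_zero[OF ig this]] ae show ?thesis by eventually_elim simp
qed

lemma locally_integrable_cbox:
  assumes "locally_integrable \<Omega> g" "cbox l u \<subseteq> \<Omega>"
  shows "integrable lebesgue (\<lambda>x. indicator (cbox l u) x * g x)"
  using assms by (auto simp: locally_integrable_def set_integrable_def)

text \<open>An open set is a countable union of closed boxes, and the boundary of a box is a null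
  set.\<close>

lemma AE_lebesgue_on_open:
  fixes \<Omega> :: "'a::euclidean_space set"
  assumes "open \<Omega>" and box: "\<And>l u. cbox l u \<subseteq> \<Omega> \<Longrightarrow> AE x in lebesgue. x \<in> box l u \<longrightarrow> P x"
  shows "AE x in lebesgue_on \<Omega>. P x"
proof -
  obtain D where D: "countable D" "D \<subseteq> Pow \<Omega>" "\<And>X. X \<in> D \<Longrightarrow> \<exists>a b. X = cbox a b" "\<Union>D = \<Omega>"
    using open_countable_Union_open_cbox[OF assms(1)] by metis
  have "AE x in lebesgue. x \<in> X \<longrightarrow> P x" if X: "X \<in> D" for X
  proof -
    obtain l u where lu: "X = cbox l u" "cbox l u \<subseteq> \<Omega>" using D(2,3) X by blast
    have "negligible (cbox l u - box l u)" using negligible_frontier_interval by blast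
    then have "AE x in lebesgue. x \<notin> cbox l u - box l u"
      unfolding negligible_iff_null_sets by (rule AE_not_in)
    with box[OF lu(2)] show ?thesis unfolding lu(1) by eventually_elim auto
  qed
  then have "AE x in lebesgue. \<forall>X\<in>D. x \<in> X \<longrightarrow> P x" by (subst AE_ball_countable[OF D(1)]) blast
  then have "AE x in lebesgue. x \<in> \<Omega> \<longrightarrow> P x" by eventually_elim (use D(4) in blast)
  then show ?thesis using assms(1) by (subst AE_restrict_space_iff) auto
qed

text \<open>Testing with bumps shows that \<open>g\<close> integrates to zero over every box inside
  \<Omega>. As \<open>g\<close> is only locally integrable, the conclusion is drawn box by box, for
  \<open>g\<close> cut off to one box at a time.\<close>

lemma fundamental_lemma:
  assumes \<Omega>: "open \<Omega>" and g: "locally_integrable \<Omega> g"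
    and zero: "\<And>\<phi>. \<phi> \<in> test_functions \<Omega> \<Longrightarrow> (LINT x|lebesgue_on \<Omega>. g x * \<phi> x) = 0"
  shows "AE x in lebesgue_on \<Omega>. g x = 0"
proof (rule AE_lebesgue_on_open[OF \<Omega>])
  fix l u :: plane assume lu: "cbox l u \<subseteq> \<Omega>"
  have box0: "(LINT x|lebesgue. indicator (box a b) x * g x) = 0" if ab: "cbox a b \<subseteq> \<Omega>" for a b
  proof -
    let ?G = "\<lambda>x. indicator (cbox a b) x * g x"
    have G: "integrable lebesgue ?G" using locally_integrable_cbox[OF g ab] .
    have meas: "box_bump n a b \<in> borel_measurable lebesgue" for n
      using test_function_continuous[OF box_bump_test_function[OF ab], of UNIV]
      by (simp add: borel_measurable_continuous_onI measurable_completion)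
    have bb: "indicator (box a b) x * g x = indicator (box a b) x * ?G x" for x
      using box_subset_cbox[of a b] by (auto simp: indicator_def)
    have "(\<lambda>n. LINT x|lebesgue. box_bump n a b x * ?G x) \<longlonglongrightarrow> (LINT x|lebesgue. indicator (box a b) x * g x)"
    proof (rule integral_dominated_convergence[where w = "\<lambda>x. norm (?G x)"])
      show "(\<lambda>x. indicator (box a b) x * g x) \<in> borel_measurable lebesgue"
        unfolding bb by (rule borel_measurable_times[OF borel_measurable_indicator borel_measurable_integrable[OF G]]) simp
      show "(\<lambda>x. box_bump n a b x * ?G x) \<in> borel_measurable lebesgue" for n
        by (rule borel_measurable_times[OF meas borel_measurable_integrable[OF G]])
      show "integrable lebesgue (\<lambda>x. norm (?G x))" using G by (rule integrable_norm)
      show "AE x in lebesgue. (\<lambda>n. box_bump n a b x * ?G x) \<longlonglongrightarrow> indicator (box a b) x * g x"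
        unfolding bb by (intro AE_I2 tendsto_intros box_bump_tendsto)
      show "AE x in lebesgue. norm (box_bump n a b x * ?G x) \<le> norm (?G x)" for n
        using box_bump_bounds[of n a b] by (auto simp: abs_mult intro!: mult_left_le_one_le)
    qed
    moreover have "(LINT x|lebesgue. box_bump n a b x * ?G x) = 0" for n
    proof -
      have "(LINT x|lebesgue. box_bump n a b x * ?G x) = (LINT x|lebesgue. indicator \<Omega> x *\<^sub>R (g x * box_bump n a b x))"
        using box_bump_support[of n a b] box_subset_cbox[of a b] ab
        by (intro Bochner_Integration.integral_cong) (force simp: indicator_def)+
      also have "\<dots> = (LINT x|lebesgue_on \<Omega>. g x * box_bump n a b x)"
        using \<Omega> by (subst integral_restrict_space) auto
      also have "\<dots> = 0" by (rule zero[OF box_bump_test_function[OF ab]])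
      finally show ?thesis .
    qed
    ultimately show ?thesis by (simp add: LIMSEQ_const_iff)
  qed
  let ?f = "\<lambda>x. indicator (box l u) x * g x"
  have "AE x in lebesgue. ?f x = 0"
  proof (rule lebesgue_AE_zero_if_box_integrals_zero)
    have "integrable lebesgue (\<lambda>x. indicator (box l u) x *\<^sub>R (indicator (cbox l u) x * g x))"
      using locally_integrable_cbox[OF g lu] by (intro integrable_mult_indicator) auto
    moreover have "(\<lambda>x. indicator (box l u) x *\<^sub>R (indicator (cbox l u) x * g x)) = ?f"
      using box_subset_cbox[of l u] by (auto simp: fun_eq_iff indicator_def)
    ultimately show "integrable lebesgue ?f" by (simp only:)
    fix a b :: plane
    \<comment> \<open>Integrals of the cut-off function over arbitrary boxes are integrals of
      \<open>g\<close> over smaller boxes that still lie in \<Omega>.\<close>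
    obtain a' b' where ab': "box a b \<inter> box l u = box a' b'" using box_Int_box[of a b l u] by blast
    have eq: "(LINT x:box a b|lebesgue. ?f x) = (LINT x|lebesgue. indicator (box a' b') x * g x)"
      unfolding set_lebesgue_integral_def ab'[symmetric]
      by (intro Bochner_Integration.integral_cong) (auto simp: indicator_def)
    show "(LINT x:box a b|lebesgue. ?f x) = 0"
    proof (cases "box a' b' = {}")
      case True then show ?thesis unfolding eq by simp
    next
      case False
      have "cbox a' b' = closure (box a' b')" using closure_box[OF False] by simp
      also have "\<dots> \<subseteq> cbox l u" using ab' box_subset_cbox[of l u] by (intro closure_minimal) auto
      finally have "cbox a' b' \<subseteq> \<Omega>" using lu by auto
      then show ?thesis unfolding eq by (rule box0)
    qed
  qed
  then show "AE x in lebesgue. x \<in> box l u \<longrightarrow> g x = 0"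
    by eventually_elim (auto simp: indicator_def)
qed

section \<open>Weak derivatives\<close>

definition l2 :: "'a measure \<Rightarrow> ('a \<Rightarrow> real) set" where
  "l2 M = {g \<in> borel_measurable M. integrable M (\<lambda>x. (g x)\<^sup>2)}"

lemma l2D: "f \<in> l2 M \<Longrightarrow> f \<in> borel_measurable M" "f \<in> l2 M \<Longrightarrow> integrable M (\<lambda>x. (f x)\<^sup>2)"
  by (auto simp: l2_def)

lemma l2_mult:
  assumes "f \<in> l2 M" "g \<in> l2 M"
  shows "integrable M (\<lambda>x. f x * g x)"
proof (rule Bochner_Integration.integrable_bound)
  show "integrable M (\<lambda>x. (f x)\<^sup>2 + (g x)\<^sup>2)" using assms by (simp add: l2D)
  show "(\<lambda>x. f x * g x) \<in> borel_measurable M" using assms[THEN l2D(1)] by simp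
  have "\<bar>a * b\<bar> \<le> \<bar>a\<^sup>2 + b\<^sup>2\<bar>" for a b :: real
  proof -
    have "2 * (\<bar>a\<bar> * \<bar>b\<bar>) \<le> a\<^sup>2 + b\<^sup>2" using zero_le_power2[of "\<bar>a\<bar> - \<bar>b\<bar>"] by (simp add: power2_diff)
    moreover have "0 \<le> \<bar>a\<bar> * \<bar>b\<bar>" by simp
    ultimately show ?thesis unfolding abs_mult by linarith
  qed
  then show "AE x in M. norm (f x * g x) \<le> norm ((f x)\<^sup>2 + (g x)\<^sup>2)" by simp
qed

lemma l2_lin:
  assumes "f \<in> l2 M" "g \<in> l2 M"
  shows "(\<lambda>x. a * f x + b * g x) \<in> l2 M"
proof -
  have "integrable M (\<lambda>x. a\<^sup>2 * (f x)\<^sup>2 + b\<^sup>2 * (g x)\<^sup>2 + 2 * a * b * (f x * g x))"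
    using assms l2_mult[OF assms] by (intro Bochner_Integration.integrable_add integrable_mult_right) (auto simp: l2D)
  moreover have "(\<lambda>x. a\<^sup>2 * (f x)\<^sup>2 + b\<^sup>2 * (g x)\<^sup>2 + 2 * a * b * (f x * g x)) = (\<lambda>x. (a * f x + b * g x)\<^sup>2)"
    by (simp add: fun_eq_iff power2_eq_square algebra_simps)
  ultimately show ?thesis using assms[THEN l2D(1)] by (auto simp: l2_def)
qed

text \<open>Fatou's lemma. The index \<open>K\<close> is there because in both applications the
  bound on the integrals holds only from some index on.\<close>

lemma fatou_bound:
  fixes v :: "nat \<Rightarrow> 'a \<Rightarrow> real"
  assumes v: "\<And>k. integrable M (v k)" "\<And>k x. 0 \<le> v k x" and w: "w \<in> borel_measurable M" "\<And>x. 0 \<le> w x"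
    and lim: "AE x in M. (\<lambda>k. v k x) \<longlonglongrightarrow> w x"
    and B: "\<And>k. k \<ge> K \<Longrightarrow> integral\<^sup>L M (v k) \<le> B"
  shows "integrable M w" "integral\<^sup>L M w \<le> B"
proof -
  have "0 \<le> integral\<^sup>L M (v K)" by (intro integral_nonneg_AE AE_I2 v(2))
  then have B0: "0 \<le> B" using B[of K] by linarith
  have "(\<integral>\<^sup>+x. ennreal (w x) \<partial>M) = (\<integral>\<^sup>+x. liminf (\<lambda>k. ennreal (v k x)) \<partial>M)"
  proof (rule nn_integral_cong_AE)
    show "AE x in M. ennreal (w x) = liminf (\<lambda>k. ennreal (v k x))"
      using lim
    proof eventually_elim
      fix x assume "(\<lambda>k. v k x) \<longlonglongrightarrow> w x"
      then have "(\<lambda>k. ennreal (v k x)) \<longlonglongrightarrow> ennreal (w x)" by (rule tendsto_ennrealI)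
      then show "ennreal (w x) = liminf (\<lambda>k. ennreal (v k x))"
        by (simp add: lim_imp_Liminf)
    qed
  qed
  also have "\<dots> \<le> liminf (\<lambda>k. \<integral>\<^sup>+x. ennreal (v k x) \<partial>M)"
    using borel_measurable_integrable[OF v(1)] by (intro nn_integral_liminf) auto
  also have "\<dots> \<le> ennreal B"
  proof (rule Liminf_le)
    show "\<forall>\<^sub>F k in sequentially. (\<integral>\<^sup>+x. ennreal (v k x) \<partial>M) \<le> ennreal B"
      unfolding eventually_sequentially
      by (intro exI[of _ K] allI impI) (use v B in \<open>simp add: nn_integral_eq_integral ennreal_leI\<close>)
  qed simp
  finally have le: "(\<integral>\<^sup>+x. ennreal (w x) \<partial>M) \<le> ennreal B" .
  show int: "integrable M w"
    using le w by (intro integrableI_nonneg) (auto intro: le_less_trans)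
  show "integral\<^sup>L M w \<le> B"
    using le B0 w(2) by (simp add: nn_integral_eq_integral[OF int])
qed

text \<open>The Riesz-Fischer theorem. The measure may be infinite, so the increments a_k of a fast
  subsequence need not be integrable; instead the weighted squares 2^k a_k^2 have a summable
  integral, which gives absolute convergence at almost every point. Fatou's lemma then shows that
  the whole sequence converges in norm to the pointwise limit of the subsequence.\<close>

lemma l2_complete:
  assumes X: "\<And>n. X n \<in> l2 M"
    and cauchy: "\<And>e. e > 0 \<Longrightarrow> \<exists>N. \<forall>m\<ge>N. \<forall>n\<ge>N. sqrt (LINT x|M. (X m x - X n x) * (X m x - X n x)) < e"
  shows "\<exists>f\<in>l2 M. (\<lambda>n::nat. sqrt (LINT x|M. (X n x - f x) * (X n x - f x))) \<longlonglongrightarrow> 0"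
proof -
  have Xm [measurable]: "X n \<in> borel_measurable M" for n using X by (rule l2D(1))
  have dl2: "(\<lambda>x. X m x - X n x) \<in> l2 M" for m n using l2_lin[OF X[of m] X[of n], of 1 "-1"] by simp
  have int: "integrable M (\<lambda>x. (X m x - X n x)\<^sup>2)" for m n using l2D(2)[OF dl2] by simp
  have small: "\<exists>N. \<forall>m\<ge>N. \<forall>n\<ge>N. (LINT x|M. (X m x - X n x)\<^sup>2) < e" if "e > 0" for e
  proof -
    obtain N where N: "\<forall>m\<ge>N. \<forall>n\<ge>N. sqrt (LINT x|M. (X m x - X n x) * (X m x - X n x)) < sqrt e"
      using cauchy[of "sqrt e"] \<open>e > 0\<close> by auto
    then show ?thesis by (intro exI[of _ N]) (simp add: power2_eq_square)
  qed
  have "\<exists>r. \<forall>k. (\<forall>m\<ge>r k. (LINT x|M. (X m x - X (r k) x)\<^sup>2) < (1/4)^k) \<and> r k < (r (Suc k)::nat)"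
  proof (intro dependent_nat_choice)
    show "\<exists>r. \<forall>m\<ge>r. (LINT x|M. (X m x - X r x)\<^sup>2) < (1/4)^0" using small[of 1] by auto
    fix r k
    obtain N where N: "\<forall>m\<ge>N. \<forall>n\<ge>N. (LINT x|M. (X m x - X n x)\<^sup>2) < (1/4)^(Suc k)"
      using small[of "(1/4)^(Suc k)"] by auto
    show "\<exists>y. (\<forall>m\<ge>y. (LINT x|M. (X m x - X y x)\<^sup>2) < (1/4)^(Suc k)) \<and> r < y"
      by (rule exI[of _ "max N (Suc r)"]) (use N in auto)
  qed
  then obtain r where r: "\<And>k m. m \<ge> r k \<Longrightarrow> (LINT x|M. (X m x - X (r k) x)\<^sup>2) < (1/4)^k" "\<And>k. r k < r (Suc k)"
    by blast
  define a where "a k x = X (r (Suc k)) x - X (r k) x" for k x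
  have am [measurable]: "a k \<in> borel_measurable M" for k unfolding a_def by simp
  \<comment> \<open>Squared increments below (1/4)^k leave (1/2)^k after weighting by 2^k.\<close>
  have a: "(\<integral>\<^sup>+x. ennreal (2^k * (a k x)\<^sup>2) \<partial>M) \<le> ennreal ((1/2)^k)" for k
  proof -
    have "(\<integral>\<^sup>+x. ennreal (2^k * (a k x)\<^sup>2) \<partial>M) = ennreal (LINT x|M. 2^k * (a k x)\<^sup>2)"
      using int unfolding a_def by (intro nn_integral_eq_integral) auto
    also have "(LINT x|M. 2^k * (a k x)\<^sup>2) = 2^k * (LINT x|M. (a k x)\<^sup>2)" by simp
    also have "\<dots> \<le> 2^k * (1/4)^k" using r(1)[of k "r (Suc k)"] r(2)[of k] by (auto simp: a_def)
    also have "2^k * (1/4)^k = (1/2::real)^k" by (simp flip: power_mult_distrib)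
    finally show ?thesis by (simp add: ennreal_leI)
  qed
  have "(\<integral>\<^sup>+x. (\<Sum>k. ennreal (2^k * (a k x)\<^sup>2)) \<partial>M) = (\<Sum>k. \<integral>\<^sup>+x. ennreal (2^k * (a k x)\<^sup>2) \<partial>M)"
    by (intro nn_integral_suminf) simp
  also have "\<dots> \<le> (\<Sum>k. ennreal ((1/2)^k))" by (intro suminf_le a) auto
  also have "\<dots> = ennreal (\<Sum>k. (1/2)^k)" by (intro suminf_ennreal_eq) (auto intro!: summable_sums summable_geometric)
  finally have "(\<integral>\<^sup>+x. (\<Sum>k. ennreal (2^k * (a k x)\<^sup>2)) \<partial>M) \<noteq> \<infinity>" by (auto simp: top_unique)
  then have "AE x in M. (\<Sum>k. ennreal (2^k * (a k x)\<^sup>2)) \<noteq> \<infinity>"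
    by (intro nn_integral_PInf_AE) auto
  then have conv: "AE x in M. convergent (\<lambda>k. X (r k) x)"
  proof eventually_elim
    fix x assume "(\<Sum>k. ennreal (2^k * (a k x)\<^sup>2)) \<noteq> \<infinity>"
    then have s1: "summable (\<lambda>k. 2^k * (a k x)\<^sup>2)" by (intro summable_suminf_not_top) auto
    have "summable (\<lambda>k. (1/2::real)^k)" by (intro summable_geometric) auto
    with s1 have s2: "summable (\<lambda>k. 2^k * (a k x)\<^sup>2 + (1/2)^k)" by (intro summable_add)
    have "summable (\<lambda>k. a k x)"
    proof (rule summable_comparison_test'[OF s2, of 0])
      fix k
      \<comment> \<open>Young's inequality with weight 2^k, written as a completed square.\<close>
      have "0 \<le> (1/2)^k * (2^k * \<bar>a k x\<bar> - 1/2)\<^sup>2" by simp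
      also have "\<dots> = 2^k * (a k x)\<^sup>2 - \<bar>a k x\<bar> + (1/2)^k / 4"
        by (simp add: power2_diff power_mult_distrib power_divide field_simps power2_eq_square)
      finally have "\<bar>a k x\<bar> \<le> 2^k * (a k x)\<^sup>2 + (1/2)^k / 4" by simp
      also have "\<dots> \<le> 2^k * (a k x)\<^sup>2 + (1/2)^k" by simp
      finally show "norm (a k x) \<le> 2^k * (a k x)\<^sup>2 + (1/2)^k" by simp
    qed
    then have "(\<lambda>n. X (r 0) x + (\<Sum>k<n. a k x)) \<longlonglongrightarrow> X (r 0) x + (\<Sum>k. a k x)"
      by (intro tendsto_intros summable_LIMSEQ)
    moreover have "X (r 0) x + (\<Sum>k<n. a k x) = X (r n) x" for n
      unfolding a_def by (induction n) auto
    ultimately show "convergent (\<lambda>k. X (r k) x)" by (auto simp: convergent_def)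
  qed
  define f where "f x = lim (\<lambda>k. X (r k) x)" for x
  have fm [measurable]: "f \<in> borel_measurable M" unfolding f_def[abs_def] by (intro borel_measurable_lim_metric) auto
  have lim: "AE x in M. (\<lambda>k. X (r k) x) \<longlonglongrightarrow> f x"
    using conv by eventually_elim (simp add: f_def convergent_LIMSEQ_iff)
  have rk: "k \<le> r k" for k by (induction k) (use r(2) in \<open>auto intro: Suc_leI le_less_trans\<close>)
  have est: "\<exists>N. \<forall>n\<ge>N. integrable M (\<lambda>x. (X n x - f x)\<^sup>2) \<and> (LINT x|M. (X n x - f x)\<^sup>2) \<le> e" if "e > 0" for e
  proof -
    obtain N where N: "\<forall>m\<ge>N. \<forall>n\<ge>N. (LINT x|M. (X m x - X n x)\<^sup>2) < e" using small[OF \<open>e > 0\<close>] by auto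
    have "integrable M (\<lambda>x. (X n x - f x)\<^sup>2) \<and> (LINT x|M. (X n x - f x)\<^sup>2) \<le> e" if n: "n \<ge> N" for n
    proof (intro conjI)
      have l: "AE x in M. (\<lambda>k. (X n x - X (r k) x)\<^sup>2) \<longlonglongrightarrow> (X n x - f x)\<^sup>2"
        using lim by eventually_elim (intro tendsto_intros)
      have b: "(LINT x|M. (X n x - X (r k) x)\<^sup>2) \<le> e" if "k \<ge> N" for k
        using N n that rk[of k] by (meson le_trans less_imp_le)
      show "integrable M (\<lambda>x. (X n x - f x)\<^sup>2)"
        by (rule fatou_bound(1)[OF int _ _ _ l b]) auto
      show "(LINT x|M. (X n x - f x)\<^sup>2) \<le> e"
        by (rule fatou_bound(2)[OF int _ _ _ l b]) auto
    qed
    then show ?thesis by blast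
  qed
  obtain n0 where "integrable M (\<lambda>x. (X n0 x - f x)\<^sup>2)" using est[of 1] by auto
  then have "(\<lambda>x. X n0 x - f x) \<in> l2 M" by (simp add: l2_def)
  from l2_lin[OF X[of n0] this, of 1 "-1"] have fl2: "f \<in> l2 M" by simp
  have "(\<lambda>n. sqrt (LINT x|M. (X n x - f x) * (X n x - f x))) \<longlonglongrightarrow> sqrt 0"
  proof (intro tendsto_real_sqrt LIMSEQ_I)
    fix e :: real assume "e > 0"
    then obtain N where "\<forall>n\<ge>N. (LINT x|M. (X n x - f x)\<^sup>2) \<le> e / 2" using est[of "e/2"] by auto
    then show "\<exists>N. \<forall>n\<ge>N. norm ((LINT x|M. (X n x - f x) * (X n x - f x)) - 0) < e"
      using \<open>e > 0\<close> by (intro exI[of _ N]) (auto simp: power2_eq_square intro: le_less_trans)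
  qed
  then show ?thesis using fl2 by (intro bexI[of _ f]) simp_all
qed

lemma subspace_l2: "subspace (l2 M)"
  unfolding subspace_def
proof (intro conjI ballI allI)
  show "0 \<in> l2 M" by (simp add: l2_def zero_fun_def)
  show "f + g \<in> l2 M" if "f \<in> l2 M" "g \<in> l2 M" for f g
    using l2_lin[OF that, of 1 1] by (simp add: plus_fun_def)
  show "c *\<^sub>R f \<in> l2 M" if "f \<in> l2 M" for f c
    using l2_lin[OF that that, of c 0] by (simp add: scaleR_fun_def)
qed

lemma semi_hilbert_l2: "semi_hilbert (l2 M) (\<lambda>f g. LINT x|M. f x * g x)"
proof
  show "subspace (l2 M)" by (rule subspace_l2)
  show "(LINT z|M. (f + g) z * h z) = (LINT z|M. f z * h z) + (LINT z|M. g z * h z)"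
    if "f \<in> l2 M" "g \<in> l2 M" "h \<in> l2 M" for f g h
    using l2_mult[OF that(1,3)] l2_mult[OF that(2,3)] by (simp add: distrib_right)
  show "(LINT x|M. (c *\<^sub>R f) x * h x) = c * (LINT x|M. f x * h x)" for f h c by (simp add: mult.assoc)
  show "(LINT x|M. f x * g x) = (LINT x|M. g x * f x)" for f g :: "'a \<Rightarrow> real" by (simp add: mult.commute)
  show "0 \<le> (LINT x|M. f x * f x)" for f :: "'a \<Rightarrow> real" by simp
  show "\<exists>x\<in>l2 M. (\<lambda>n. sqrt (LINT y|M. (X n - x) y * (X n - x) y)) \<longlonglongrightarrow> 0"
    if "\<And>n. X n \<in> l2 M" "\<And>e. e > 0 \<Longrightarrow> \<exists>N. \<forall>m\<ge>N. \<forall>n\<ge>N. sqrt (LINT x|M. (X m - X n) x * (X m - X n) x) < e" for X :: "nat \<Rightarrow> _"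
    using l2_complete[of X M] that by simp
qed

interpretation l2: semi_hilbert "l2 M" "\<lambda>f g. LINT x|M. f x * g x" for M
  by (rule semi_hilbert_l2)

lemma L2_eq_l2: "L2 \<Omega> = l2 (lebesgue_on \<Omega>)"
  by (simp add: L2_def l2_def)

lemma l2_AE_subseq:
  assumes X: "\<And>n. X n \<in> l2 M" "f \<in> l2 M" and lim: "(\<lambda>n. LINT x|M. (X n x - f x)\<^sup>2) \<longlonglongrightarrow> 0"
  shows "\<exists>r::nat \<Rightarrow> nat. strict_mono r \<and> (AE x in M. (\<lambda>n. X (r n) x) \<longlonglongrightarrow> f x)"
proof -
  have "integrable M (\<lambda>x. (X n x - f x)\<^sup>2)" for n
    using l2D(2)[OF l2_lin[OF X(1)[of n] X(2), of 1 "-1"]] by simp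
  from tendsto_L1_AE_subseq[of M "\<lambda>n x. (X n x - f x)\<^sup>2", OF this] lim
  obtain r where r: "strict_mono r" "AE x in M. (\<lambda>n. (X (r n) x - f x)\<^sup>2) \<longlonglongrightarrow> 0" by auto
  from r(2) have "AE x in M. (\<lambda>n. X (r n) x) \<longlonglongrightarrow> f x"
  proof eventually_elim
    fix x assume "(\<lambda>n. (X (r n) x - f x)\<^sup>2) \<longlonglongrightarrow> 0"
    from tendsto_real_sqrt[OF this] show "(\<lambda>n. X (r n) x) \<longlonglongrightarrow> f x"
      by (simp add: LIM_zero_cancel tendsto_rabs_zero_iff)
  qed
  then show ?thesis using r(1) by blast
qed

lemma l2_AE_cong:
  assumes "f \<in> l2 M" "g \<in> borel_measurable M" "AE x in M. f x = g x"
  shows "g \<in> l2 M"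
proof -
  have "integrable M (\<lambda>x. (g x)\<^sup>2)"
    using assms(3) l2D(2)[OF assms(1)] l2D(1)[OF assms(1)] assms(2)
    by (subst integrable_cong_AE[where g = "\<lambda>x. (f x)\<^sup>2"]) auto
  then show ?thesis using assms(2) by (simp add: l2_def)
qed

section \<open>Weak derivatives and Sobolev spaces on an open set\<close>

locale open_domain =
  fixes \<Omega> :: "plane set"
  assumes open_\<Omega>: "open \<Omega>"
begin

abbreviation "M \<equiv> lebesgue_on \<Omega>"
abbreviation "TF \<equiv> test_functions \<Omega>"
abbreviation "D \<equiv> weak_deriv \<Omega>"

lemma sets_\<Omega> [simp]: "\<Omega> \<in> sets lebesgue"
  using open_\<Omega> by simp

lemma continuous_measurable:
  fixes f :: "plane \<Rightarrow> real"
  shows "continuous_on UNIV f \<Longrightarrow> f \<in> borel_measurable M"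
  by (intro measurable_restrict_space1 measurable_completion) (simp add: borel_measurable_continuous_onI)

text \<open>The bridge between two measures: Sobolev notions use Lebesgue measure on \<Omega>, while
  integration by parts and Fubini are carried out for \<open>lborel\<close> on the whole
  plane.\<close>

lemma integral_supported:
  fixes f :: "plane \<Rightarrow> real"
  assumes "continuous_on UNIV f" "\<And>x. x \<notin> \<Omega> \<Longrightarrow> f x = 0"
  shows "(LINT x|M. f x) = (LINT x|lborel. f x)" "integrable lborel f \<Longrightarrow> integrable M f"
    "(\<integral>\<^sup>+x. ennreal (f x) \<partial>M) = (\<integral>\<^sup>+x. ennreal (f x) \<partial>lborel)"
proof -
  have m: "f \<in> borel_measurable lborel" using assms(1) by (simp add: borel_measurable_continuous_onI)
  have eq: "(\<lambda>x. indicator \<Omega> x *\<^sub>R f x) = f" using assms(2) by (auto simp: indicator_def fun_eq_iff)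
  show "(LINT x|M. f x) = (LINT x|lborel. f x)"
    by (subst integral_restrict_space) (simp_all only: eq integral_completion[OF m], simp)
  show "integrable lborel f \<Longrightarrow> integrable M f"
    by (subst integrable_restrict_space) (simp_all only: eq integrable_completion[OF m], simp)
  have "(\<integral>\<^sup>+x. ennreal (f x) \<partial>M) = (\<integral>\<^sup>+x. ennreal (f x) * indicator \<Omega> x \<partial>lebesgue)"
    by (subst nn_integral_restrict_space) auto
  also have "\<dots> = (\<integral>\<^sup>+x. ennreal (f x) \<partial>lebesgue)"
    using assms(2) by (intro nn_integral_cong) (auto simp: indicator_def)
  finally show "(\<integral>\<^sup>+x. ennreal (f x) \<partial>M) = (\<integral>\<^sup>+x. ennreal (f x) \<partial>lborel)"
    by (simp add: nn_integral_completion)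
qed

lemma TF_measurable [simp]: "\<phi> \<in> TF \<Longrightarrow> \<phi> \<in> borel_measurable M"
  by (intro continuous_measurable test_function_continuous)

lemma TF_bounded:
  assumes "\<phi> \<in> TF"
  obtains C where "C \<ge> 0" "\<And>x. \<bar>\<phi> x\<bar> \<le> C"
  using bounded_support_bounded[OF test_function_bounded_support[OF assms] test_function_continuous[OF assms]] by blast

lemma TF_mult_integral:
  assumes "\<phi> \<in> TF" "\<psi> \<in> TF"
  shows "(LINT x|M. \<phi> x * \<psi> x) = (LINT x|lborel. \<phi> x * \<psi> x)" "integrable M (\<lambda>x. \<phi> x * \<psi> x)" "integrable lborel (\<lambda>x. \<phi> x * \<psi> x)"
proof -
  have c: "continuous_on UNIV (\<lambda>x. \<phi> x * \<psi> x)" using assms by (intro continuous_intros test_function_continuous)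
  have z: "\<phi> x * \<psi> x = 0" if "x \<notin> \<Omega>" for x using test_function_zero_outside[OF assms(1) that] by simp
  show "(LINT x|M. \<phi> x * \<psi> x) = (LINT x|lborel. \<phi> x * \<psi> x)" by (rule integral_supported(1)[OF c z])
  show i: "integrable lborel (\<lambda>x. \<phi> x * \<psi> x)"
    by (intro bounded_support_integrable bounded_support_mult(1) test_function_bounded_support[OF assms(2)] c)
  show "integrable M (\<lambda>x. \<phi> x * \<psi> x)" by (rule integral_supported(2)[OF c z i])
qed

lemma TF_l2: "\<phi> \<in> TF \<Longrightarrow> \<phi> \<in> l2 M"
  using TF_mult_integral(2)[of \<phi> \<phi>] by (simp add: l2_def power2_eq_square)

lemma locally_integrable_TF:
  assumes g: "locally_integrable \<Omega> g" and \<phi>: "\<phi> \<in> TF"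
  shows "integrable M (\<lambda>x. g x * \<phi> x)"
proof -
  let ?K = "closure {x. \<phi> x \<noteq> 0}"
  have "compact ?K" "?K \<subseteq> \<Omega>" using \<phi> by (auto simp: test_functions_def)
  then have i: "integrable lebesgue (\<lambda>x. indicator ?K x *\<^sub>R g x)"
    using g by (simp add: locally_integrable_def set_integrable_def)
  obtain C where C: "C \<ge> 0" "\<And>x. \<bar>\<phi> x\<bar> \<le> C" using TF_bounded[OF \<phi>] by blast
  have m: "\<phi> \<in> borel_measurable lebesgue"
    using test_function_continuous[OF \<phi>, of UNIV] by (intro measurable_completion) (simp add: borel_measurable_continuous_onI)
  have K: "\<phi> x \<noteq> 0 \<Longrightarrow> x \<in> ?K" for x using closure_subset[of "{x. \<phi> x \<noteq> 0}"] by auto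
  have eq: "(\<lambda>x. indicator \<Omega> x *\<^sub>R (g x * \<phi> x)) = (\<lambda>x. (indicator ?K x *\<^sub>R g x) * \<phi> x)"
  proof
    fix x show "indicator \<Omega> x *\<^sub>R (g x * \<phi> x) = (indicator ?K x *\<^sub>R g x) * \<phi> x"
      using K[of x] \<open>?K \<subseteq> \<Omega>\<close> by (cases "\<phi> x = 0") (auto simp: indicator_def)
  qed
  have "integrable lebesgue (\<lambda>x. (indicator ?K x *\<^sub>R g x) * \<phi> x)"
  proof (rule Bochner_Integration.integrable_bound)
    show "integrable lebesgue (\<lambda>x. C * (indicator ?K x *\<^sub>R g x))" using i by (rule integrable_mult_right)
    show "(\<lambda>x. (indicator ?K x *\<^sub>R g x) * \<phi> x) \<in> borel_measurable lebesgue"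
      by (rule borel_measurable_times[OF borel_measurable_integrable[OF i] m])
    show "AE x in lebesgue. norm ((indicator ?K x *\<^sub>R g x) * \<phi> x) \<le> norm (C * (indicator ?K x *\<^sub>R g x))"
      using C by (intro AE_I2) (auto simp: abs_mult mult.commute[of C] intro!: mult_left_mono)
  qed
  then show ?thesis by (subst integrable_restrict_space) (simp_all only: eq, simp)
qed

text \<open>The indicator of a compact set is square integrable, so restricting \<open>g\<close> to
  that set gives a product of two \<open>l2\<close> functions.\<close>

lemma l2_locally_integrable:
  assumes "g \<in> l2 M"
  shows "locally_integrable \<Omega> g"
  unfolding locally_integrable_def
proof (intro allI impI)
  fix K assume K: "compact K \<and> K \<subseteq> \<Omega>"
  have KM: "K \<in> sets M" using K by (auto simp: sets_restrict_space_iff compact_imp_closed)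
  have "indicat_real K \<in> l2 M"
  proof -
    have "K \<in> sets borel" using K by (auto intro: borel_closed compact_imp_closed)
    then have "emeasure M K < \<infinity>"
      using K emeasure_restrict_space[of \<Omega> lebesgue K] emeasure_compact_finite[of K] by simp
    then have "integrable M (indicat_real K)" using KM by (intro integrable_real_indicator)
    moreover have "(\<lambda>x. (indicat_real K x)\<^sup>2) = indicat_real K" by (auto simp: indicator_def)
    ultimately show ?thesis using KM by (simp add: l2_def)
  qed
  from l2_mult[OF this assms] have "integrable lebesgue (\<lambda>x. indicator \<Omega> x *\<^sub>R (indicat_real K x * g x))"
    by (subst (asm) integrable_restrict_space) auto
  moreover have "(\<lambda>x. indicator \<Omega> x *\<^sub>R (indicat_real K x * g x)) = (\<lambda>x. indicator K x *\<^sub>R g x)"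
    using K by (auto simp: fun_eq_iff indicator_def)
  ultimately show "g absolutely_integrable_on K" by (simp add: set_integrable_def)
qed

lemma locally_integrable_lin:
  assumes "locally_integrable \<Omega> g" "locally_integrable \<Omega> h"
  shows "locally_integrable \<Omega> (\<lambda>x. a * g x + b * h x)"
  using assms unfolding locally_integrable_def
  by (auto intro!: set_integral_add set_integrable_mult_right)

lemma has_weak_deriv_unique:
  assumes "has_weak_deriv \<Omega> is u g" "has_weak_deriv \<Omega> is u h"
  shows "AE x in M. g x = h x"
proof -
  have li: "locally_integrable \<Omega> g" "locally_integrable \<Omega> h" using assms by (auto simp: has_weak_deriv_def)
  have "AE x in M. 1 * g x + (-1) * h x = 0"
  proof (rule fundamental_lemma[OF open_\<Omega> locally_integrable_lin[OF li]])
    fix \<phi> assume \<phi>: "\<phi> \<in> TF"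
    have "(-1) ^ length is * (LINT x|M. g x * \<phi> x) = (-1) ^ length is * (LINT x|M. h x * \<phi> x)"
      using assms \<phi> unfolding has_weak_deriv_def by simp
    then have "(LINT x|M. g x * \<phi> x) = (LINT x|M. h x * \<phi> x)" by simp
    then show "(LINT x|M. (1 * g x + (-1) * h x) * \<phi> x) = 0"
      using locally_integrable_TF[OF li(1) \<phi>] locally_integrable_TF[OF li(2) \<phi>] by (simp add: left_diff_distrib)
  qed
  then show ?thesis by eventually_elim simp
qed

lemma has_weak_deriv_lin:
  assumes "has_weak_deriv \<Omega> is u g" "has_weak_deriv \<Omega> is v h"
  shows "has_weak_deriv \<Omega> is (\<lambda>x. a * u x + b * v x) (\<lambda>x. a * g x + b * h x)"
proof -
  have li: "locally_integrable \<Omega> u" "locally_integrable \<Omega> v" "locally_integrable \<Omega> g" "locally_integrable \<Omega> h"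
    using assms by (auto simp: has_weak_deriv_def)
  have *: "(LINT x|M. (a * p x + b * q x) * \<phi> x) = a * (LINT x|M. p x * \<phi> x) + b * (LINT x|M. q x * \<phi> x)"
    if "locally_integrable \<Omega> p" "locally_integrable \<Omega> q" "\<phi> \<in> TF" for p q \<phi>
    using locally_integrable_TF[OF that(1,3)] locally_integrable_TF[OF that(2,3)] by (simp add: distrib_right mult.assoc)
  show ?thesis unfolding has_weak_deriv_def
  proof (intro conjI ballI locally_integrable_lin li)
    fix \<phi> assume \<phi>: "\<phi> \<in> TF"
    have "(LINT x|M. u x * pdiffs is \<phi> x) = (-1) ^ length is * (LINT x|M. g x * \<phi> x)"
      "(LINT x|M. v x * pdiffs is \<phi> x) = (-1) ^ length is * (LINT x|M. h x * \<phi> x)"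
      using assms \<phi> by (auto simp: has_weak_deriv_def)
    then show "(LINT x|M. (a * u x + b * v x) * pdiffs is \<phi> x) = (-1) ^ length is * (LINT x|M. (a * g x + b * h x) * \<phi> x)"
      unfolding *[OF li(1,2) test_functions_pdiffs[OF \<phi>]] *[OF li(3,4) \<phi>] by (simp add: algebra_simps)
  qed
qed

lemma weak_deriv_works:
  assumes "has_weak_deriv \<Omega> is u g"
  shows "has_weak_deriv \<Omega> is u (D is u)" "AE x in M. D is u x = g x"
proof -
  show "has_weak_deriv \<Omega> is u (D is u)" unfolding weak_deriv_def
    by (rule someI[where P = "has_weak_deriv \<Omega> is u", OF assms])
  then show "AE x in M. D is u x = g x" using has_weak_deriv_unique assms by blast
qed

text \<open>\<open>weak_deriv\<close> is a choice that is known to agree with a square-integrable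
  derivative only almost everywhere. Completeness of Lebesgue measure makes the chosen function
  measurable.\<close>

lemma borel_measurable_AE_on:
  fixes f g :: "plane \<Rightarrow> real"
  assumes f: "f \<in> borel_measurable M" and ae: "AE x in M. f x = g x"
  shows "g \<in> borel_measurable M"
proof -
  have "(\<lambda>x. if x \<in> \<Omega> then f x else 0) \<in> borel_measurable lebesgue" using f by (simp add: borel_measurable_if)
  moreover have "AE x in lebesgue. (if x \<in> \<Omega> then f x else 0) = (if x \<in> \<Omega> then g x else 0)"
  proof -
    have "AE x in lebesgue. x \<in> \<Omega> \<longrightarrow> f x = g x" using ae by (subst (asm) AE_restrict_space_iff) auto
    then show ?thesis by eventually_elim auto
  qed
  ultimately have "(\<lambda>x. if x \<in> \<Omega> then g x else 0) \<in> borel_measurable lebesgue" by (rule borel_measurable_AE)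
  then show ?thesis by (simp add: borel_measurable_if)
qed

lemma weak_deriv_l2:
  assumes "has_weak_deriv \<Omega> is u g" "g \<in> l2 M"
  shows "D is u \<in> l2 M"
proof -
  have ae: "AE x in M. g x = D is u x" using weak_deriv_works(2)[OF assms(1)] by eventually_elim simp
  show ?thesis using l2_AE_cong[OF assms(2) borel_measurable_AE_on[OF l2D(1)[OF assms(2)] ae] ae] .
qed

lemma sobolevD:
  assumes "u \<in> sobolev \<Omega> m" "length is \<le> m"
  shows "has_weak_deriv \<Omega> is u (D is u)" "D is u \<in> l2 M" "u \<in> l2 M"
  using assms weak_deriv_l2 weak_deriv_works(1) by (auto simp: sobolev_def L2_eq_l2)

lemma sobolevI:
  assumes "u \<in> l2 M" "\<And>is. length is \<le> m \<Longrightarrow> \<exists>g\<in>l2 M. has_weak_deriv \<Omega> is u g"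
  shows "u \<in> sobolev \<Omega> m"
  using assms by (auto simp: sobolev_def L2_eq_l2)

lemma sobolev_lin:
  assumes "u \<in> sobolev \<Omega> m" "v \<in> sobolev \<Omega> m"
  shows "(\<lambda>x. a * u x + b * v x) \<in> sobolev \<Omega> m"
proof (rule sobolevI)
  show "(\<lambda>x. a * u x + b * v x) \<in> l2 M" using assms by (auto intro!: l2_lin simp: sobolev_def L2_eq_l2)
  fix "is" :: "2 list" assume len: "length is \<le> m"
  show "\<exists>g\<in>l2 M. has_weak_deriv \<Omega> is (\<lambda>x. a * u x + b * v x) g"
    using has_weak_deriv_lin[OF sobolevD(1)[OF assms(1) len] sobolevD(1)[OF assms(2) len]]
      l2_lin[OF sobolevD(2)[OF assms(1) len] sobolevD(2)[OF assms(2) len]] by blast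
qed

lemma weak_deriv_lin:
  assumes "u \<in> sobolev \<Omega> m" "v \<in> sobolev \<Omega> m" "length is \<le> m"
  shows "AE x in M. D is (\<lambda>x. a * u x + b * v x) x = a * D is u x + b * D is v x"
  by (rule weak_deriv_works(2)[OF has_weak_deriv_lin]) (use sobolevD assms in blast)+

lemma has_weak_deriv_Nil: "u \<in> l2 M \<Longrightarrow> has_weak_deriv \<Omega> [] u u"
  by (simp add: has_weak_deriv_def l2_locally_integrable)

lemma weak_deriv_Nil: "u \<in> l2 M \<Longrightarrow> AE x in M. D [] u x = u x"
  by (rule weak_deriv_works(2)[OF has_weak_deriv_Nil])

text \<open>The outermost derivative on \<phi> is the first to be moved and becomes the innermost
  one on \<psi>; this reverses the list and explains every later \<open>rev\<close>.\<close>

lemma TF_integral_pdiffs: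
  "\<phi> \<in> TF \<Longrightarrow> \<psi> \<in> TF \<Longrightarrow> (LINT x|M. \<psi> x * pdiffs is \<phi> x) = (-1) ^ length is * (LINT x|M. pdiffs (rev is) \<psi> x * \<phi> x)"
proof (induction "is" arbitrary: \<psi>)
  case (Cons i "is")
  have "(LINT x|M. \<psi> x * pdiffs (i # is) \<phi> x) = (LINT x|lborel. \<psi> x * pdiff i (pdiffs is \<phi>) x)"
    using Cons.prems by (simp add: TF_mult_integral(1) test_functions_pdiff test_functions_pdiffs)
  also have "\<dots> = - (LINT x|lborel. pdiff i \<psi> x * pdiffs is \<phi> x)"
    using Cons.prems by (intro test_function_by_parts) (auto intro: test_functions_pdiffs)
  also have "\<dots> = - (LINT x|M. pdiff i \<psi> x * pdiffs is \<phi> x)"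
    using Cons.prems by (simp add: TF_mult_integral(1) test_functions_pdiff test_functions_pdiffs)
  also have "\<dots> = (-1) ^ length (i # is) * (LINT x|M. pdiffs (rev is) (pdiff i \<psi>) x * \<phi> x)"
    using Cons.IH[OF Cons.prems(1) test_functions_pdiff[OF Cons.prems(2)]] by simp
  also have "pdiffs (rev is) (pdiff i \<psi>) = pdiffs (rev (i # is)) \<psi>"
    using pdiffs_append[of "rev is" "[i]" \<psi>] by simp
  finally show ?case .
qed simp

lemma TF_has_weak_deriv: "\<phi> \<in> TF \<Longrightarrow> has_weak_deriv \<Omega> is \<phi> (pdiffs (rev is) \<phi>)"
  unfolding has_weak_deriv_def
  using TF_integral_pdiffs by (auto intro!: l2_locally_integrable TF_l2 test_functions_pdiffs)

lemma TF_weak_deriv: "\<phi> \<in> TF \<Longrightarrow> AE x in M. D is \<phi> x = pdiffs (rev is) \<phi> x"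
  by (rule weak_deriv_works(2)[OF TF_has_weak_deriv])

lemma TF_sobolev: "\<phi> \<in> TF \<Longrightarrow> \<phi> \<in> sobolev \<Omega> m"
  by (rule sobolevI) (auto intro!: TF_l2 TF_has_weak_deriv test_functions_pdiffs)

definition dn :: "2 list \<Rightarrow> sfun \<Rightarrow> real" where
  "dn is u = (LINT x|M. (D is u x)\<^sup>2)"

lemma dn_nonneg [simp]: "0 \<le> dn is u"
  by (simp add: dn_def)

lemma finite_lists [simp]: "finite {is :: 2 list. length is = k}"
  using finite_lists_length_eq[of "UNIV :: 2 set" k] by simp

lemma seminorm_sq: "(sobolev_seminorm \<Omega> k u)\<^sup>2 = (\<Sum>is | length is = k. dn is u)"
  unfolding sobolev_seminorm_def dn_def by (rule real_sqrt_pow2) (auto intro!: sum_nonneg)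

lemma norm_sq: "(sobolev_norm \<Omega> m u)\<^sup>2 = (\<Sum>k\<le>m. \<Sum>is | length is = k. dn is u)"
  unfolding sobolev_norm_def seminorm_sq by (rule real_sqrt_pow2) (auto intro!: sum_nonneg)

lemma sobolev_norm_nonneg [simp]: "0 \<le> sobolev_norm \<Omega> m u" "0 \<le> sobolev_seminorm \<Omega> m u"
  unfolding sobolev_norm_def sobolev_seminorm_def by (auto intro!: sum_nonneg)

lemma dn_le_norm: "length is \<le> m \<Longrightarrow> dn is u \<le> (sobolev_norm \<Omega> m u)\<^sup>2"
proof -
  assume len: "length is \<le> m"
  have "dn is u \<le> (\<Sum>js | length js = length is. dn js u)"
    by (intro member_le_sum[where f = "\<lambda>js. dn js u"]) auto
  also have "\<dots> \<le> (\<Sum>k\<le>m. \<Sum>js | length js = k. dn js u)"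
    using len by (intro member_le_sum[where f = "\<lambda>k. \<Sum>js | length js = k. dn js u"]) (auto intro!: sum_nonneg)
  finally show ?thesis by (simp add: norm_sq)
qed

text \<open>A crude bound by (p + q)^2 \<le> 2 p^2 + 2 q^2. It sums up over all derivatives and is
  enough for limit arguments, where a triangle inequality for the Sobolev norm is avoided.\<close>

lemma dn_lin_le:
  assumes "u \<in> sobolev \<Omega> m" "v \<in> sobolev \<Omega> m" "length is \<le> m"
  shows "dn is (\<lambda>x. a * u x + b * v x) \<le> 2 * a\<^sup>2 * dn is u + 2 * b\<^sup>2 * dn is v"
proof -
  note du = sobolevD(2)[OF assms(1,3)] and dv = sobolevD(2)[OF assms(2,3)]
  have "dn is (\<lambda>x. a * u x + b * v x) = (LINT x|M. (a * D is u x + b * D is v x)\<^sup>2)"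
    unfolding dn_def
  proof (rule integral_cong_AE)
    show "(\<lambda>x. (D is (\<lambda>x. a * u x + b * v x) x)\<^sup>2) \<in> borel_measurable M"
      using l2D(1)[OF sobolevD(2)[OF sobolev_lin[OF assms(1,2)] assms(3)]] by simp
    show "(\<lambda>x. (a * D is u x + b * D is v x)\<^sup>2) \<in> borel_measurable M" using du[THEN l2D(1)] dv[THEN l2D(1)] by simp
    show "AE x in M. (D is (\<lambda>x. a * u x + b * v x) x)\<^sup>2 = (a * D is u x + b * D is v x)\<^sup>2"
      using weak_deriv_lin[OF assms, of a b] by eventually_elim simp
  qed
  also have "\<dots> \<le> (LINT x|M. 2 * a\<^sup>2 * (D is u x)\<^sup>2 + 2 * b\<^sup>2 * (D is v x)\<^sup>2)"
  proof (rule integral_mono)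
    show "integrable M (\<lambda>x. (a * D is u x + b * D is v x)\<^sup>2)" using l2D(2)[OF l2_lin[OF du dv]] .
    show "integrable M (\<lambda>x. 2 * a\<^sup>2 * (D is u x)\<^sup>2 + 2 * b\<^sup>2 * (D is v x)\<^sup>2)" using du[THEN l2D(2)] dv[THEN l2D(2)] by simp
    fix x
    show "(a * D is u x + b * D is v x)\<^sup>2 \<le> 2 * a\<^sup>2 * (D is u x)\<^sup>2 + 2 * b\<^sup>2 * (D is v x)\<^sup>2"
      using zero_le_power2[of "a * D is u x - b * D is v x"]
      by (simp add: power2_eq_square algebra_simps)
  qed
  also have "\<dots> = 2 * a\<^sup>2 * dn is u + 2 * b\<^sup>2 * dn is v" unfolding dn_def using du[THEN l2D(2)] dv[THEN l2D(2)] by simp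
  finally show ?thesis .
qed

lemma norm_lin_le:
  assumes "u \<in> sobolev \<Omega> m" "v \<in> sobolev \<Omega> m"
  shows "(sobolev_norm \<Omega> m (\<lambda>x. a * u x + b * v x))\<^sup>2 \<le> 2 * a\<^sup>2 * (sobolev_norm \<Omega> m u)\<^sup>2 + 2 * b\<^sup>2 * (sobolev_norm \<Omega> m v)\<^sup>2"
proof -
  have "(sobolev_norm \<Omega> m (\<lambda>x. a * u x + b * v x))\<^sup>2 \<le> (\<Sum>k\<le>m. \<Sum>is | length is = k. 2 * a\<^sup>2 * dn is u + 2 * b\<^sup>2 * dn is v)"
    unfolding norm_sq by (intro sum_mono dn_lin_le[OF assms]) auto
  then show ?thesis by (simp add: norm_sq sum.distrib sum_distrib_left)
qed

lemma sobolev0D: "u \<in> sobolev0 \<Omega> m \<Longrightarrow> u \<in> sobolev \<Omega> m"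
  by (simp add: sobolev0_def)

lemma TF_sobolev0:
  assumes "\<phi> \<in> TF"
  shows "\<phi> \<in> sobolev0 \<Omega> m"
proof -
  have "dn is (\<lambda>x. \<phi> x - \<phi> x) = 0" for "is"
    using dn_lin_le[OF TF_sobolev[OF assms] TF_sobolev[OF assms], of "is" "length is" 0 0] by (simp add: order_antisym)
  then have "(sobolev_norm \<Omega> m (\<lambda>x. \<phi> x - \<phi> x))\<^sup>2 = 0" unfolding norm_sq by simp
  then show ?thesis using assms unfolding sobolev0_def by (auto intro!: TF_sobolev bexI[of _ \<phi>])
qed

lemma sobolev0_approx:
  assumes "u \<in> sobolev0 \<Omega> m"
  obtains \<phi> where "\<And>n::nat. \<phi> n \<in> TF" "(\<lambda>n. sobolev_norm \<Omega> m (\<lambda>x. u x - \<phi> n x)) \<longlonglongrightarrow> 0"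
proof -
  have "\<forall>n. \<exists>\<phi>\<in>TF. sobolev_norm \<Omega> m (\<lambda>x. u x - \<phi> x) < inverse (real (Suc n))"
    using assms by (auto simp: sobolev0_def)
  then obtain \<phi> where \<phi>: "\<And>n. \<phi> n \<in> TF" "\<And>n. sobolev_norm \<Omega> m (\<lambda>x. u x - \<phi> n x) < inverse (real (Suc n))"
    by metis
  have "(\<lambda>n. sobolev_norm \<Omega> m (\<lambda>x. u x - \<phi> n x)) \<longlonglongrightarrow> 0"
    by (rule Lim_null_comparison[OF _ LIMSEQ_inverse_real_of_nat]) (use \<phi>(2) in \<open>auto intro!: always_eventually less_imp_le\<close>)
  then show ?thesis using that \<phi>(1) by blast
qed

text \<open>Limits of sequences from the closure of the test functions stay in it. Linear
  combinations and completeness of V rest on this.\<close>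

lemma sobolev0I:
  assumes u: "u \<in> sobolev \<Omega> m" and X: "\<And>n::nat. X n \<in> sobolev0 \<Omega> m"
    and lim: "(\<lambda>n. sobolev_norm \<Omega> m (\<lambda>x. u x - X n x)) \<longlonglongrightarrow> 0"
  shows "u \<in> sobolev0 \<Omega> m"
  unfolding sobolev0_def
proof (safe intro!: u)
  fix e :: real assume e: "e > 0"
  then obtain n where n: "sobolev_norm \<Omega> m (\<lambda>x. u x - X n x) < e / 2"
    using LIMSEQ_D[OF lim, of "e / 2"] by auto
  obtain \<phi> where \<phi>: "\<phi> \<in> TF" "sobolev_norm \<Omega> m (\<lambda>x. X n x - \<phi> x) < e / 2"
    using X[of n] e unfolding sobolev0_def by (auto dest!: spec[of _ "e / 2"])
  have s1: "(\<lambda>x. u x - X n x) \<in> sobolev \<Omega> m" using sobolev_lin[OF u sobolev0D[OF X[of n]], of 1 "-1"] by simp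
  have s2: "(\<lambda>x. X n x - \<phi> x) \<in> sobolev \<Omega> m" using sobolev_lin[OF sobolev0D[OF X[of n]] TF_sobolev[OF \<phi>(1)], of 1 "-1"] by simp
  have "(sobolev_norm \<Omega> m (\<lambda>x. u x - \<phi> x))\<^sup>2 \<le> 2 * (sobolev_norm \<Omega> m (\<lambda>x. u x - X n x))\<^sup>2 + 2 * (sobolev_norm \<Omega> m (\<lambda>x. X n x - \<phi> x))\<^sup>2"
    using norm_lin_le[OF s1 s2, of 1 1] by simp
  also have "\<dots> < 2 * (e / 2)\<^sup>2 + 2 * (e / 2)\<^sup>2"
    using n \<phi>(2) by (intro add_strict_mono mult_strict_left_mono power_strict_mono) auto
  also have "\<dots> = e\<^sup>2" by (simp add: power2_eq_square)
  finally have "sobolev_norm \<Omega> m (\<lambda>x. u x - \<phi> x) < e" using e by (simp add: power2_less_imp_less)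
  then show "\<exists>\<phi>\<in>TF. sobolev_norm \<Omega> m (\<lambda>x. u x - \<phi> x) < e" using \<phi>(1) by blast
qed

lemma sobolev0_lin:
  assumes "u \<in> sobolev0 \<Omega> m" "v \<in> sobolev0 \<Omega> m"
  shows "(\<lambda>x. a * u x + b * v x) \<in> sobolev0 \<Omega> m"
proof -
  note s = assms[THEN sobolev0D]
  obtain \<phi> where \<phi>: "\<And>n::nat. \<phi> n \<in> TF" "(\<lambda>n. sobolev_norm \<Omega> m (\<lambda>x. u x - \<phi> n x)) \<longlonglongrightarrow> 0"
    using sobolev0_approx[OF assms(1)] by blast
  obtain \<psi> where \<psi>: "\<And>n::nat. \<psi> n \<in> TF" "(\<lambda>n. sobolev_norm \<Omega> m (\<lambda>x. v x - \<psi> n x)) \<longlonglongrightarrow> 0"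
    using sobolev0_approx[OF assms(2)] by blast
  show ?thesis
  proof (rule sobolev0I)
    show "(\<lambda>x. a * u x + b * v x) \<in> sobolev \<Omega> m" using s by (rule sobolev_lin)
    show "(\<lambda>x. a * \<phi> n x + b * \<psi> n x) \<in> sobolev0 \<Omega> m" for n
      using \<phi>(1) \<psi>(1) by (intro TF_sobolev0 test_functions_lin)
    have s1: "(\<lambda>x. u x - \<phi> n x) \<in> sobolev \<Omega> m" for n using sobolev_lin[OF s(1) TF_sobolev[OF \<phi>(1)], of 1 "-1"] by simp
    have s2: "(\<lambda>x. v x - \<psi> n x) \<in> sobolev \<Omega> m" for n using sobolev_lin[OF s(2) TF_sobolev[OF \<psi>(1)], of 1 "-1"] by simp
    have eq: "(\<lambda>x. (a * u x + b * v x) - (a * \<phi> n x + b * \<psi> n x)) = (\<lambda>x. a * (u x - \<phi> n x) + b * (v x - \<psi> n x))" for n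
      by (simp add: fun_eq_iff algebra_simps)
    have l: "(\<lambda>n. 2 * a\<^sup>2 * (sobolev_norm \<Omega> m (\<lambda>x. u x - \<phi> n x))\<^sup>2 + 2 * b\<^sup>2 * (sobolev_norm \<Omega> m (\<lambda>x. v x - \<psi> n x))\<^sup>2) \<longlonglongrightarrow> 2 * a\<^sup>2 * 0\<^sup>2 + 2 * b\<^sup>2 * 0\<^sup>2"
      by (intro tendsto_intros \<phi> \<psi>)
    have "(\<lambda>n. (sobolev_norm \<Omega> m (\<lambda>x. (a * u x + b * v x) - (a * \<phi> n x + b * \<psi> n x)))\<^sup>2) \<longlonglongrightarrow> 0"
      by (rule Lim_null_comparison[OF always_eventually l[simplified]]) (use norm_lin_le[OF s1 s2] in \<open>simp add: eq\<close>)
    from tendsto_real_sqrt[OF this]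
    show "(\<lambda>n. sobolev_norm \<Omega> m (\<lambda>x. (a * u x + b * v x) - (a * \<phi> n x + b * \<psi> n x))) \<longlonglongrightarrow> 0" by simp
  qed
qed

end

section \<open>Integral inequalities for test functions\<close>

definition pt :: "real \<Rightarrow> real \<Rightarrow> plane" where
  "pt a b = (\<chi> i. if i = 1 then a else b)"

lemma pt_nth [simp]: "pt a b $ 1 = a" "pt a b $ 2 = b"
  by (simp_all add: pt_def)

lemma continuous_on_pt: "continuous_on UNIV (\<lambda>p. pt (fst p) (snd p))"
proof -
  have "continuous_on UNIV (\<lambda>p::real \<times> real. if i = 1 then fst p else snd p)" for i :: 2
    by (cases "i = 1") (auto intro: continuous_intros)
  then show ?thesis unfolding pt_def by (rule continuous_on_vec_lambda)
qed

lemma pt_measurable: "(\<lambda>p. pt (fst p) (snd p)) \<in> borel_measurable borel"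
  using continuous_on_pt by (rule borel_measurable_continuous_onI)

text \<open>Both measures give an open box the product of its side lengths, which determines
  Lebesgue measure. This opens the way to Fubini in either order of the two coordinates.\<close>

lemma lborel_plane: "(lborel :: plane measure) = distr lborel borel (\<lambda>p. pt (fst p) (snd p))"
proof (rule lborel_eqI)
  let ?T = "\<lambda>p. pt (fst p) (snd p)"
  fix l u :: plane assume le: "\<And>b. b \<in> Basis \<Longrightarrow> l \<bullet> b \<le> u \<bullet> b"
  have le': "l $ i \<le> u $ i" for i using le[of "axis i 1"] by (simp add: inner_axis)
  have "?T -` box l u = {l $ 1<..<u $ 1} \<times> {l $ 2<..<u $ 2}"
    by (auto simp: mem_box_cart forall_2)
  then have "emeasure (distr lborel borel ?T) (box l u) = emeasure (lborel :: (real \<times> real) measure) ({l $ 1<..<u $ 1} \<times> {l $ 2<..<u $ 2})"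
    using pt_measurable by (subst emeasure_distr) auto
  also have "\<dots> = emeasure (lborel \<Otimes>\<^sub>M lborel) ({l $ 1<..<u $ 1} \<times> {l $ 2<..<u $ 2})" by (simp only: lborel_prod)
  also have "\<dots> = emeasure lborel {l $ 1<..<u $ 1} * emeasure lborel {l $ 2<..<u $ 2}"
    by (rule lborel.emeasure_pair_measure_Times) auto
  also have "\<dots> = ennreal ((u $ 1 - l $ 1) * (u $ 2 - l $ 2))" using le' by (simp add: ennreal_mult)
  also have "(u $ 1 - l $ 1) * (u $ 2 - l $ 2) = (\<Prod>b\<in>Basis. (u - l) \<bullet> b)"
  proof -
    have B: "(Basis :: plane set) = {axis 1 1, axis 2 1}" by (auto simp: Basis_vec_def UNIV_2)
    have "axis 1 (1::real) \<noteq> (axis 2 1 :: plane)" by (simp add: axis_eq_axis)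
    then show ?thesis unfolding B by (simp add: inner_axis)
  qed
  finally show "emeasure (distr lborel borel ?T) (box l u) = ennreal (\<Prod>b\<in>Basis. (u - l) \<bullet> b)" .
qed simp

lemma nn_integral_plane:
  fixes f :: "plane \<Rightarrow> ennreal"
  assumes [measurable]: "f \<in> borel_measurable borel"
  shows "(\<integral>\<^sup>+x. f x \<partial>lborel) = (\<integral>\<^sup>+b. \<integral>\<^sup>+a. f (pt a b) \<partial>lborel \<partial>lborel)"
    "(\<integral>\<^sup>+x. f x \<partial>lborel) = (\<integral>\<^sup>+a. \<integral>\<^sup>+b. f (pt a b) \<partial>lborel \<partial>lborel)"
proof -
  have m: "(\<lambda>p. f (pt (fst p) (snd p))) \<in> borel_measurable (lborel \<Otimes>\<^sub>M lborel)"
    unfolding lborel_prod using measurable_compose[OF pt_measurable assms] by simp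
  have "(\<integral>\<^sup>+x. f x \<partial>lborel) = (\<integral>\<^sup>+p. f (pt (fst p) (snd p)) \<partial>lborel)"
    by (subst lborel_plane, subst nn_integral_distr) (use pt_measurable in auto)
  also have "\<dots> = (\<integral>\<^sup>+p. f (pt (fst p) (snd p)) \<partial>(lborel \<Otimes>\<^sub>M lborel))" by (simp only: lborel_prod)
  finally have eq: "(\<integral>\<^sup>+x. f x \<partial>lborel) = (\<integral>\<^sup>+p. f (pt (fst p) (snd p)) \<partial>(lborel \<Otimes>\<^sub>M lborel))" .
  show "(\<integral>\<^sup>+x. f x \<partial>lborel) = (\<integral>\<^sup>+b. \<integral>\<^sup>+a. f (pt a b) \<partial>lborel \<partial>lborel)"
    unfolding eq using lborel_pair.nn_integral_snd[OF m] by simp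
  show "(\<integral>\<^sup>+x. f x \<partial>lborel) = (\<integral>\<^sup>+a. \<integral>\<^sup>+b. f (pt a b) \<partial>lborel \<partial>lborel)"
    unfolding eq using lborel.nn_integral_fst[OF m] by simp
qed

text \<open>The fundamental theorem of calculus on an interval that starts at a point
  \<open>l\<close> \<le> \<open>a\<close> left of -R, where \<open>g\<close> is zero.\<close>

lemma line_bound:
  fixes g g' :: "real \<Rightarrow> real"
  assumes d: "\<And>t. (g has_real_derivative g' t) (at t)" and c: "continuous_on UNIV g'"
    and bs: "\<And>t. t < - R \<Longrightarrow> g t = 0"
  shows "ennreal \<bar>g a\<bar> \<le> (\<integral>\<^sup>+t. ennreal \<bar>g' t\<bar> \<partial>lborel)"
proof -
  define l where "l = min a (- R - 1)"
  have cont: "isCont g' x" for x using c by (simp add: continuous_on_eq_continuous_at)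
  have hb: "has_bochner_integral lborel (\<lambda>x. g' x * indicator {l..a} x) (g a - g l)"
    by (rule has_bochner_integral_FTC_Icc_real) (use d cont in \<open>auto simp: l_def\<close>)
  have "g l = 0" using bs[of l] by (simp add: l_def)
  then have "ennreal \<bar>g a\<bar> = ennreal (norm (LINT x|lborel. g' x * indicator {l..a} x))"
    using has_bochner_integral_integral_eq[OF hb] by simp
  also have "\<dots> \<le> (\<integral>\<^sup>+x. norm (g' x * indicator {l..a} x) \<partial>lborel)"
    by (rule integral_norm_bound_ennreal[OF integrable.intros[OF hb]])
  also have "\<dots> \<le> (\<integral>\<^sup>+t. ennreal \<bar>g' t\<bar> \<partial>lborel)"
    by (intro nn_integral_mono ennreal_leI) (auto simp: indicator_def)
  finally show ?thesis .
qed

lemma pt_axis: "pt a b + t *\<^sub>R axis 1 1 = pt (a + t) b" "pt a b + t *\<^sub>R axis 2 1 = pt a (b + t)"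
  by (simp_all add: vec_eq_iff forall_2 axis_def)

lemma norm_pt_ge: "\<bar>a\<bar> \<le> norm (pt a b)" "\<bar>b\<bar> \<le> norm (pt a b)"
  using component_le_norm_cart[of "pt a b" 1] component_le_norm_cart[of "pt a b" 2] by simp_all

text \<open>Ladyzhenskaya's inequality, from \<open>\<phi>\<^sup>2 \<le> 2 \<integral> \<bar>\<phi> \<partial>\<^sub>i\<phi>\<bar>\<close> along both coordinate lines.\<close>

lemma ladyzhenskaya_nn:
  assumes \<phi>: "\<phi> \<in> test_functions \<Omega>"
  shows "(\<integral>\<^sup>+x. ennreal ((\<phi> x) ^ 4) \<partial>lborel) \<le>
    (\<integral>\<^sup>+x. ennreal (2 * \<bar>\<phi> x * pdiff 1 \<phi> x\<bar>) \<partial>lborel) * (\<integral>\<^sup>+x. ennreal (2 * \<bar>\<phi> x * pdiff 2 \<phi> x\<bar>) \<partial>lborel)"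
proof -
  note cont = test_function_continuous[OF \<phi>, of UNIV] test_function_continuous[OF test_functions_pdiff[OF \<phi>], of UNIV]
  have m1 [measurable]: "\<phi> \<in> borel_measurable borel" using cont(1) by (rule borel_measurable_continuous_onI)
  have m2 [measurable]: "pdiff i \<phi> \<in> borel_measurable borel" for i using cont(2) by (rule borel_measurable_continuous_onI)
  obtain R where R: "\<And>x. norm x > R \<Longrightarrow> \<phi> x = 0" using test_function_bounded_support[OF \<phi>] by (auto simp: bounded_support_def)
  \<comment> \<open>\<open>A\<close> depends only on the second coordinate and \<open>B\<close> only
    on the first, and each bounds \<phi>^2 along its own lines. Hence \<phi>^4 is at most
    \<open>A b * B a\<close>, whose double integral factorises.\<close>
  define A where "A b = (\<integral>\<^sup>+t. ennreal (2 * \<bar>\<phi> (pt t b) * pdiff 1 \<phi> (pt t b)\<bar>) \<partial>lborel)" for b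
  define B where "B a = (\<integral>\<^sup>+t. ennreal (2 * \<bar>\<phi> (pt a t) * pdiff 2 \<phi> (pt a t)\<bar>) \<partial>lborel)" for a
  have sq: "((\<lambda>t. (\<phi> (x + t *\<^sub>R axis i 1))\<^sup>2) has_real_derivative 2 * (\<phi> (x + t *\<^sub>R axis i 1) * pdiff i \<phi> (x + t *\<^sub>R axis i 1))) (at t)" for x t i
    by (auto intro!: derivative_eq_intros pdiff_line test_function_differentiable[OF \<phi>])
  have cl: "continuous_on UNIV (\<lambda>t. 2 * (\<phi> (x + t *\<^sub>R axis i 1) * pdiff i \<phi> (x + t *\<^sub>R axis i 1)))" for x i
    by (intro continuous_intros continuous_on_compose2[OF cont(1)] continuous_on_compose2[OF cont(2)]) auto
  have abs2: "\<bar>2 * (p * q)\<bar> = 2 * \<bar>p * q\<bar>" for p q :: real by (simp add: abs_mult)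
  have lA: "ennreal ((\<phi> (pt a b))\<^sup>2) \<le> A b" for a b
  proof -
    have "\<phi> (pt 0 b + t *\<^sub>R axis 1 1) = 0" if "t < - \<bar>R\<bar>" for t
      using R[of "pt t b"] norm_pt_ge(1)[of t b] that by (simp add: pt_axis)
    then show ?thesis
      using line_bound[OF sq[of "pt 0 b" 1] cl, of "\<bar>R\<bar>" a] by (simp add: pt_axis A_def abs2)
  qed
  have lB: "ennreal ((\<phi> (pt a b))\<^sup>2) \<le> B a" for a b
  proof -
    have "\<phi> (pt a 0 + t *\<^sub>R axis 2 1) = 0" if "t < - \<bar>R\<bar>" for t
      using R[of "pt a t"] norm_pt_ge(2)[of t a] that by (simp add: pt_axis)
    then show ?thesis
      using line_bound[OF sq[of "pt a 0" 2] cl, of "\<bar>R\<bar>" b] by (simp add: pt_axis B_def abs2)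
  qed
  have ptm [measurable]: "(\<lambda>a. pt a b) \<in> borel_measurable borel" "(\<lambda>b. pt a b) \<in> borel_measurable borel" for a b
    using measurable_compose[OF _ pt_measurable, of "\<lambda>a. (a, b)"] measurable_compose[OF _ pt_measurable, of "\<lambda>b. (a, b)"] by auto
  have "(\<integral>\<^sup>+x. ennreal ((\<phi> x) ^ 4) \<partial>lborel) = (\<integral>\<^sup>+b. \<integral>\<^sup>+a. ennreal ((\<phi> (pt a b)) ^ 4) \<partial>lborel \<partial>lborel)"
    by (rule nn_integral_plane(1)) measurable
  also have "\<dots> \<le> (\<integral>\<^sup>+b. \<integral>\<^sup>+a. A b * B a \<partial>lborel \<partial>lborel)"
  proof (intro nn_integral_mono)
    fix a b
    have "(\<phi> (pt a b)) ^ 4 = (\<phi> (pt a b))\<^sup>2 * (\<phi> (pt a b))\<^sup>2" by (simp flip: power_add)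
    then have "ennreal ((\<phi> (pt a b)) ^ 4) = ennreal ((\<phi> (pt a b))\<^sup>2) * ennreal ((\<phi> (pt a b))\<^sup>2)"
      by (simp only: ennreal_mult[symmetric] zero_le_power2)
    also have "\<dots> \<le> A b * B a" by (intro mult_mono lA lB) auto
    finally show "ennreal ((\<phi> (pt a b)) ^ 4) \<le> A b * B a" .
  qed
  also have "\<dots> = (\<integral>\<^sup>+b. A b \<partial>lborel) * (\<integral>\<^sup>+a. B a \<partial>lborel)"
  proof -
    have prodm: "(\<lambda>(a, t). f (pt a t)) \<in> borel_measurable (borel \<Otimes>\<^sub>M borel)" if "f \<in> borel_measurable borel" for f :: "plane \<Rightarrow> ennreal"
      using measurable_compose[OF pt_measurable that] by (simp add: borel_prod case_prod_unfold)
    have prodm': "(\<lambda>(b, t). f (pt t b)) \<in> borel_measurable (borel \<Otimes>\<^sub>M borel)" if "f \<in> borel_measurable borel" for f :: "plane \<Rightarrow> ennreal"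
      using measurable_compose[OF measurable_pair_swap' prodm[OF that]] by (simp add: case_prod_unfold)
    have Bm: "B \<in> borel_measurable lborel"
      unfolding B_def using prodm[of "\<lambda>x. ennreal (2 * \<bar>\<phi> x * pdiff 2 \<phi> x\<bar>)"]
      by (intro lborel.borel_measurable_nn_integral) (auto simp: case_prod_unfold cong: measurable_cong_sets)
    have Am: "A \<in> borel_measurable lborel"
      unfolding A_def using prodm'[of "\<lambda>x. ennreal (2 * \<bar>\<phi> x * pdiff 1 \<phi> x\<bar>)"]
      by (intro lborel.borel_measurable_nn_integral) (auto simp: case_prod_unfold cong: measurable_cong_sets)
    show ?thesis using Am Bm by (simp add: nn_integral_cmult nn_integral_multc)
  qed
  also have "(\<integral>\<^sup>+b. A b \<partial>lborel) = (\<integral>\<^sup>+x. ennreal (2 * \<bar>\<phi> x * pdiff 1 \<phi> x\<bar>) \<partial>lborel)"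
    unfolding A_def by (rule nn_integral_plane(1)[symmetric]) measurable
  also have "(\<integral>\<^sup>+a. B a \<partial>lborel) = (\<integral>\<^sup>+x. ennreal (2 * \<bar>\<phi> x * pdiff 2 \<phi> x\<bar>) \<partial>lborel)"
    unfolding B_def by (rule nn_integral_plane(2)[symmetric]) measurable
  finally show ?thesis .
qed

context open_domain
begin

text \<open>Ladyzhenskaya's inequality, with the Cauchy-Schwarz inequality applied to each of its
  two factors.\<close>

lemma TF_power4:
  assumes \<phi>: "\<phi> \<in> TF"
  shows "integrable M (\<lambda>x. (\<phi> x) ^ 4)"
    "(LINT x|M. (\<phi> x) ^ 4) \<le> 4 * (LINT x|M. (\<phi> x)\<^sup>2) * sqrt (LINT x|M. (pdiff 1 \<phi> x)\<^sup>2) * sqrt (LINT x|M. (pdiff 2 \<phi> x)\<^sup>2)"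
proof -
  note \<phi>' = test_functions_pdiff[OF \<phi>]
  note cont = test_function_continuous[OF \<phi>, of UNIV] test_function_continuous[OF \<phi>', of UNIV]
  have c4: "continuous_on UNIV (\<lambda>x. (\<phi> x) ^ 4)" by (intro continuous_intros cont)
  have z: "\<phi> x = 0" if "x \<notin> \<Omega>" for x using test_function_zero_outside[OF \<phi> that] .
  have b: "(\<integral>\<^sup>+x. ennreal (2 * \<bar>\<phi> x * pdiff i \<phi> x\<bar>) \<partial>lborel) \<le> ennreal (2 * (sqrt (LINT x|M. (\<phi> x)\<^sup>2) * sqrt (LINT x|M. (pdiff i \<phi> x)\<^sup>2)))" for i
  proof -
    have "(\<integral>\<^sup>+x. ennreal (2 * \<bar>\<phi> x * pdiff i \<phi> x\<bar>) \<partial>lborel) = (\<integral>\<^sup>+x. ennreal (2 * \<bar>\<phi> x * pdiff i \<phi> x\<bar>) \<partial>M)"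
      by (rule integral_supported(3)[symmetric]) (auto simp: z intro!: continuous_intros cont)
    also have "\<dots> = ennreal (LINT x|M. 2 * \<bar>\<phi> x * pdiff i \<phi> x\<bar>)"
      using TF_mult_integral(2)[OF \<phi> \<phi>'] by (intro nn_integral_eq_integral) auto
    also have "(LINT x|M. 2 * \<bar>\<phi> x * pdiff i \<phi> x\<bar>) \<le> 2 * (sqrt (LINT x|M. (\<phi> x)\<^sup>2) * sqrt (LINT x|M. (pdiff i \<phi> x)\<^sup>2))"
    proof -
      have l: "(\<lambda>x. \<bar>\<phi> x\<bar>) \<in> l2 M" "(\<lambda>x. \<bar>pdiff i \<phi> x\<bar>) \<in> l2 M"
        using TF_l2[OF \<phi>] TF_l2[OF \<phi>'] borel_measurable_abs[OF TF_measurable[OF \<phi>]] borel_measurable_abs[OF TF_measurable[OF \<phi>']]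
        by (auto simp: l2_def)
      from l2.cauchy_schwarz[OF l] show ?thesis
        by (simp add: l2.nrm_def abs_mult power2_eq_square flip: abs_mult)
    qed
    finally show ?thesis by (simp add: ennreal_leI)
  qed
  have "(\<integral>\<^sup>+x. ennreal ((\<phi> x) ^ 4) \<partial>M) = (\<integral>\<^sup>+x. ennreal ((\<phi> x) ^ 4) \<partial>lborel)"
    by (rule integral_supported(3)[OF c4]) (simp add: z)
  also have "\<dots> \<le> ennreal (2 * (sqrt (LINT x|M. (\<phi> x)\<^sup>2) * sqrt (LINT x|M. (pdiff 1 \<phi> x)\<^sup>2))) * ennreal (2 * (sqrt (LINT x|M. (\<phi> x)\<^sup>2) * sqrt (LINT x|M. (pdiff 2 \<phi> x)\<^sup>2)))"
    by (rule order_trans[OF ladyzhenskaya_nn[OF \<phi>]]) (intro mult_mono b, auto)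
  also have "\<dots> = ennreal (4 * (LINT x|M. (\<phi> x)\<^sup>2) * sqrt (LINT x|M. (pdiff 1 \<phi> x)\<^sup>2) * sqrt (LINT x|M. (pdiff 2 \<phi> x)\<^sup>2))"
  proof -
    have "sqrt (LINT x|M. (\<phi> x)\<^sup>2) * sqrt (LINT x|M. (\<phi> x)\<^sup>2) = (LINT x|M. (\<phi> x)\<^sup>2)" by simp
    then show ?thesis by (simp flip: ennreal_mult add: mult_ac)
  qed
  finally have le: "(\<integral>\<^sup>+x. ennreal ((\<phi> x) ^ 4) \<partial>M) \<le> ennreal (4 * (LINT x|M. (\<phi> x)\<^sup>2) * sqrt (LINT x|M. (pdiff 1 \<phi> x)\<^sup>2) * sqrt (LINT x|M. (pdiff 2 \<phi> x)\<^sup>2))" .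
  show int: "integrable M (\<lambda>x. (\<phi> x) ^ 4)"
    using le TF_measurable[OF \<phi>] by (intro integrableI_nonneg) (auto intro: le_less_trans)
  show "(LINT x|M. (\<phi> x) ^ 4) \<le> 4 * (LINT x|M. (\<phi> x)\<^sup>2) * sqrt (LINT x|M. (pdiff 1 \<phi> x)\<^sup>2) * sqrt (LINT x|M. (pdiff 2 \<phi> x)\<^sup>2)"
    using le by (subst (asm) nn_integral_eq_integral[OF int]) (auto simp: ennreal_le_iff)
qed

end

section \<open>The energy space\<close>

context semi_hilbert
begin

lemma nrm_tendsto:
  assumes "\<And>n. X n \<in> V" "x \<in> V" "(\<lambda>n::nat. nrm (X n - x)) \<longlonglongrightarrow> 0"
  shows "(\<lambda>n. nrm (X n)) \<longlonglongrightarrow> nrm x"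
proof (rule LIM_zero_cancel, rule Lim_null_comparison[OF _ assms(3)])
  have "nrm (X n) \<le> nrm (X n - x) + nrm x" "nrm x \<le> nrm (X n - x) + nrm (X n)" for n
    using nrm_triangle[of "X n - x" x] nrm_triangle[of "x - X n" "X n"] nrm_minus_commute[of x "X n"] assms(1)[of n] assms(2) by auto
  then show "\<forall>\<^sub>F n in sequentially. norm (nrm (X n) - nrm x) \<le> nrm (X n - x)" by (auto simp: abs_le_iff algebra_simps)
qed

lemma ip_tendsto2:
  assumes X: "\<And>n. X n \<in> V" "x \<in> V" "(\<lambda>n::nat. nrm (X n - x)) \<longlonglongrightarrow> 0"
    and Y: "\<And>n. Y n \<in> V" "y \<in> V" "(\<lambda>n::nat. nrm (Y n - y)) \<longlonglongrightarrow> 0"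
  shows "(\<lambda>n. ip (X n) (Y n)) \<longlonglongrightarrow> ip x y"
proof (rule LIM_zero_cancel, rule Lim_null_comparison)
  show "\<forall>\<^sub>F n in sequentially. norm (ip (X n) (Y n) - ip x y) \<le> nrm (X n - x) * nrm (Y n) + nrm x * nrm (Y n - y)"
  proof (rule always_eventually, rule allI)
    fix n
    have "ip (X n) (Y n) - ip x y = ip (X n - x) (Y n) + ip x (Y n - y)"
      using X Y by (simp add: ip_simps)
    then show "norm (ip (X n) (Y n) - ip x y) \<le> nrm (X n - x) * nrm (Y n) + nrm x * nrm (Y n - y)"
      using cauchy_schwarz[of "X n - x" "Y n"] cauchy_schwarz[of x "Y n - y"] X(1)[of n] X(2) Y(1)[of n] Y(2) by simp
  qed
  have "(\<lambda>n. nrm (X n - x) * nrm (Y n) + nrm x * nrm (Y n - y)) \<longlonglongrightarrow> 0 * nrm y + nrm x * 0"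
    by (intro tendsto_intros X Y nrm_tendsto)
  then show "(\<lambda>n. nrm (X n - x) * nrm (Y n) + nrm x * nrm (Y n - y)) \<longlonglongrightarrow> 0" by simp
qed

end

lemma lists_of_2:
  "{is :: 2 list. length is = 0} = {[]}"
  "{is :: 2 list. length is = 1} = {[1], [2]}"
  "{is :: 2 list. length is = 2} = {[1, 1], [1, 2], [2, 1], [2, 2]}"
proof -
  show "{is :: 2 list. length is = 0} = {[]}" by auto
  show "{is :: 2 list. length is = 1} = {[1], [2]}"
    using exhaust_2 by (auto simp: length_Suc_conv)
  show "{is :: 2 list. length is = 2} = {[1, 1], [1, 2], [2, 1], [2, 2]}"
    using exhaust_2 by (auto simp: length_Suc_conv numeral_2_eq_2)
qed

context open_domain
begin

lemma energy_sq: "(energy_norm \<Omega> u)\<^sup>2 = dn [1, 1] u + dn [1, 2] u + dn [2, 1] u + dn [2, 2] u"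
  unfolding seminorm_sq lists_of_2 by simp

lemma norm2_sq: "(sobolev_norm \<Omega> 2 u)\<^sup>2 = dn [] u + dn [1] u + dn [2] u + (energy_norm \<Omega> u)\<^sup>2"
proof -
  have "{..2::nat} = {0, 1, 2}" by auto
  then show ?thesis unfolding norm_sq energy_sq using lists_of_2 by simp
qed

lemma dn_le_energy: "length is = 2 \<Longrightarrow> dn is u \<le> (energy_norm \<Omega> u)\<^sup>2"
  unfolding seminorm_sq by (rule member_le_sum[where f = "\<lambda>js. dn js u"]) auto

lemma dn_diff:
  assumes "u \<in> sobolev \<Omega> m" "v \<in> sobolev \<Omega> m" "length is \<le> m"
  shows "l2.nrm M (D is v - D is u) = sqrt (dn is (\<lambda>x. u x - v x))"
proof -
  have s: "(\<lambda>x. u x - v x) \<in> sobolev \<Omega> m" using sobolev_lin[OF assms(1,2), of 1 "-1"] by simp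
  have "(LINT x|M. (D is v - D is u) x * (D is v - D is u) x) = dn is (\<lambda>x. u x - v x)"
    unfolding dn_def
  proof (rule integral_cong_AE)
    show "(\<lambda>x. (D is v - D is u) x * (D is v - D is u) x) \<in> borel_measurable M"
      using sobolevD(2)[OF assms(1,3), THEN l2D(1)] sobolevD(2)[OF assms(2,3), THEN l2D(1)] by simp
    show "(\<lambda>x. (D is (\<lambda>x. u x - v x) x)\<^sup>2) \<in> borel_measurable M"
      using sobolevD(2)[OF s assms(3), THEN l2D(1)] by simp
    show "AE x in M. (D is v - D is u) x * (D is v - D is u) x = (D is (\<lambda>x. u x - v x) x)\<^sup>2"
      using weak_deriv_lin[OF assms, of 1 "-1"]
      by eventually_elim (simp add: power2_eq_square left_diff_distrib right_diff_distrib)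
  qed
  then show ?thesis by (simp add: l2.nrm_def)
qed

lemma D_conv:
  assumes u: "u \<in> sobolev \<Omega> m" and X: "\<And>n::nat. X n \<in> sobolev \<Omega> m"
    and lim: "(\<lambda>n. sobolev_norm \<Omega> m (\<lambda>x. u x - X n x)) \<longlonglongrightarrow> 0" and len: "length is \<le> m"
  shows "(\<lambda>n. l2.nrm M (D is (X n) - D is u)) \<longlonglongrightarrow> 0"
proof (rule Lim_null_comparison[OF _ lim])
  have "sqrt (dn is (\<lambda>x. u x - X n x)) \<le> sobolev_norm \<Omega> m (\<lambda>x. u x - X n x)" for n
    using dn_le_norm[OF len] by (intro real_le_lsqrt) auto
  then show "\<forall>\<^sub>F n in sequentially. norm (l2.nrm M (D is (X n) - D is u)) \<le> sobolev_norm \<Omega> m (\<lambda>x. u x - X n x)"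
    unfolding dn_diff[OF u X len] by simp
qed

lemma D_ip_conv:
  assumes "u \<in> sobolev \<Omega> m" "\<And>n::nat. X n \<in> sobolev \<Omega> m" "(\<lambda>n. sobolev_norm \<Omega> m (\<lambda>x. u x - X n x)) \<longlonglongrightarrow> 0"
    "length is \<le> m" "length js \<le> m"
  shows "(\<lambda>n. LINT x|M. D is (X n) x * D js (X n) x) \<longlonglongrightarrow> (LINT x|M. D is u x * D js u x)"
  by (rule l2.ip_tendsto2) (use assms in \<open>auto intro: sobolevD(2) D_conv\<close>)

lemma dn_conv:
  assumes "u \<in> sobolev \<Omega> m" "\<And>n::nat. X n \<in> sobolev \<Omega> m" "(\<lambda>n. sobolev_norm \<Omega> m (\<lambda>x. u x - X n x)) \<longlonglongrightarrow> 0"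
    "length is \<le> m"
  shows "(\<lambda>n. dn is (X n)) \<longlonglongrightarrow> dn is u"
  unfolding dn_def power2_eq_square by (rule D_ip_conv[OF assms assms(4)])

lemma TF_ip:
  assumes "\<phi> \<in> TF" "\<psi> \<in> TF"
  shows "(LINT x|M. D is \<phi> x * D js \<psi> x) = (LINT x|lborel. pdiffs (rev is) \<phi> x * pdiffs (rev js) \<psi> x)"
proof -
  have "(LINT x|M. D is \<phi> x * D js \<psi> x) = (LINT x|M. pdiffs (rev is) \<phi> x * pdiffs (rev js) \<psi> x)"
  proof (rule integral_cong_AE)
    show "(\<lambda>x. D is \<phi> x * D js \<psi> x) \<in> borel_measurable M"
      using sobolevD(2)[OF TF_sobolev[OF assms(1)] order_refl, THEN l2D(1)] sobolevD(2)[OF TF_sobolev[OF assms(2)] order_refl, THEN l2D(1)] by simp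
    show "(\<lambda>x. pdiffs (rev is) \<phi> x * pdiffs (rev js) \<psi> x) \<in> borel_measurable M"
      using assms by (intro borel_measurable_times TF_measurable test_functions_pdiffs)
    show "AE x in M. D is \<phi> x * D js \<psi> x = pdiffs (rev is) \<phi> x * pdiffs (rev js) \<psi> x"
      using TF_weak_deriv[OF assms(1), of "is"] TF_weak_deriv[OF assms(2), of js] by eventually_elim simp
  qed
  then show ?thesis using assms by (simp add: TF_mult_integral(1) test_functions_pdiffs)
qed

text \<open>Two integrations by parts, through third derivatives that test functions have. This is
  why the Laplacian controls the whole Hessian.\<close>

lemma TF_mixed_identity:
  assumes \<phi>: "\<phi> \<in> TF"
  shows "(LINT x|M. D [1, 1] \<phi> x * D [2, 2] \<phi> x) = (LINT x|M. D [1, 2] \<phi> x * D [1, 2] \<phi> x)"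
    "(LINT x|M. D [1, 1] \<phi> x * D [2, 2] \<phi> x) = (LINT x|M. D [2, 1] \<phi> x * D [2, 1] \<phi> x)"
proof -
  note T1 = test_functions_pdiff[OF \<phi>, of 1] and T2 = test_functions_pdiff[OF \<phi>, of 2]
  have c: "pdiff 1 (pdiff 2 \<phi>) = pdiff 2 (pdiff 1 \<phi>)" by (rule test_function_pdiff_commute[OF \<phi>])
  have c2: "pdiff 1 (pdiff 2 (pdiff 2 \<phi>)) = pdiff 2 (pdiff 1 (pdiff 2 \<phi>))" by (rule test_function_pdiff_commute[OF T2])
  have "(LINT x|lborel. pdiff 1 (pdiff 1 \<phi>) x * pdiff 2 (pdiff 2 \<phi>) x) = - (LINT x|lborel. pdiff 1 \<phi> x * pdiff 1 (pdiff 2 (pdiff 2 \<phi>)) x)"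
    using test_function_by_parts[OF T1 test_functions_pdiff[OF T2, of 2], of 1] by simp
  also have "\<dots> = (LINT x|lborel. pdiff 2 (pdiff 1 \<phi>) x * pdiff 1 (pdiff 2 \<phi>) x)"
    unfolding c2 using test_function_by_parts[OF T1 test_functions_pdiff[OF T2, of 1], of 2] by simp
  finally have "(LINT x|lborel. pdiff 1 (pdiff 1 \<phi>) x * pdiff 2 (pdiff 2 \<phi>) x) = (LINT x|lborel. pdiff 2 (pdiff 1 \<phi>) x * pdiff 2 (pdiff 1 \<phi>) x)"
    unfolding c .
  then show "(LINT x|M. D [1, 1] \<phi> x * D [2, 2] \<phi> x) = (LINT x|M. D [1, 2] \<phi> x * D [1, 2] \<phi> x)"
    "(LINT x|M. D [1, 1] \<phi> x * D [2, 2] \<phi> x) = (LINT x|M. D [2, 1] \<phi> x * D [2, 1] \<phi> x)"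
    by (simp_all add: TF_ip[OF \<phi> \<phi>] c)
qed

lemma mixed_identity:
  assumes "u \<in> V \<Omega>"
  shows "(LINT x|M. D [1, 1] u x * D [2, 2] u x) = dn [1, 2] u" "(LINT x|M. D [1, 1] u x * D [2, 2] u x) = dn [2, 1] u"
proof -
  obtain \<phi> where \<phi>: "\<And>n::nat. \<phi> n \<in> TF" "(\<lambda>n. sobolev_norm \<Omega> 2 (\<lambda>x. u x - \<phi> n x)) \<longlonglongrightarrow> 0"
    using sobolev0_approx[OF assms] by blast
  note conv = D_ip_conv[OF sobolev0D[OF assms] TF_sobolev[OF \<phi>(1)] \<phi>(2)]
  have "(\<lambda>n. LINT x|M. D [1, 1] (\<phi> n) x * D [2, 2] (\<phi> n) x) \<longlonglongrightarrow> (LINT x|M. D [1, 1] u x * D [2, 2] u x)"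
    by (rule conv) auto
  moreover have "(\<lambda>n. LINT x|M. D [1, 2] (\<phi> n) x * D [1, 2] (\<phi> n) x) \<longlonglongrightarrow> (LINT x|M. D [1, 2] u x * D [1, 2] u x)"
    by (rule conv) auto
  moreover have "(\<lambda>n. LINT x|M. D [2, 1] (\<phi> n) x * D [2, 1] (\<phi> n) x) \<longlonglongrightarrow> (LINT x|M. D [2, 1] u x * D [2, 1] u x)"
    by (rule conv) auto
  ultimately show "(LINT x|M. D [1, 1] u x * D [2, 2] u x) = dn [1, 2] u" "(LINT x|M. D [1, 1] u x * D [2, 2] u x) = dn [2, 1] u"
    unfolding dn_def power2_eq_square using TF_mixed_identity[OF \<phi>(1)] LIMSEQ_unique by auto
qed

lemma laplace_eq: "laplace \<Omega> u = (\<lambda>x. 1 * D [1, 1] u x + 1 * D [2, 2] u x)"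
  by (simp add: laplace_def fun_eq_iff)

lemma laplace_l2: "u \<in> sobolev \<Omega> 2 \<Longrightarrow> laplace \<Omega> u \<in> l2 M"
  unfolding laplace_eq by (intro l2_lin sobolevD(2)) auto

lemma laplace_lin:
  assumes "u \<in> sobolev \<Omega> 2" "v \<in> sobolev \<Omega> 2"
  shows "AE x in M. laplace \<Omega> (\<lambda>x. a * u x + b * v x) x = a * laplace \<Omega> u x + b * laplace \<Omega> v x"
proof -
  have "AE x in M. D [1, 1] (\<lambda>x. a * u x + b * v x) x = a * D [1, 1] u x + b * D [1, 1] v x"
    "AE x in M. D [2, 2] (\<lambda>x. a * u x + b * v x) x = a * D [2, 2] u x + b * D [2, 2] v x"
    by (auto intro!: weak_deriv_lin[OF assms])
  then show ?thesis by eventually_elim (simp add: laplace_def algebra_simps)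
qed

text \<open>The cross term of the squared Laplacian splits into the two mixed terms of the Hessian
  norm. Hence the seminorm induced by \<open>form_a\<close> on V is exactly
  \<open>energy_norm\<close>.\<close>

lemma form_a_energy:
  assumes "u \<in> V \<Omega>"
  shows "form_a \<Omega> u u = (energy_norm \<Omega> u)\<^sup>2"
proof -
  have l: "D [1, 1] u \<in> l2 M" "D [2, 2] u \<in> l2 M"
    by (rule sobolevD(2)[OF sobolev0D[OF assms]]; simp)+
  have "form_a \<Omega> u u = (LINT x|M. (D [1, 1] u x)\<^sup>2 + 2 * (D [1, 1] u x * D [2, 2] u x) + (D [2, 2] u x)\<^sup>2)"
    unfolding form_a_def laplace_def by (rule Bochner_Integration.integral_cong) (auto simp: power2_eq_square algebra_simps)
  also have "\<dots> = dn [1, 1] u + 2 * (LINT x|M. D [1, 1] u x * D [2, 2] u x) + dn [2, 2] u"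
    unfolding dn_def using l[THEN l2D(2)] l2_mult[OF l] by simp
  finally show ?thesis using mixed_identity[OF assms] by (simp add: energy_sq)
qed

lemma laplace_nrm: "u \<in> V \<Omega> \<Longrightarrow> l2.nrm M (laplace \<Omega> u) = energy_norm \<Omega> u"
  using form_a_energy[of u] by (simp add: l2.nrm_def form_a_def)

lemma form_a_lin:
  assumes "u \<in> sobolev \<Omega> 2" "v \<in> sobolev \<Omega> 2" "w \<in> sobolev \<Omega> 2"
  shows "form_a \<Omega> (\<lambda>x. a * u x + b * v x) w = a * form_a \<Omega> u w + b * form_a \<Omega> v w"
proof -
  note l = assms[THEN laplace_l2] laplace_l2[OF sobolev_lin[OF assms(1,2)]]
  have "form_a \<Omega> (\<lambda>x. a * u x + b * v x) w = (LINT x|M. a * (laplace \<Omega> u x * laplace \<Omega> w x) + b * (laplace \<Omega> v x * laplace \<Omega> w x))"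
    unfolding form_a_def
  proof (rule integral_cong_AE)
    show "(\<lambda>x. laplace \<Omega> (\<lambda>x. a * u x + b * v x) x * laplace \<Omega> w x) \<in> borel_measurable M"
      using l(3,4)[THEN l2D(1)] by simp
    show "(\<lambda>x. a * (laplace \<Omega> u x * laplace \<Omega> w x) + b * (laplace \<Omega> v x * laplace \<Omega> w x)) \<in> borel_measurable M"
      using l(1-3)[THEN l2D(1)] by simp
    show "AE x in M. laplace \<Omega> (\<lambda>x. a * u x + b * v x) x * laplace \<Omega> w x = a * (laplace \<Omega> u x * laplace \<Omega> w x) + b * (laplace \<Omega> v x * laplace \<Omega> w x)"
      using laplace_lin[OF assms(1,2), of a b] by eventually_elim (simp add: algebra_simps)
  qed
  also have "\<dots> = a * form_a \<Omega> u w + b * form_a \<Omega> v w"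
    unfolding form_a_def using l2_mult[OF l(1,3)] l2_mult[OF l(2,3)] by simp
  finally show ?thesis .
qed

end

section \<open>Poincare's inequality and fourth powers on bounded domains\<close>

locale bounded_domain = open_domain +
  assumes bounded_\<Omega>: "bounded \<Omega>"
begin

definition radius :: real where "radius = (SOME R. R > 0 \<and> (\<forall>x\<in>\<Omega>. norm x \<le> R))"

lemma radius: "radius > 0" "x \<in> \<Omega> \<Longrightarrow> norm x \<le> radius"
proof -
  have "\<exists>R. R > 0 \<and> (\<forall>x\<in>\<Omega>. norm x \<le> R)" using bounded_\<Omega> bounded_pos by blast
  then have "radius > 0 \<and> (\<forall>x\<in>\<Omega>. norm x \<le> radius)" unfolding radius_def by (rule someI_ex)
  then show "radius > 0" "x \<in> \<Omega> \<Longrightarrow> norm x \<le> radius" by auto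
qed

text \<open>The Poincare constant: |x_i| \<le> \<open>radius\<close> and Young's inequality bound
  the squared norm of \<phi> by half of itself plus 2 radius^2 times that of its i-th
  derivative.\<close>

definition P :: real where "P = 4 * radius\<^sup>2"

lemma P_pos: "P > 0"
  using radius(1) by (simp add: P_def)

text \<open>Poincare's inequality: integrate \<open>\<partial>\<^sub>i (x\<^sub>i \<phi>\<^sup>2) = \<phi>\<^sup>2 + 2 x\<^sub>i \<phi> \<partial>\<^sub>i\<phi>\<close>.\<close>

lemma poincare_TF:
  assumes \<phi>: "\<phi> \<in> TF"
  shows "(LINT x|lborel. (\<phi> x)\<^sup>2) \<le> P * (LINT x|lborel. (pdiff i \<phi> x)\<^sup>2)"
proof -
  note \<phi>' = test_functions_pdiff[OF \<phi>, of i]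
  note cont = test_function_continuous[OF \<phi>, of UNIV] test_function_continuous[OF \<phi>', of UNIV]
  have nthd: "((\<lambda>x::plane. x $ i) has_derivative (\<lambda>h. h $ i)) (at x)" for x
    by (rule bounded_linear_imp_has_derivative[OF bounded_linear_vec_nth])
  have pn: "pdiff i (\<lambda>x. x $ i) x = 1" for x by (subst pdiff_eqI[OF nthd]) simp
  have nd: "(\<lambda>x::plane. x $ i) differentiable (at x)" for x using nthd by (auto simp: differentiable_def)
  have d2: "(\<lambda>x. \<phi> x * \<phi> x) differentiable (at x)" for x
    by (intro differentiable_mult test_function_differentiable[OF \<phi>])
  have p2: "pdiff i (\<lambda>x. \<phi> x * \<phi> x) = (\<lambda>x. 2 * (\<phi> x * pdiff i \<phi> x))"
    using pdiff_mult[OF test_function_differentiable[OF \<phi>] test_function_differentiable[OF \<phi>]] by (simp add: fun_eq_iff)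
  have bp: "(LINT x|lborel. x $ i * pdiff i (\<lambda>x. \<phi> x * \<phi> x) x) = - (LINT x|lborel. pdiff i (\<lambda>x. x $ i) x * (\<phi> x * \<phi> x))"
  proof (rule integral_by_parts[OF nd _ d2])
    have "pdiff i (\<lambda>x. x $ i) = (\<lambda>x. 1)" using pn by (simp add: fun_eq_iff)
    then show "continuous_on UNIV (pdiff i (\<lambda>x. x $ i))" by simp
    show "continuous_on UNIV (pdiff i (\<lambda>x. \<phi> x * \<phi> x))" unfolding p2 by (intro continuous_intros cont)
    show "bounded_support (\<lambda>x. \<phi> x * \<phi> x)" by (intro bounded_support_mult(1) test_function_bounded_support[OF \<phi>])
  qed
  have i1: "integrable lborel (\<lambda>x. (\<phi> x)\<^sup>2)" "integrable lborel (\<lambda>x. (pdiff i \<phi> x)\<^sup>2)"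
    using TF_mult_integral(3)[OF \<phi> \<phi>] TF_mult_integral(3)[OF \<phi>' \<phi>'] by (simp_all add: power2_eq_square)
  have "(LINT x|lborel. (\<phi> x)\<^sup>2) = (LINT x|lborel. - (x $ i * (2 * (\<phi> x * pdiff i \<phi> x))))"
    using bp unfolding p2 pn by (simp add: power2_eq_square)
  also have "\<dots> \<le> (LINT x|lborel. (\<phi> x)\<^sup>2 / 2 + (2 * radius\<^sup>2) * (pdiff i \<phi> x)\<^sup>2)"
  proof (rule integral_mono)
    show "integrable lborel (\<lambda>x. - (x $ i * (2 * (\<phi> x * pdiff i \<phi> x))))"
      by (intro integrable_minus bounded_support_integrable bounded_support_mult(1) bounded_support_mult(2)
          test_function_bounded_support[OF \<phi>'] continuous_intros cont)
    show "integrable lborel (\<lambda>x. (\<phi> x)\<^sup>2 / 2 + (2 * radius\<^sup>2) * (pdiff i \<phi> x)\<^sup>2)" using i1 by simp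
    fix x :: plane
    show "- (x $ i * (2 * (\<phi> x * pdiff i \<phi> x))) \<le> (\<phi> x)\<^sup>2 / 2 + (2 * radius\<^sup>2) * (pdiff i \<phi> x)\<^sup>2"
    proof (cases "x \<in> \<Omega>")
      case True
      have "\<bar>x $ i\<bar> \<le> radius" using component_le_norm_cart[of x i] radius(2)[OF True] by simp
      then have xr: "(x $ i)\<^sup>2 \<le> radius\<^sup>2" using abs_le_square_iff[of "x $ i" radius] radius(1) by simp
      have "0 \<le> (\<phi> x + 2 * (x $ i) * pdiff i \<phi> x)\<^sup>2 / 2" by simp
      also have "\<dots> = (\<phi> x)\<^sup>2 / 2 + x $ i * (2 * (\<phi> x * pdiff i \<phi> x)) + 2 * ((x $ i)\<^sup>2 * (pdiff i \<phi> x)\<^sup>2)"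
        by (simp add: power2_eq_square algebra_simps add_divide_distrib)
      also have "(x $ i)\<^sup>2 * (pdiff i \<phi> x)\<^sup>2 \<le> radius\<^sup>2 * (pdiff i \<phi> x)\<^sup>2" using xr by (intro mult_right_mono) auto
      finally show ?thesis by simp
    next
      case False
      then show ?thesis using test_function_zero_outside[OF \<phi>] by simp
    qed
  qed
  also have "\<dots> = (LINT x|lborel. (\<phi> x)\<^sup>2) / 2 + (2 * radius\<^sup>2) * (LINT x|lborel. (pdiff i \<phi> x)\<^sup>2)" using i1 by simp
  finally show ?thesis by (simp add: P_def)
qed

text \<open>The new index is appended rather than prepended because \<open>D\<close> of a list acts
  on test functions as \<open>pdiffs\<close> of the reversed list, so the last index is the
  outermost derivative.\<close>

lemma poincare_dn_TF: "\<phi> \<in> TF \<Longrightarrow> dn is \<phi> \<le> P * dn (is @ [i]) \<phi>"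
  using poincare_TF[OF test_functions_pdiffs, of \<phi> "rev is" i]
  unfolding dn_def power2_eq_square by (simp add: TF_ip)

lemma poincare:
  assumes u: "u \<in> sobolev0 \<Omega> m" and len: "length is < m"
  shows "dn is u \<le> P * dn (is @ [i]) u"
proof -
  obtain \<phi> where \<phi>: "\<And>n::nat. \<phi> n \<in> TF" "(\<lambda>n. sobolev_norm \<Omega> m (\<lambda>x. u x - \<phi> n x)) \<longlonglongrightarrow> 0"
    using sobolev0_approx[OF u] by blast
  note conv = dn_conv[OF sobolev0D[OF u] TF_sobolev[OF \<phi>(1)] \<phi>(2)]
  have "(\<lambda>n. dn is (\<phi> n)) \<longlonglongrightarrow> dn is u" by (rule conv) (use len in auto)
  moreover have "(\<lambda>n. P * dn (is @ [i]) (\<phi> n)) \<longlonglongrightarrow> P * dn (is @ [i]) u"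
    by (intro tendsto_intros conv) (use len in auto)
  ultimately show ?thesis using poincare_dn_TF[OF \<phi>(1)] by (intro LIMSEQ_le) auto
qed

lemma dn1_le:
  assumes "u \<in> V \<Omega>"
  shows "dn [i] u \<le> P * (energy_norm \<Omega> u)\<^sup>2"
proof -
  have "dn [i] u \<le> P * dn [i, 1] u" using poincare[OF assms, of "[i]" 1] by simp
  also have "\<dots> \<le> P * (energy_norm \<Omega> u)\<^sup>2" using P_pos by (intro mult_left_mono dn_le_energy) auto
  finally show ?thesis .
qed

lemma dn0_le:
  assumes "u \<in> V \<Omega>"
  shows "dn [] u \<le> P * (P * (energy_norm \<Omega> u)\<^sup>2)"
proof -
  have "dn [] u \<le> P * dn [1] u" using poincare[OF assms, of "[]" 1] by simp
  also have "\<dots> \<le> P * (P * (energy_norm \<Omega> u)\<^sup>2)" using P_pos dn1_le[OF assms] by (intro mult_left_mono) auto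
  finally show ?thesis .
qed

lemma dn_le:
  assumes "u \<in> V \<Omega>" "length is \<le> 2"
  shows "dn is u \<le> (1 + P + P * P) * (energy_norm \<Omega> u)\<^sup>2"
proof -
  let ?E = "(energy_norm \<Omega> u)\<^sup>2"
  have nn: "0 \<le> ?E" "0 \<le> P * ?E" "0 \<le> P * (P * ?E)" using P_pos by auto
  have eq: "(1 + P + P * P) * ?E = ?E + P * ?E + P * (P * ?E)" by (simp add: algebra_simps)
  consider "is = []" | i where "is = [i]" | "length is = 2"
    using assms(2) by (cases "is" rule: rev_cases; force simp: le_Suc_eq numeral_2_eq_2 length_Suc_conv)
  then show ?thesis
  proof cases
    case 1 then have "dn is u = dn [] u" by simp
    then show ?thesis unfolding eq using dn0_le[OF assms(1)] nn by linarith
  next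
    case 2 then have "dn is u = dn [i] u" by simp
    then show ?thesis unfolding eq using dn1_le[OF assms(1), of i] nn by linarith
  next
    case 3 then show ?thesis unfolding eq using dn_le_energy[OF 3, of u] nn by linarith
  qed
qed

text \<open>Ladyzhenskaya's inequality is applied to the first derivatives of approximating test
  functions, with Poincare's inequality for the factor of lower order. An almost everywhere
  convergent subsequence and Fatou's lemma carry the bound over to V.\<close>

lemma power4_bound:
  assumes u: "u \<in> V \<Omega>"
  shows "integrable M (\<lambda>x. (D [i] u x) ^ 4)" "(LINT x|M. (D [i] u x) ^ 4) \<le> 4 * P * ((energy_norm \<Omega> u)\<^sup>2)\<^sup>2"
proof -
  obtain \<phi> where \<phi>: "\<And>n::nat. \<phi> n \<in> TF" "(\<lambda>n. sobolev_norm \<Omega> 2 (\<lambda>x. u x - \<phi> n x)) \<longlonglongrightarrow> 0"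
    using sobolev0_approx[OF u] by blast
  have su: "u \<in> sobolev \<Omega> 2" and s\<phi>: "\<phi> n \<in> sobolev \<Omega> 2" for n
    using sobolev0D[OF u] TF_sobolev[OF \<phi>(1)] by auto
  have D: "D [i] u \<in> l2 M" "D [i] (\<phi> n) \<in> l2 M" for n
    using sobolevD(2)[OF su, of "[i]"] sobolevD(2)[OF s\<phi>, of "[i]"] by auto
  have "(\<lambda>n. l2.nrm M (D [i] (\<phi> n) - D [i] u)) \<longlonglongrightarrow> 0" by (rule D_conv[OF su s\<phi> \<phi>(2)]) simp
  from tendsto_power[OF this, of 2] have "(\<lambda>n. LINT x|M. (D [i] (\<phi> n) x - D [i] u x)\<^sup>2) \<longlonglongrightarrow> 0"
    by (simp add: l2.nrm_def power2_eq_square)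
  from l2_AE_subseq[OF D(2,1) this]
  obtain r :: "nat \<Rightarrow> nat" where r: "strict_mono r" "AE x in M. (\<lambda>n. D [i] (\<phi> (r n)) x) \<longlonglongrightarrow> D [i] u x" by blast
  define E where "E n = (energy_norm \<Omega> (\<phi> (r n)))\<^sup>2" for n
  have "(\<lambda>n. (energy_norm \<Omega> (\<phi> n))\<^sup>2) \<longlonglongrightarrow> (energy_norm \<Omega> u)\<^sup>2"
    unfolding energy_sq by (intro tendsto_intros dn_conv[OF su s\<phi> \<phi>(2)]) auto
  from LIMSEQ_subseq_LIMSEQ[OF this r(1)] have E: "E \<longlonglongrightarrow> (energy_norm \<Omega> u)\<^sup>2" unfolding E_def[abs_def] comp_def .
  have est: "integrable M (\<lambda>x. (D [i] (\<phi> (r n)) x) ^ 4) \<and> (LINT x|M. (D [i] (\<phi> (r n)) x) ^ 4) \<le> 4 * P * (E n)\<^sup>2" for n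
  proof -
    note T = \<phi>(1)[of "r n"]
    note T' = test_functions_pdiff[OF T, of i]
    have ae: "AE x in M. D [i] (\<phi> (r n)) x ^ 4 = pdiff i (\<phi> (r n)) x ^ 4"
      using TF_weak_deriv[OF T, of "[i]"] by eventually_elim simp
    have m: "(\<lambda>x. D [i] (\<phi> (r n)) x ^ 4) \<in> borel_measurable M" "(\<lambda>x. pdiff i (\<phi> (r n)) x ^ 4) \<in> borel_measurable M"
      using l2D(1)[OF D(2)[of "r n"]] TF_measurable[OF T'] by simp_all
    have dn': "(LINT x|M. (pdiffs (rev is) (\<phi> (r n)) x)\<^sup>2) = dn is (\<phi> (r n))" for "is"
      unfolding dn_def power2_eq_square using TF_ip[OF T T, of "is" "is"] T by (simp add: TF_mult_integral(1) test_functions_pdiffs)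
    have "(LINT x|M. pdiff i (\<phi> (r n)) x ^ 4) \<le> 4 * dn [i] (\<phi> (r n)) * sqrt (dn [i, 1] (\<phi> (r n))) * sqrt (dn [i, 2] (\<phi> (r n)))"
      using TF_power4(2)[OF T'] dn'[of "[i]"] dn'[of "[i, 1]"] dn'[of "[i, 2]"] by simp
    also have "\<dots> \<le> 4 * (P * E n) * sqrt (E n) * sqrt (E n)"
      unfolding E_def using dn1_le[OF TF_sobolev0[OF T]] dn_le_energy[of "[i, 1]" "\<phi> (r n)"] dn_le_energy[of "[i, 2]" "\<phi> (r n)"] P_pos
      by (intro mult_mono real_sqrt_le_mono) auto
    also have "\<dots> = 4 * P * (E n)\<^sup>2" by (simp add: E_def power2_eq_square mult.assoc)
    finally have "(LINT x|M. pdiff i (\<phi> (r n)) x ^ 4) \<le> 4 * P * (E n)\<^sup>2" .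
    then show ?thesis using TF_power4(1)[OF T'] integral_cong_AE[OF m ae] integrable_cong_AE[OF m ae] by simp
  qed
  have ae4: "AE x in M. (\<lambda>n. D [i] (\<phi> (r n)) x ^ 4) \<longlonglongrightarrow> D [i] u x ^ 4"
    using r(2) by eventually_elim (intro tendsto_intros)
  have m4: "(\<lambda>x. D [i] u x ^ 4) \<in> borel_measurable M" using l2D(1)[OF D(1)] by simp
  \<comment> \<open>The bounds for the approximations only tend to the claimed bound, hence the
    slack \<open>e\<close>.\<close>
  have key: "integrable M (\<lambda>x. (D [i] u x) ^ 4) \<and> (LINT x|M. (D [i] u x) ^ 4) \<le> 4 * P * ((energy_norm \<Omega> u)\<^sup>2)\<^sup>2 + e" if e: "e > 0" for e
  proof -
    have "(\<lambda>n. 4 * P * (E n)\<^sup>2) \<longlonglongrightarrow> 4 * P * ((energy_norm \<Omega> u)\<^sup>2)\<^sup>2" by (intro tendsto_intros E)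
    then have "\<forall>\<^sub>F n in sequentially. 4 * P * (E n)\<^sup>2 < 4 * P * ((energy_norm \<Omega> u)\<^sup>2)\<^sup>2 + e"
      by (rule order_tendstoD(2)) (use e in simp)
    then obtain K where K: "\<And>n. n \<ge> K \<Longrightarrow> 4 * P * (E n)\<^sup>2 < 4 * P * ((energy_norm \<Omega> u)\<^sup>2)\<^sup>2 + e"
      by (auto simp: eventually_sequentially)
    have b: "(LINT x|M. (D [i] (\<phi> (r n)) x) ^ 4) \<le> 4 * P * ((energy_norm \<Omega> u)\<^sup>2)\<^sup>2 + e" if "n \<ge> K" for n
      using est[of n] K[OF that] by linarith
    show ?thesis
      using fatou_bound[OF _ _ m4 _ ae4 b] est by auto
  qed
  show "integrable M (\<lambda>x. (D [i] u x) ^ 4)" using key[of 1] by simp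
  show "(LINT x|M. (D [i] u x) ^ 4) \<le> 4 * P * ((energy_norm \<Omega> u)\<^sup>2)\<^sup>2"
    by (rule field_le_epsilon) (rule key[THEN conjunct2])
qed

end

section \<open>The trilinear form\<close>

lemma l2_bounded_mult:
  assumes p: "p \<in> l2 M" and q: "q \<in> borel_measurable M" and bd: "AE x in M. \<bar>q x\<bar> \<le> C" and C: "C \<ge> 0"
  shows "(\<lambda>x. p x * q x) \<in> l2 M" "l2.nrm M (\<lambda>x. p x * q x) \<le> C * l2.nrm M p"
proof -
  have ae: "AE x in M. norm ((p x * q x)\<^sup>2) \<le> norm (C\<^sup>2 * (p x)\<^sup>2)"
    using bd
  proof eventually_elim
    fix x assume "\<bar>q x\<bar> \<le> C"
    then have "(q x)\<^sup>2 \<le> C\<^sup>2" using C abs_le_square_iff[of "q x" C] by simp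
    then have "(p x)\<^sup>2 * (q x)\<^sup>2 \<le> (p x)\<^sup>2 * C\<^sup>2" by (intro mult_left_mono) auto
    then show "norm ((p x * q x)\<^sup>2) \<le> norm (C\<^sup>2 * (p x)\<^sup>2)" by (simp add: power_mult_distrib mult.commute)
  qed
  have m: "(\<lambda>x. (p x * q x)\<^sup>2) \<in> borel_measurable M" using l2D(1)[OF p] q by simp
  have i: "integrable M (\<lambda>x. C\<^sup>2 * (p x)\<^sup>2)" using l2D(2)[OF p] by simp
  have int: "integrable M (\<lambda>x. (p x * q x)\<^sup>2)" by (rule Bochner_Integration.integrable_bound[OF i m ae])
  then show "(\<lambda>x. p x * q x) \<in> l2 M" using l2D(1)[OF p] q by (simp add: l2_def)
  have "(LINT x|M. (p x * q x)\<^sup>2) \<le> (LINT x|M. C\<^sup>2 * (p x)\<^sup>2)"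
    by (rule integral_mono_AE[OF int i]) (use ae in eventually_elim, simp)
  then have "sqrt (LINT x|M. (p x * q x)\<^sup>2) \<le> sqrt (C\<^sup>2 * (LINT x|M. (p x)\<^sup>2))" by simp
  then show "l2.nrm M (\<lambda>x. p x * q x) \<le> C * l2.nrm M p"
    using C by (simp add: l2.nrm_def real_sqrt_mult flip: power2_eq_square)
qed

text \<open>The Cauchy-Schwarz inequality for the squares of \<open>p\<close> and
  \<open>q\<close>.\<close>

lemma l2_mult_power4:
  assumes m: "p \<in> borel_measurable M" "q \<in> borel_measurable M"
    and p: "integrable M (\<lambda>x. (p x) ^ 4)" "(LINT x|M. (p x) ^ 4) \<le> A\<^sup>2" "A \<ge> 0"
    and q: "integrable M (\<lambda>x. (q x) ^ 4)" "(LINT x|M. (q x) ^ 4) \<le> B\<^sup>2" "B \<ge> 0"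
  shows "(\<lambda>x. p x * q x) \<in> l2 M" "(l2.nrm M (\<lambda>x. p x * q x))\<^sup>2 \<le> A * B"
proof -
  have l: "(\<lambda>x. (p x)\<^sup>2) \<in> l2 M" "(\<lambda>x. (q x)\<^sup>2) \<in> l2 M"
    using m p(1) q(1) by (auto simp: l2_def simp flip: power_mult)
  have eq: "(\<lambda>x. (p x * q x)\<^sup>2) = (\<lambda>x. (p x)\<^sup>2 * (q x)\<^sup>2)" by (simp add: power_mult_distrib)
  show pq: "(\<lambda>x. p x * q x) \<in> l2 M" using l2_mult[OF l] m unfolding l2_def eq[symmetric] by simp
  have n: "l2.nrm M (\<lambda>x. (f x)\<^sup>2) = sqrt (LINT x|M. (f x) ^ 4)" for f
    unfolding l2.nrm_def by (simp flip: power_add)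
  have nA: "l2.nrm M (\<lambda>x. (p x)\<^sup>2) \<le> A" and nB: "l2.nrm M (\<lambda>x. (q x)\<^sup>2) \<le> B"
    unfolding n using p q by (auto intro!: real_le_lsqrt)
  have "(l2.nrm M (\<lambda>x. p x * q x))\<^sup>2 = (LINT x|M. (p x)\<^sup>2 * (q x)\<^sup>2)"
    using l2.nrm_sq[OF pq] by (simp add: power2_eq_square mult_ac)
  also have "\<dots> \<le> l2.nrm M (\<lambda>x. (p x)\<^sup>2) * l2.nrm M (\<lambda>x. (q x)\<^sup>2)" using l2.cauchy_schwarz[OF l] by simp
  also have "\<dots> \<le> A * B" using nA nB p(3) l by (intro mult_mono) auto
  finally show "(l2.nrm M (\<lambda>x. p x * q x))\<^sup>2 \<le> A * B" .
qed

section \<open>Functionals in H^-1 and functions that vanish almost everywhere\<close>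

context open_domain
begin

lemma D_l2: "u \<in> sobolev \<Omega> m \<Longrightarrow> length is \<le> m \<Longrightarrow> D is u \<in> l2 M"
  by (rule sobolevD(2))

lemma sobolev_l2: "u \<in> sobolev \<Omega> m \<Longrightarrow> u \<in> l2 M"
  by (simp add: sobolev_def L2_eq_l2)

text \<open>Functionals of this shape lie in \<open>H\<^sup>-\<^sup>1\<close>.\<close>

definition h1_form :: "sfun \<Rightarrow> sfun \<Rightarrow> sfun \<Rightarrow> sfun \<Rightarrow> real" where
  "h1_form w0 w1 w2 \<phi> = (LINT x|M. w0 x * \<phi> x) + (LINT x|M. w1 x * D [1] \<phi> x) + (LINT x|M. w2 x * D [2] \<phi> x)"

lemma h1_form_lin:
  assumes w: "w0 \<in> l2 M" "w1 \<in> l2 M" "w2 \<in> l2 M"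
    and uv: "u \<in> sobolev \<Omega> m" "v \<in> sobolev \<Omega> m" and m: "1 \<le> m"
  shows "h1_form w0 w1 w2 (\<lambda>x. a * u x + b * v x) = a * h1_form w0 w1 w2 u + b * h1_form w0 w1 w2 v"
proof -
  have lin: "(LINT x|M. w x * (a * p x + b * q x)) = a * (LINT x|M. w x * p x) + b * (LINT x|M. w x * q x)"
    if "w \<in> l2 M" "p \<in> l2 M" "q \<in> l2 M" for w p q
    using l2_mult[OF that(1,2)] l2_mult[OF that(1,3)] by (simp add: distrib_left mult.left_commute)
  have i: "(LINT x|M. w x * D [i] (\<lambda>x. a * u x + b * v x) x) = (LINT x|M. w x * (a * D [i] u x + b * D [i] v x))"
    if w: "w \<in> l2 M" for w i
  proof (rule integral_cong_AE)
    have "D [i] (\<lambda>x. a * u x + b * v x) \<in> l2 M" using sobolev_lin[OF uv] m by (intro D_l2) auto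
    from l2D(1)[OF this] show "(\<lambda>x. w x * D [i] (\<lambda>x. a * u x + b * v x) x) \<in> borel_measurable M" using w[THEN l2D(1)] by simp
    have "D [i] u \<in> l2 M" "D [i] v \<in> l2 M" using uv m by (auto intro!: D_l2)
    from this[THEN l2D(1)] show "(\<lambda>x. w x * (a * D [i] u x + b * D [i] v x)) \<in> borel_measurable M" using w[THEN l2D(1)] by simp
    have "AE x in M. D [i] (\<lambda>x. a * u x + b * v x) x = a * D [i] u x + b * D [i] v x"
      using m by (intro weak_deriv_lin[OF uv]) simp
    then show "AE x in M. w x * D [i] (\<lambda>x. a * u x + b * v x) x = w x * (a * D [i] u x + b * D [i] v x)"
      by eventually_elim simp
  qed
  have l: "D [i] u \<in> l2 M" "D [i] v \<in> l2 M" for i using uv m by (auto intro!: D_l2)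
  show ?thesis unfolding h1_form_def i[OF w(2)] i[OF w(3)]
    using lin[OF w(1) uv[THEN sobolev_l2]] lin[OF w(2) l] lin[OF w(3) l]
    by (simp add: algebra_simps)
qed

lemma nrm_le_norm1:
  assumes "u \<in> sobolev \<Omega> m"
  shows "l2.nrm M u \<le> sobolev_norm \<Omega> 1 u" "l2.nrm M (D [i] u) \<le> sobolev_norm \<Omega> 1 u"
proof -
  have u: "u \<in> l2 M" using assms by (simp add: sobolev_def L2_eq_l2)
  have "l2.nrm M u = l2.nrm M (D [] u)"
    unfolding l2.nrm_def
  proof (rule arg_cong[where f = sqrt], rule integral_cong_AE)
    show "(\<lambda>x. u x * u x) \<in> borel_measurable M" using l2D(1)[OF u] by simp
    show "(\<lambda>x. D [] u x * D [] u x) \<in> borel_measurable M" using l2D(1)[OF D_l2[OF assms, of "[]"]] by simp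
    show "AE x in M. u x * u x = D [] u x * D [] u x" using weak_deriv_Nil[OF u] by eventually_elim simp
  qed
  also have "\<dots> = sqrt (dn [] u)" by (simp add: l2.nrm_def dn_def power2_eq_square)
  also have "\<dots> \<le> sobolev_norm \<Omega> 1 u" using dn_le_norm[of "[]" 1 u] by (intro real_le_lsqrt) auto
  finally show "l2.nrm M u \<le> sobolev_norm \<Omega> 1 u" .
  have "l2.nrm M (D [i] u) = sqrt (dn [i] u)" by (simp add: l2.nrm_def dn_def power2_eq_square)
  also have "\<dots> \<le> sobolev_norm \<Omega> 1 u" using dn_le_norm[of "[i]" 1 u] by (intro real_le_lsqrt) auto
  finally show "l2.nrm M (D [i] u) \<le> sobolev_norm \<Omega> 1 u" .
qed

lemma h1_form_bound:
  assumes w: "w0 \<in> l2 M" "w1 \<in> l2 M" "w2 \<in> l2 M" and u: "u \<in> sobolev \<Omega> m" "1 \<le> m"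
  shows "\<bar>h1_form w0 w1 w2 u\<bar> \<le> (l2.nrm M w0 + l2.nrm M w1 + l2.nrm M w2) * sobolev_norm \<Omega> 1 u"
proof -
  have ul: "u \<in> l2 M" using u by (simp add: sobolev_def L2_eq_l2)
  have l: "D [i] u \<in> l2 M" for i using u by (auto intro!: D_l2)
  have c: "\<bar>LINT x|M. w x * p x\<bar> \<le> l2.nrm M w * sobolev_norm \<Omega> 1 u"
    if "w \<in> l2 M" "p \<in> l2 M" "l2.nrm M p \<le> sobolev_norm \<Omega> 1 u" for w p
    using order_trans[OF l2.cauchy_schwarz[OF that(1,2)] mult_left_mono[OF that(3) l2.nrm_nonneg[OF that(1)]]] .
  have "\<bar>h1_form w0 w1 w2 u\<bar> \<le> \<bar>LINT x|M. w0 x * u x\<bar> + \<bar>LINT x|M. w1 x * D [1] u x\<bar> + \<bar>LINT x|M. w2 x * D [2] u x\<bar>"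
    unfolding h1_form_def by linarith
  also have "\<dots> \<le> l2.nrm M w0 * sobolev_norm \<Omega> 1 u + l2.nrm M w1 * sobolev_norm \<Omega> 1 u + l2.nrm M w2 * sobolev_norm \<Omega> 1 u"
    by (intro add_mono c w ul l nrm_le_norm1[OF u(1)])
  finally show ?thesis by (simp add: distrib_right)
qed

text \<open>The empty box is contained in every \<Omega>, so a bump over it is a test function
  without further conditions.\<close>

lemma TF_nonempty: "\<exists>\<phi>. \<phi> \<in> TF"
proof -
  have "x \<notin> cbox (1 :: plane) 0" for x
  proof
    assume "x \<in> cbox (1 :: plane) 0"
    then have "1 \<le> x $ 1 \<and> x $ 1 \<le> 0" by (simp add: mem_box_cart)
    then show False by linarith
  qed
  then have "cbox (1 :: plane) 0 = {}" by blast
  then show ?thesis using box_bump_test_function[of 1 0 \<Omega> 0] by auto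
qed

lemma zero_sobolev0: "(\<lambda>x. 0) \<in> sobolev0 \<Omega> m"
  and norm_zero: "sobolev_norm \<Omega> m (\<lambda>x. 0) = 0"
proof -
  obtain \<phi> where \<phi>: "\<phi> \<in> TF" using TF_nonempty by blast
  show "(\<lambda>x. 0) \<in> sobolev0 \<Omega> m" using sobolev0_lin[OF TF_sobolev0[OF \<phi>] TF_sobolev0[OF \<phi>], where m = m and a = 0 and b = 0] by simp
  have "(sobolev_norm \<Omega> m (\<lambda>x. 0))\<^sup>2 \<le> 0" using norm_lin_le[OF TF_sobolev[OF \<phi>] TF_sobolev[OF \<phi>], where m = m and a = 0 and b = 0] by simp
  then show "sobolev_norm \<Omega> m (\<lambda>x. 0) = 0" by simp
qed

lemma h1_form_Hminus1:
  assumes w: "w0 \<in> l2 M" "w1 \<in> l2 M" "w2 \<in> l2 M"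
  shows "h1_form w0 w1 w2 \<in> Hminus1 \<Omega>" "Hminus1_norm \<Omega> (h1_form w0 w1 w2) \<le> l2.nrm M w0 + l2.nrm M w1 + l2.nrm M w2"
proof -
  let ?C = "l2.nrm M w0 + l2.nrm M w1 + l2.nrm M w2"
  have C: "?C \<ge> 0" using w by simp
  have b: "\<bar>h1_form w0 w1 w2 v\<bar> \<le> ?C * sobolev_norm \<Omega> 1 v" if "v \<in> sobolev0 \<Omega> 1" for v
    using h1_form_bound[OF w sobolev0D[OF that]] by simp
  have "\<forall>v\<in>sobolev0 \<Omega> 1. \<forall>u\<in>sobolev0 \<Omega> 1. \<forall>a b. h1_form w0 w1 w2 (\<lambda>x. a * v x + b * u x) = a * h1_form w0 w1 w2 v + b * h1_form w0 w1 w2 u"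
    using h1_form_lin[OF w sobolev0D sobolev0D, of _ 1] by simp
  then show "h1_form w0 w1 w2 \<in> Hminus1 \<Omega>" using b unfolding bounded_functionals_def by blast
  show "Hminus1_norm \<Omega> (h1_form w0 w1 w2) \<le> ?C"
    unfolding dual_norm_def
  proof (rule cSUP_least)
    show "{v \<in> sobolev0 \<Omega> 1. sobolev_norm \<Omega> 1 v \<le> 1} \<noteq> {}" using zero_sobolev0[of 1] norm_zero[of 1] by auto
    fix v assume v: "v \<in> {v \<in> sobolev0 \<Omega> 1. sobolev_norm \<Omega> 1 v \<le> 1}"
    then have "\<bar>h1_form w0 w1 w2 v\<bar> \<le> ?C * sobolev_norm \<Omega> 1 v" using b by simp
    also have "\<dots> \<le> ?C * 1" using v C by (intro mult_left_mono) auto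
    finally show "\<bar>h1_form w0 w1 w2 v\<bar> \<le> ?C" by simp
  qed
qed

text \<open>The assumptions \<open>p\<close> mark the gap between functionals on V and those in
  H^-1: the Laplacian of \<eta> times a first derivative of \<zeta> has to be square integrable,
  which holds as soon as one of the two is bounded.\<close>

lemma Gamma_h1_form:
  assumes p: "(\<lambda>x. laplace \<Omega> \<eta> x * D [2] \<zeta> x) \<in> l2 M" "(\<lambda>x. laplace \<Omega> \<eta> x * D [1] \<zeta> x) \<in> l2 M"
    and \<phi>: "\<phi> \<in> sobolev \<Omega> m" "1 \<le> m"
  shows "form_Gamma \<Omega> \<eta> \<zeta> \<phi> = h1_form (\<lambda>x. 0) (\<lambda>x. laplace \<Omega> \<eta> x * D [2] \<zeta> x) (\<lambda>x. - (laplace \<Omega> \<eta> x * D [1] \<zeta> x)) \<phi>"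
proof -
  have l: "D [i] \<phi> \<in> l2 M" for i using \<phi> by (auto intro!: D_l2)
  have "form_Gamma \<Omega> \<eta> \<zeta> \<phi> = (LINT x|M. (laplace \<Omega> \<eta> x * D [2] \<zeta> x) * D [1] \<phi> x - (laplace \<Omega> \<eta> x * D [1] \<zeta> x) * D [2] \<phi> x)"
    unfolding form_Gamma_def by (rule Bochner_Integration.integral_cong) (auto simp: algebra_simps)
  also have "\<dots> = (LINT x|M. (laplace \<Omega> \<eta> x * D [2] \<zeta> x) * D [1] \<phi> x) - (LINT x|M. (laplace \<Omega> \<eta> x * D [1] \<zeta> x) * D [2] \<phi> x)"
    by (intro Bochner_Integration.integral_diff l2_mult p l)
  finally show ?thesis by (simp add: h1_form_def)
qed

lemma energy_zero_if_AE_zero: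
  assumes u: "u \<in> sobolev \<Omega> 2" and ae: "AE x in M. u x = 0"
  shows "energy_norm \<Omega> u = 0"
proof -
  have ul: "u \<in> l2 M" using u by (simp add: sobolev_def L2_eq_l2)
  have z: "(\<lambda>x. 0) \<in> l2 M" by (simp add: l2_def)
  have "has_weak_deriv \<Omega> is u (\<lambda>x. 0)" for "is"
    unfolding has_weak_deriv_def
  proof (intro conjI ballI l2_locally_integrable ul z)
    fix \<phi> assume \<phi>: "\<phi> \<in> TF"
    have "(LINT x|M. u x * pdiffs is \<phi> x) = (LINT x|M. 0)"
    proof (rule integral_cong_AE)
      show "(\<lambda>x. u x * pdiffs is \<phi> x) \<in> borel_measurable M"
        using l2D(1)[OF ul] TF_measurable[OF test_functions_pdiffs[OF \<phi>]] by simp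
      show "AE x in M. u x * pdiffs is \<phi> x = 0" using ae by eventually_elim simp
    qed simp
    then show "(LINT x|M. u x * pdiffs is \<phi> x) = (-1) ^ length is * (LINT x|M. 0 * \<phi> x)" by simp
  qed
  from weak_deriv_works(2)[OF this] have D0: "AE x in M. D is u x = 0" for "is" .
  have "dn is u = 0" if len: "length is \<le> 2" for "is"
  proof -
    have "dn is u = (LINT x|M. 0)"
      unfolding dn_def
    proof (rule integral_cong_AE)
      show "(\<lambda>x. (D is u x)\<^sup>2) \<in> borel_measurable M" using l2D(1)[OF D_l2[OF u len]] by simp
      show "AE x in M. (D is u x)\<^sup>2 = 0" using D0[of "is"] by eventually_elim simp
    qed simp
    then show ?thesis by simp
  qed
  then have "(energy_norm \<Omega> u)\<^sup>2 = 0" unfolding energy_sq by simp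
  then show ?thesis by simp
qed

end

section \<open>The trilinear form on V and completeness of V\<close>

context bounded_domain
begin

lemma V_diff_mem: "u \<in> V \<Omega> \<Longrightarrow> v \<in> V \<Omega> \<Longrightarrow> (\<lambda>x. u x - v x) \<in> V \<Omega>"
  using sobolev0_lin[of u 2 v 1 "-1"] by simp

lemma AE_zero_if_energy_zero:
  assumes u: "u \<in> V \<Omega>" and z: "energy_norm \<Omega> u = 0"
  shows "AE x in M. u x = 0"
proof -
  have us: "u \<in> sobolev \<Omega> 2" using u by (rule sobolev0D)
  have ul: "u \<in> l2 M" using us by (simp add: sobolev_def L2_eq_l2)
  have Dl: "D [] u \<in> l2 M" using us by (intro D_l2) auto
  have "dn [] u = 0" using dn0_le[OF u] z dn_nonneg[of "[]" u] by (simp del: dn_nonneg)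
  then have "AE x in M. (D [] u x)\<^sup>2 = 0"
    unfolding dn_def using l2D(2)[OF Dl] by (subst (asm) integral_nonneg_eq_0_iff_AE) auto
  then show ?thesis using weak_deriv_Nil[OF ul] by eventually_elim simp
qed

text \<open>Translates the almost-everywhere uniqueness in \<open>bijective_op\<close> into the
  vanishing of a seminorm, by Poincare's inequality in one direction.\<close>

lemma ae_eq_iff_energy:
  assumes "u \<in> V \<Omega>" "v \<in> V \<Omega>"
  shows "ae_eq \<Omega> u v \<longleftrightarrow> energy_norm \<Omega> (\<lambda>x. u x - v x) = 0"
proof -
  note d = V_diff_mem[OF assms]
  have "ae_eq \<Omega> u v \<longleftrightarrow> (AE x in M. u x - v x = 0)" by (simp add: ae_eq_def)
  then show ?thesis using AE_zero_if_energy_zero[OF d] energy_zero_if_AE_zero[OF sobolev0D[OF d]] by blast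
qed

lemma grad_product:
  assumes "\<zeta> \<in> V \<Omega>" "\<phi> \<in> V \<Omega>"
  shows "(\<lambda>x. D [i] \<zeta> x * D [j] \<phi> x) \<in> l2 M"
    "l2.nrm M (\<lambda>x. D [i] \<zeta> x * D [j] \<phi> x) \<le> 2 * sqrt P * energy_norm \<Omega> \<zeta> * energy_norm \<Omega> \<phi>"
proof -
  have m: "D [i] v \<in> borel_measurable M" if "v \<in> V \<Omega>" for v i
    using l2D(1)[OF D_l2[OF sobolev0D[OF that], of "[i]"]] by simp
  \<comment> \<open>Chosen with K^2 = 4 P, so that the fourth-power bound becomes a perfect
    square.\<close>
  define K where "K = 2 * sqrt P"
  have K: "K \<ge> 0" "K\<^sup>2 = 4 * P" using P_pos by (auto simp: K_def power_mult_distrib)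
  have p4: "integrable M (\<lambda>x. (D [i] v x) ^ 4)" "(LINT x|M. (D [i] v x) ^ 4) \<le> (K * (energy_norm \<Omega> v)\<^sup>2)\<^sup>2" if "v \<in> V \<Omega>" for v i
    using power4_bound[OF that] by (auto simp: power_mult_distrib K(2))
  note r = l2_mult_power4[OF m[OF assms(1)] m[OF assms(2)] p4[OF assms(1)] _ p4[OF assms(2)], of i j]
  have A: "0 \<le> K * (energy_norm \<Omega> \<zeta>)\<^sup>2" "0 \<le> K * (energy_norm \<Omega> \<phi>)\<^sup>2" using K by auto
  show "(\<lambda>x. D [i] \<zeta> x * D [j] \<phi> x) \<in> l2 M" by (rule r(1)[OF A])
  have "(l2.nrm M (\<lambda>x. D [i] \<zeta> x * D [j] \<phi> x))\<^sup>2 \<le> (K * (energy_norm \<Omega> \<zeta>)\<^sup>2) * (K * (energy_norm \<Omega> \<phi>)\<^sup>2)"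
    by (rule r(2)[OF A])
  also have "\<dots> = (K * energy_norm \<Omega> \<zeta> * energy_norm \<Omega> \<phi>)\<^sup>2" by (simp add: power2_eq_square mult_ac)
  finally show "l2.nrm M (\<lambda>x. D [i] \<zeta> x * D [j] \<phi> x) \<le> 2 * sqrt P * energy_norm \<Omega> \<zeta> * energy_norm \<Omega> \<phi>"
    unfolding K_def by (rule power2_le_imp_le) (use P_pos in simp)
qed

text \<open>Up to sign the Jacobian determinant of \<zeta> and \<phi>. Grouping the two gradients
  makes \<Gamma> an L^2 pairing with the Laplacian of the first argument.\<close>

definition curl_form :: "sfun \<Rightarrow> sfun \<Rightarrow> sfun" where
  "curl_form \<zeta> \<phi> x = D [2] \<zeta> x * D [1] \<phi> x - D [1] \<zeta> x * D [2] \<phi> x"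

lemma Gamma_eq: "form_Gamma \<Omega> \<eta> \<zeta> \<phi> = (LINT x|M. laplace \<Omega> \<eta> x * curl_form \<zeta> \<phi> x)"
  by (simp add: form_Gamma_def curl_form_def)

lemma curl_form_l2:
  assumes "\<zeta> \<in> V \<Omega>" "\<phi> \<in> V \<Omega>"
  shows "curl_form \<zeta> \<phi> \<in> l2 M" "l2.nrm M (curl_form \<zeta> \<phi>) \<le> 4 * sqrt P * energy_norm \<Omega> \<zeta> * energy_norm \<Omega> \<phi>"
proof -
  note g = grad_product[OF assms]
  have eq: "curl_form \<zeta> \<phi> = (\<lambda>x. D [2] \<zeta> x * D [1] \<phi> x) - (\<lambda>x. D [1] \<zeta> x * D [2] \<phi> x)"
    by (simp add: fun_eq_iff curl_form_def)
  show "curl_form \<zeta> \<phi> \<in> l2 M" unfolding eq by (intro l2.V_diff g)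
  show "l2.nrm M (curl_form \<zeta> \<phi>) \<le> 4 * sqrt P * energy_norm \<Omega> \<zeta> * energy_norm \<Omega> \<phi>"
    unfolding eq using l2.nrm_triangle_diff[OF g(1)[of 2 1] g(1)[of 1 2]] g(2)[of 2 1] g(2)[of 1 2] by simp
qed

lemma curl_form_lin:
  assumes "u \<in> V \<Omega>" "v \<in> V \<Omega>" "w \<in> V \<Omega>"
  shows "AE x in M. curl_form (\<lambda>x. a * u x + b * v x) w x = a * curl_form u w x + b * curl_form v w x"
    "AE x in M. curl_form w (\<lambda>x. a * u x + b * v x) x = a * curl_form w u x + b * curl_form w v x"
proof -
  have 1: "AE x in M. D [1] (\<lambda>x. a * u x + b * v x) x = a * D [1] u x + b * D [1] v x"
    by (rule weak_deriv_lin[OF sobolev0D[OF assms(1)] sobolev0D[OF assms(2)]]) simp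
  have 2: "AE x in M. D [2] (\<lambda>x. a * u x + b * v x) x = a * D [2] u x + b * D [2] v x"
    by (rule weak_deriv_lin[OF sobolev0D[OF assms(1)] sobolev0D[OF assms(2)]]) simp
  show "AE x in M. curl_form (\<lambda>x. a * u x + b * v x) w x = a * curl_form u w x + b * curl_form v w x"
    using 1 2 by eventually_elim (simp add: curl_form_def algebra_simps)
  show "AE x in M. curl_form w (\<lambda>x. a * u x + b * v x) x = a * curl_form w u x + b * curl_form w v x"
    using 1 2 by eventually_elim (simp add: curl_form_def algebra_simps)
qed

lemma l2_integral_lin:
  assumes l: "p \<in> l2 N" "r \<in> l2 N" "s \<in> l2 N" "t \<in> l2 N" and ae: "AE x in N. t x = a * r x + b * s x"
  shows "(LINT x|N. p x * t x) = a * (LINT x|N. p x * r x) + b * (LINT x|N. p x * s x)"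
proof -
  have "(LINT x|N. p x * t x) = (LINT x|N. a * (p x * r x) + b * (p x * s x))"
  proof (rule integral_cong_AE)
    show "(\<lambda>x. p x * t x) \<in> borel_measurable N" "(\<lambda>x. a * (p x * r x) + b * (p x * s x)) \<in> borel_measurable N"
      using l[THEN l2D(1)] by simp_all
    show "AE x in N. p x * t x = a * (p x * r x) + b * (p x * s x)"
      using ae by eventually_elim (simp add: algebra_simps)
  qed
  then show ?thesis using l2_mult[OF l(1,2)] l2_mult[OF l(1,3)] by simp
qed

lemma Gamma_lin:
  assumes "u \<in> V \<Omega>" "v \<in> V \<Omega>" "w \<in> V \<Omega>" "z \<in> V \<Omega>"
  shows "form_Gamma \<Omega> (\<lambda>x. a * u x + b * v x) w z = a * form_Gamma \<Omega> u w z + b * form_Gamma \<Omega> v w z"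
    "form_Gamma \<Omega> w (\<lambda>x. a * u x + b * v x) z = a * form_Gamma \<Omega> w u z + b * form_Gamma \<Omega> w v z"
    "form_Gamma \<Omega> w z (\<lambda>x. a * u x + b * v x) = a * form_Gamma \<Omega> w z u + b * form_Gamma \<Omega> w z v"
proof -
  have l: "(\<lambda>x. a * u x + b * v x) \<in> V \<Omega>" using assms by (intro sobolev0_lin)
  note L = laplace_l2[OF sobolev0D]
  have "(LINT x|M. curl_form w z x * laplace \<Omega> (\<lambda>x. a * u x + b * v x) x) =
      a * (LINT x|M. curl_form w z x * laplace \<Omega> u x) + b * (LINT x|M. curl_form w z x * laplace \<Omega> v x)"
    using assms l by (intro l2_integral_lin curl_form_l2 L laplace_lin sobolev0D)
  then show "form_Gamma \<Omega> (\<lambda>x. a * u x + b * v x) w z = a * form_Gamma \<Omega> u w z + b * form_Gamma \<Omega> v w z"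
    by (simp add: Gamma_eq mult.commute)
  show "form_Gamma \<Omega> w (\<lambda>x. a * u x + b * v x) z = a * form_Gamma \<Omega> w u z + b * form_Gamma \<Omega> w v z"
    unfolding Gamma_eq using assms l by (intro l2_integral_lin curl_form_l2 L curl_form_lin)
  show "form_Gamma \<Omega> w z (\<lambda>x. a * u x + b * v x) = a * form_Gamma \<Omega> w z u + b * form_Gamma \<Omega> w z v"
    unfolding Gamma_eq using assms l by (intro l2_integral_lin curl_form_l2 L curl_form_lin)
qed

text \<open>Hoelder's inequality with exponents 2, 4, 4: the Laplacian is measured in L^2, each
  gradient in L^4.\<close>

lemma Gamma_bound:
  assumes "\<eta> \<in> V \<Omega>" "\<zeta> \<in> V \<Omega>" "\<phi> \<in> V \<Omega>"
  shows "\<bar>form_Gamma \<Omega> \<eta> \<zeta> \<phi>\<bar> \<le> 4 * sqrt P * energy_norm \<Omega> \<eta> * energy_norm \<Omega> \<zeta> * energy_norm \<Omega> \<phi>"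
proof -
  note c = curl_form_l2[OF assms(2,3)]
  have "\<bar>form_Gamma \<Omega> \<eta> \<zeta> \<phi>\<bar> \<le> energy_norm \<Omega> \<eta> * l2.nrm M (curl_form \<zeta> \<phi>)"
    unfolding Gamma_eq using l2.cauchy_schwarz[OF laplace_l2[OF sobolev0D[OF assms(1)]] c(1)] by (simp add: laplace_nrm assms(1))
  also have "\<dots> \<le> energy_norm \<Omega> \<eta> * (4 * sqrt P * energy_norm \<Omega> \<zeta> * energy_norm \<Omega> \<phi>)"
    using c(2) by (intro mult_left_mono) auto
  finally show ?thesis by (simp add: mult_ac)
qed

lemma load_lin:
  assumes "f \<in> L2 \<Omega>" "u \<in> sobolev \<Omega> m" "v \<in> sobolev \<Omega> m"
  shows "load \<Omega> f (\<lambda>x. a * u x + b * v x) = a * load \<Omega> f u + b * load \<Omega> f v"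
  unfolding load_def using assms sobolev_lin[OF assms(2,3)]
  by (intro l2_integral_lin AE_I2) (auto simp: sobolev_def L2_eq_l2)

lemma energy_norm_sqrt: "u \<in> V \<Omega> \<Longrightarrow> sqrt (form_a \<Omega> u u) = energy_norm \<Omega> u"
  by (simp add: form_a_energy)

text \<open>By Poincare's inequality a Cauchy sequence for the energy norm is Cauchy in L^2 for
  every derivative of order at most 2. The limits of these derivatives are the weak derivatives of
  the limit function because the defining identity passes to the limit for each test
  function.\<close>

lemma V_complete:
  assumes X: "\<And>n. X n \<in> V \<Omega>"
    and cauchy: "\<And>e. e > 0 \<Longrightarrow> \<exists>N. \<forall>m\<ge>N. \<forall>n\<ge>N. energy_norm \<Omega> (\<lambda>x. X m x - X n x) < e"
  shows "\<exists>v\<in>V \<Omega>. (\<lambda>n::nat. energy_norm \<Omega> (\<lambda>x. X n x - v x)) \<longlonglongrightarrow> 0"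
proof -
  note sX = sobolev0D[OF X]
  define C where "C = sqrt (1 + P + P * P)"
  have Cpos: "C > 0" using P_pos by (auto simp: C_def intro!: add_pos_pos)
  have nrm_diff: "l2.nrm M (D is (X m) - D is (X n)) \<le> C * energy_norm \<Omega> (\<lambda>x. X m x - X n x)" if len: "length is \<le> 2" for "is" m n
  proof -
    have "l2.nrm M (D is (X m) - D is (X n)) = sqrt (dn is (\<lambda>x. X n x - X m x))"
      by (rule dn_diff[OF sX sX len])
    also have "\<dots> = l2.nrm M (D is (X n) - D is (X m))"
      using l2.nrm_minus_commute[OF D_l2[OF sX len] D_l2[OF sX len]] dn_diff[OF sX sX len] by metis
    also have "\<dots> = sqrt (dn is (\<lambda>x. X m x - X n x))" by (rule dn_diff[OF sX sX len])
    also have "\<dots> \<le> sqrt ((1 + P + P * P) * (energy_norm \<Omega> (\<lambda>x. X m x - X n x))\<^sup>2)"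
      by (intro real_sqrt_le_mono dn_le V_diff_mem X len)
    finally show ?thesis by (simp add: real_sqrt_mult C_def)
  qed
  \<comment> \<open>Lists longer than 2 receive a dummy limit, so that one choice function covers
    all lists.\<close>
  have "\<exists>g. g \<in> l2 M \<and> (length is \<le> 2 \<longrightarrow> (\<lambda>n. l2.nrm M (D is (X n) - g)) \<longlonglongrightarrow> 0)" for "is"
  proof (cases "length is \<le> 2")
    case True
    have "\<exists>N. \<forall>m\<ge>N. \<forall>n\<ge>N. l2.nrm M (D is (X m) - D is (X n)) < e" if "e > 0" for e
    proof -
      obtain N where N: "\<forall>m\<ge>N. \<forall>n\<ge>N. energy_norm \<Omega> (\<lambda>x. X m x - X n x) < e / C"
        using cauchy[of "e / C"] \<open>e > 0\<close> Cpos by auto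
      have "l2.nrm M (D is (X m) - D is (X n)) < e" if "m \<ge> N" "n \<ge> N" for m n
      proof -
        have "C * energy_norm \<Omega> (\<lambda>x. X m x - X n x) < C * (e / C)" using N that Cpos by (intro mult_strict_left_mono) auto
        then show ?thesis using nrm_diff[OF True, of m n] Cpos by simp
      qed
      then show ?thesis by blast
    qed
    from l2.complete_nrm[OF D_l2[OF sX True] this] show ?thesis by blast
  next
    case False
    then show ?thesis by (intro exI[of _ 0]) simp
  qed
  then have "\<forall>is. \<exists>g. g \<in> l2 M \<and> (length is \<le> 2 \<longrightarrow> (\<lambda>n. l2.nrm M (D is (X n) - g)) \<longlonglongrightarrow> 0)" by (rule allI)
  from choice[OF this] obtain g where G: "\<forall>is. g is \<in> l2 M \<and> (length is \<le> 2 \<longrightarrow> (\<lambda>n. l2.nrm M (D is (X n) - g is)) \<longlonglongrightarrow> 0)" ..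
  have gl: "g is \<in> l2 M" for "is" using G by simp
  have g: "(\<lambda>n. l2.nrm M (D is (X n) - g is)) \<longlonglongrightarrow> 0" if "length is \<le> 2" for "is"
    using spec[OF G, of "is"] that by simp
  define v where "v = g []"
  have wd: "has_weak_deriv \<Omega> is v (g is)" if len: "length is \<le> 2" for "is"
    unfolding has_weak_deriv_def
  proof (intro conjI ballI)
    show "locally_integrable \<Omega> v" "locally_integrable \<Omega> (g is)" unfolding v_def by (intro l2_locally_integrable gl)+
    fix \<phi> assume \<phi>: "\<phi> \<in> TF"
    note T = TF_l2[OF test_functions_pdiffs[OF \<phi>, of "is"]] TF_l2[OF \<phi>]
    have len0: "length ([] :: 2 list) \<le> 2" by simp
    have lim1: "(\<lambda>n. LINT x|M. D [] (X n) x * pdiffs is \<phi> x) \<longlonglongrightarrow> (LINT x|M. v x * pdiffs is \<phi> x)"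
      unfolding v_def by (rule l2.ip_tendsto[OF D_l2[OF sX len0] gl T(1) g[OF len0]])
    have "(\<lambda>n. LINT x|M. D is (X n) x * \<phi> x) \<longlonglongrightarrow> (LINT x|M. g is x * \<phi> x)"
      by (rule l2.ip_tendsto[OF D_l2[OF sX len] gl T(2) g[OF len]])
    then have lim2: "(\<lambda>n. (-1) ^ length is * (LINT x|M. D is (X n) x * \<phi> x)) \<longlonglongrightarrow> (-1) ^ length is * (LINT x|M. g is x * \<phi> x)"
      by (intro tendsto_intros)
    have ibp: "(LINT x|M. D [] (X n) x * pdiffs is \<phi> x) = (-1) ^ length is * (LINT x|M. D is (X n) x * \<phi> x)" for n
    proof -
      have "(LINT x|M. D [] (X n) x * pdiffs is \<phi> x) = (LINT x|M. X n x * pdiffs is \<phi> x)"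
      proof (rule integral_cong_AE)
        have Xl: "X n \<in> l2 M" using sX[of n] by (simp add: sobolev_def L2_eq_l2)
        show "(\<lambda>x. D [] (X n) x * pdiffs is \<phi> x) \<in> borel_measurable M" "(\<lambda>x. X n x * pdiffs is \<phi> x) \<in> borel_measurable M"
          using l2D(1)[OF D_l2[OF sX[of n], of "[]"]] l2D(1)[OF Xl] l2D(1)[OF T(1)] by simp_all
        show "AE x in M. D [] (X n) x * pdiffs is \<phi> x = X n x * pdiffs is \<phi> x"
          using weak_deriv_Nil[OF Xl] by eventually_elim simp
      qed
      also have "\<dots> = (-1) ^ length is * (LINT x|M. D is (X n) x * \<phi> x)"
        using sobolevD(1)[OF sX len] \<phi> unfolding has_weak_deriv_def by blast
      finally show ?thesis .
    qed
    show "(LINT x|M. v x * pdiffs is \<phi> x) = (-1) ^ length is * (LINT x|M. g is x * \<phi> x)"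
      using LIMSEQ_unique[OF lim1 lim2[folded ibp]] .
  qed
  have sv: "v \<in> sobolev \<Omega> 2" by (rule sobolevI) (use gl wd v_def in auto)
  have dnlim: "(\<lambda>n. dn is (\<lambda>x. v x - X n x)) \<longlonglongrightarrow> 0" if len: "length is \<le> 2" for "is"
  proof -
    have "dn is (\<lambda>x. v x - X n x) = (l2.nrm M (D is (X n) - g is))\<^sup>2" for n
    proof -
      have "sqrt (dn is (\<lambda>x. v x - X n x)) = l2.nrm M (D is (X n) - D is v)" by (rule dn_diff[OF sv sX len, symmetric])
      also have "\<dots> = l2.nrm M (D is (X n) - g is)"
        unfolding l2.nrm_def
      proof (rule arg_cong[where f = sqrt], rule integral_cong_AE)
        show "(\<lambda>x. (D is (X n) - D is v) x * (D is (X n) - D is v) x) \<in> borel_measurable M"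
          "(\<lambda>x. (D is (X n) - g is) x * (D is (X n) - g is) x) \<in> borel_measurable M"
          using l2D(1)[OF D_l2[OF sX[of n] len]] l2D(1)[OF D_l2[OF sv len]] l2D(1)[OF gl[of "is"]] by simp_all
        show "AE x in M. (D is (X n) - D is v) x * (D is (X n) - D is v) x = (D is (X n) - g is) x * (D is (X n) - g is) x"
          using weak_deriv_works(2)[OF wd[OF len]] by eventually_elim simp
      qed
      finally show ?thesis by (metis dn_nonneg real_sqrt_pow2)
    qed
    then show ?thesis using tendsto_power[OF g[OF len], of 2] by simp
  qed
  have "(\<lambda>n. (sobolev_norm \<Omega> 2 (\<lambda>x. v x - X n x))\<^sup>2) \<longlonglongrightarrow> (\<Sum>k\<le>(2::nat). \<Sum>is | length (is :: 2 list) = k. 0)"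
    unfolding norm_sq by (intro tendsto_sum dnlim) auto
  then have "(\<lambda>n. (sobolev_norm \<Omega> 2 (\<lambda>x. v x - X n x))\<^sup>2) \<longlonglongrightarrow> 0" by simp
  from tendsto_real_sqrt[OF this] have nl: "(\<lambda>n. sobolev_norm \<Omega> 2 (\<lambda>x. v x - X n x)) \<longlonglongrightarrow> 0" by simp
  have vV: "v \<in> V \<Omega>" by (rule sobolev0I[OF sv X nl])
  have "energy_norm \<Omega> (\<lambda>x. X n x - v x) \<le> sobolev_norm \<Omega> 2 (\<lambda>x. v x - X n x)" for n
  proof -
    have "(energy_norm \<Omega> (\<lambda>x. X n x - v x))\<^sup>2 = (energy_norm \<Omega> (\<lambda>x. v x - X n x))\<^sup>2"
    proof -
      have "dn is (\<lambda>x. X n x - v x) = dn is (\<lambda>x. v x - X n x)" if len: "length is \<le> 2" for "is"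
        using dn_diff[OF sv sX len, of n] dn_diff[OF sX sv len, of n] l2.nrm_minus_commute[OF D_l2[OF sX[of n] len] D_l2[OF sv len]]
        by (metis real_sqrt_eq_iff)
      then show ?thesis unfolding energy_sq by simp
    qed
    also have "\<dots> \<le> (sobolev_norm \<Omega> 2 (\<lambda>x. v x - X n x))\<^sup>2" unfolding norm2_sq by simp
    finally show ?thesis by (rule power2_le_imp_le) simp
  qed
  then have "(\<lambda>n. energy_norm \<Omega> (\<lambda>x. X n x - v x)) \<longlonglongrightarrow> 0"
    by (intro Lim_null_comparison[OF _ nl]) (auto intro!: always_eventually)
  then show ?thesis using vV by blast
qed

lemma lin_comb_eq: "(\<lambda>x. a * u x + b * v x) = a *\<^sub>R u + b *\<^sub>R (v :: sfun)"
  by (simp add: fun_eq_iff)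

lemma diff_eq: "(\<lambda>x. u x - v x) = u - (v :: sfun)"
  by (simp add: fun_eq_iff)

lemma subspace_V_space: "subspace (V \<Omega>)"
  unfolding subspace_def
proof (intro conjI ballI allI)
  show "0 \<in> V \<Omega>" using zero_sobolev0[of 2] by (simp add: zero_fun_def)
  show "u + v \<in> V \<Omega>" if "u \<in> V \<Omega>" "v \<in> V \<Omega>" for u v
    using sobolev0_lin[OF that, of 1 1] by (simp add: plus_fun_def)
  show "c *\<^sub>R u \<in> V \<Omega>" if "u \<in> V \<Omega>" for u c
    using sobolev0_lin[OF that that, of c 0] by (simp add: scaleR_fun_def)
qed

lemma semi_hilbert_V: "semi_hilbert (V \<Omega>) (form_a \<Omega>)"
proof
  show "subspace (V \<Omega>)" by (rule subspace_V_space)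
  show "form_a \<Omega> (u + v) w = form_a \<Omega> u w + form_a \<Omega> v w" if "u \<in> V \<Omega>" "v \<in> V \<Omega>" "w \<in> V \<Omega>" for u v w
    using form_a_lin[OF that[THEN sobolev0D], of 1 1] by (simp add: plus_fun_def)
  show "form_a \<Omega> (c *\<^sub>R u) w = c * form_a \<Omega> u w" if "u \<in> V \<Omega>" "w \<in> V \<Omega>" for u w c
    using form_a_lin[OF that(1,1,2)[THEN sobolev0D], of c 0] by (simp add: scaleR_fun_def)
  show "form_a \<Omega> u w = form_a \<Omega> w u" for u w by (simp add: form_a_def mult.commute)
  show "0 \<le> form_a \<Omega> u u" for u by (simp add: form_a_def)
  show "\<exists>v\<in>V \<Omega>. (\<lambda>n. sqrt (form_a \<Omega> (X n - v) (X n - v))) \<longlonglongrightarrow> 0"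
    if X: "\<And>n. X n \<in> V \<Omega>"
      and c: "\<And>e. e > 0 \<Longrightarrow> \<exists>N. \<forall>m\<ge>N. \<forall>n\<ge>N. sqrt (form_a \<Omega> (X m - X n) (X m - X n)) < e" for X :: "nat \<Rightarrow> sfun"
  proof -
    have eq: "sqrt (form_a \<Omega> (p - q) (p - q)) = energy_norm \<Omega> (\<lambda>x. p x - q x)" if "p \<in> V \<Omega>" "q \<in> V \<Omega>" for p q
      using energy_norm_sqrt[OF V_diff_mem[OF that]] by (simp add: diff_eq)
    have cc: "\<exists>N. \<forall>m\<ge>N. \<forall>n\<ge>N. energy_norm \<Omega> (\<lambda>x. X m x - X n x) < e" if "e > 0" for e
      using c[OF that] by (simp add: eq X)
    obtain v where v: "v \<in> V \<Omega>" "(\<lambda>n. energy_norm \<Omega> (\<lambda>x. X n x - v x)) \<longlonglongrightarrow> 0"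
      using V_complete[OF X cc] by blast
    then show ?thesis by (intro bexI[of _ v]) (simp_all add: eq X)
  qed
qed

lemma ns_form_V:
  assumes "f \<in> L2 \<Omega>"
  shows "ns_form (V \<Omega>) (form_a \<Omega>) (form_Gamma \<Omega>) (load \<Omega> f) (4 * sqrt P)"
proof -
  interpret H: semi_hilbert "V \<Omega>" "form_a \<Omega>" by (rule semi_hilbert_V)
  have nrm: "H.nrm u = energy_norm \<Omega> u" if "u \<in> V \<Omega>" for u using energy_norm_sqrt[OF that] by (simp add: H.nrm_def)
  show ?thesis
  proof
    show "linear_form (V \<Omega>) (\<lambda>x. form_Gamma \<Omega> x y z)" "linear_form (V \<Omega>) (\<lambda>x. form_Gamma \<Omega> y x z)"
      "linear_form (V \<Omega>) (\<lambda>x. form_Gamma \<Omega> y z x)" if "y \<in> V \<Omega>" "z \<in> V \<Omega>" for y z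
      using Gamma_lin[OF _ _ that] by (simp_all add: linear_form_def lin_comb_eq)
    show "linear_form (V \<Omega>) (load \<Omega> f)"
      using load_lin[OF assms] sobolev0D by (fastforce simp: linear_form_def lin_comb_eq)
    show "\<bar>form_Gamma \<Omega> x y z\<bar> \<le> 4 * sqrt P * H.nrm x * H.nrm y * H.nrm z"
      if "x \<in> V \<Omega>" "y \<in> V \<Omega>" "z \<in> V \<Omega>" for x y z
      using Gamma_bound[OF that] that by (simp add: nrm)
  qed (use P_pos in simp)
qed

end

section \<open>Functionals from \<open>H\<^sup>-\<^sup>1\<close> and finite element approximation\<close>

context open_domain
begin

lemma h1_form_lin_weights:
  assumes w: "w0 \<in> l2 M" "w1 \<in> l2 M" "w2 \<in> l2 M" and w': "w0' \<in> l2 M" "w1' \<in> l2 M" "w2' \<in> l2 M"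
    and u: "u \<in> sobolev \<Omega> m" "1 \<le> m"
  shows "h1_form (a *\<^sub>R w0 + b *\<^sub>R w0') (a *\<^sub>R w1 + b *\<^sub>R w1') (a *\<^sub>R w2 + b *\<^sub>R w2') u = a * h1_form w0 w1 w2 u + b * h1_form w0' w1' w2' u"
proof -
  have l: "D [i] u \<in> l2 M" for i using u by (auto intro!: D_l2)
  have "(LINT x|M. (a *\<^sub>R p + b *\<^sub>R q) x * r x) = a * (LINT x|M. p x * r x) + b * (LINT x|M. q x * r x)"
    if "p \<in> l2 M" "q \<in> l2 M" "r \<in> l2 M" for p q r
    using l2_mult[OF that(1,3)] l2_mult[OF that(2,3)] by (simp add: distrib_right mult.assoc)
  note lin = this[OF w(1) w'(1) sobolev_l2[OF u(1)]] this[OF w(2) w'(2) l] this[OF w(3) w'(3) l]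
  show ?thesis unfolding h1_form_def lin by (simp add: algebra_simps)
qed

text \<open>\<open>h1_bounded l C\<close>: on \<open>V\<close>, \<open>l\<close> coincides with an element of \<open>H\<^sup>-\<^sup>1\<close> of norm at most \<open>C\<close>.\<close>

definition h1_bounded :: "(sfun \<Rightarrow> real) \<Rightarrow> real \<Rightarrow> bool" where
  "h1_bounded l C \<longleftrightarrow> (\<exists>w0\<in>l2 M. \<exists>w1\<in>l2 M. \<exists>w2\<in>l2 M.
     (\<forall>\<phi>\<in>V \<Omega>. l \<phi> = h1_form w0 w1 w2 \<phi>) \<and> l2.nrm M w0 + l2.nrm M w1 + l2.nrm M w2 \<le> C)"

lemma h1_bounded_lin:
  assumes "h1_bounded l C" "h1_bounded l' C'"
  shows "h1_bounded (\<lambda>\<phi>. a * l \<phi> + b * l' \<phi>) (\<bar>a\<bar> * C + \<bar>b\<bar> * C')"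
proof -
  obtain w0 w1 w2 where w: "w0 \<in> l2 M" "w1 \<in> l2 M" "w2 \<in> l2 M" "\<And>\<phi>. \<phi> \<in> V \<Omega> \<Longrightarrow> l \<phi> = h1_form w0 w1 w2 \<phi>"
      "l2.nrm M w0 + l2.nrm M w1 + l2.nrm M w2 \<le> C" using assms(1) unfolding h1_bounded_def by blast
  obtain w0' w1' w2' where w': "w0' \<in> l2 M" "w1' \<in> l2 M" "w2' \<in> l2 M" "\<And>\<phi>. \<phi> \<in> V \<Omega> \<Longrightarrow> l' \<phi> = h1_form w0' w1' w2' \<phi>"
      "l2.nrm M w0' + l2.nrm M w1' + l2.nrm M w2' \<le> C'" using assms(2) unfolding h1_bounded_def by blast
  have n: "l2.nrm M (a *\<^sub>R p + b *\<^sub>R q) \<le> \<bar>a\<bar> * l2.nrm M p + \<bar>b\<bar> * l2.nrm M q" if "p \<in> l2 M" "q \<in> l2 M" for p q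
    using l2.nrm_triangle[of "a *\<^sub>R p" M "b *\<^sub>R q"] that by (simp add: l2.nrm_scale)
  have "\<bar>a\<bar> * (l2.nrm M w0 + l2.nrm M w1 + l2.nrm M w2) + \<bar>b\<bar> * (l2.nrm M w0' + l2.nrm M w1' + l2.nrm M w2') \<le> \<bar>a\<bar> * C + \<bar>b\<bar> * C'"
    using w(5) w'(5) by (intro add_mono mult_left_mono) auto
  then have "l2.nrm M (a *\<^sub>R w0 + b *\<^sub>R w0') + l2.nrm M (a *\<^sub>R w1 + b *\<^sub>R w1') + l2.nrm M (a *\<^sub>R w2 + b *\<^sub>R w2') \<le> \<bar>a\<bar> * C + \<bar>b\<bar> * C'"
    using n[OF w(1) w'(1)] n[OF w(2) w'(2)] n[OF w(3) w'(3)] by (simp add: distrib_left)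
  moreover have "a * l \<phi> + b * l' \<phi> = h1_form (a *\<^sub>R w0 + b *\<^sub>R w0') (a *\<^sub>R w1 + b *\<^sub>R w1') (a *\<^sub>R w2 + b *\<^sub>R w2') \<phi>" if "\<phi> \<in> V \<Omega>" for \<phi>
    using h1_form_lin_weights[OF w(1-3) w'(1-3) sobolev0D[OF that], of a b] w(4) w'(4) that by simp
  ultimately show ?thesis unfolding h1_bounded_def using w w' by (intro bexI[where x = "a *\<^sub>R w0 + b *\<^sub>R w0'"] bexI[where x = "a *\<^sub>R w1 + b *\<^sub>R w1'"] bexI[where x = "a *\<^sub>R w2 + b *\<^sub>R w2'"]) auto
qed

lemma h1_bounded_load:
  assumes "f \<in> L2 \<Omega>"
  shows "h1_bounded (load \<Omega> f) (l2.nrm M f)"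
  unfolding h1_bounded_def
  by (rule bexI[of _ f], rule bexI[of _ 0], rule bexI[of _ 0])
    (use assms in \<open>auto simp: L2_eq_l2 h1_form_def load_def\<close>)

lemma h1_bounded_Gamma:
  assumes p: "(\<lambda>x. laplace \<Omega> \<eta> x * D [2] \<zeta> x) \<in> l2 M" "(\<lambda>x. laplace \<Omega> \<eta> x * D [1] \<zeta> x) \<in> l2 M"
    and b: "l2.nrm M (\<lambda>x. laplace \<Omega> \<eta> x * D [2] \<zeta> x) + l2.nrm M (\<lambda>x. laplace \<Omega> \<eta> x * D [1] \<zeta> x) \<le> C"
  shows "h1_bounded (form_Gamma \<Omega> \<eta> \<zeta>) C"
proof -
  let ?w = "\<lambda>x. - (laplace \<Omega> \<eta> x * D [1] \<zeta> x)"
  have w: "?w = (-1) *\<^sub>R (\<lambda>x. laplace \<Omega> \<eta> x * D [1] \<zeta> x)" by (simp add: fun_eq_iff)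
  have wl: "?w \<in> l2 M" unfolding w using p(2) by (rule l2.V_scale)
  have "l2.nrm M ?w = l2.nrm M (\<lambda>x. laplace \<Omega> \<eta> x * D [1] \<zeta> x)" unfolding w l2.nrm_scale[OF p(2)] by simp
  moreover have "(\<lambda>x. 0) = (0 :: sfun)" by (simp add: zero_fun_def)
  ultimately show ?thesis
    unfolding h1_bounded_def using Gamma_h1_form[OF p sobolev0D] wl p(1) b
    by (intro bexI[where x = 0] bexI[where x = "\<lambda>x. laplace \<Omega> \<eta> x * D [2] \<zeta> x"] bexI[where x = ?w]) auto
qed

lemma TF_laplace_bounded:
  assumes "\<psi> \<in> TF"
  shows "\<exists>C\<ge>0. (AE x in M. \<bar>laplace \<Omega> \<psi> x\<bar> \<le> C) \<and> (\<forall>i. AE x in M. \<bar>D [i] \<psi> x\<bar> \<le> C)"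
proof -
  have "\<exists>C\<ge>0. \<forall>x. \<bar>pdiffs is \<psi> x\<bar> \<le> C" for "is"
    using TF_bounded[OF test_functions_pdiffs[OF assms]] by metis
  then obtain C where C: "\<And>is. C is \<ge> 0" "\<And>is x. \<bar>pdiffs is \<psi> x\<bar> \<le> C is" by metis
  define B where "B = C [1, 1] + C [2, 2] + C [1] + C [2]"
  have nn: "0 \<le> C [1, 1]" "0 \<le> C [2, 2]" "0 \<le> C [1]" "0 \<le> C [2]" using C(1) by auto
  have "AE x in M. \<bar>laplace \<Omega> \<psi> x\<bar> \<le> B"
    using TF_weak_deriv[OF assms, of "[1, 1]"] TF_weak_deriv[OF assms, of "[2, 2]"]
  proof eventually_elim
    fix x assume "D [1, 1] \<psi> x = pdiffs (rev [1, 1]) \<psi> x" "D [2, 2] \<psi> x = pdiffs (rev [2, 2]) \<psi> x"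
    then show "\<bar>laplace \<Omega> \<psi> x\<bar> \<le> B"
      using C(2)[of "[1, 1]" x] C(2)[of "[2, 2]" x] nn unfolding laplace_def B_def by simp
  qed
  moreover have "AE x in M. \<bar>D [i] \<psi> x\<bar> \<le> B" for i
    using TF_weak_deriv[OF assms, of "[i]"]
  proof eventually_elim
    fix x assume "D [i] \<psi> x = pdiffs (rev [i]) \<psi> x"
    then show "\<bar>D [i] \<psi> x\<bar> \<le> B"
      using C(2)[of "[i]" x] nn exhaust_2[of i] unfolding B_def by auto
  qed
  moreover have "B \<ge> 0" using nn by (simp add: B_def)
  ultimately show ?thesis by blast
qed

end

context bounded_domain
begin

text \<open>Each product contains a bounded factor from \<psi> and a square-integrable one from
  \<theta>: first a bounded Laplacian times a gradient in L^2, then a Laplacian in L^2 times a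
  bounded gradient.\<close>

lemma TF_Gamma_h1_bounded:
  assumes \<psi>: "\<psi> \<in> TF"
  shows "\<exists>C\<ge>0. \<forall>\<theta>\<in>V \<Omega>. h1_bounded (form_Gamma \<Omega> \<psi> \<theta>) (C * energy_norm \<Omega> \<theta>) \<and> h1_bounded (form_Gamma \<Omega> \<theta> \<psi>) (C * energy_norm \<Omega> \<theta>)"
proof -
  obtain C where C: "C \<ge> 0" "AE x in M. \<bar>laplace \<Omega> \<psi> x\<bar> \<le> C" "\<And>i. AE x in M. \<bar>D [i] \<psi> x\<bar> \<le> C"
    using TF_laplace_bounded[OF \<psi>] by blast
  have \<psi>s: "\<psi> \<in> sobolev \<Omega> 2" by (rule TF_sobolev[OF \<psi>])
  have m: "laplace \<Omega> \<psi> \<in> borel_measurable M" "D [i] \<psi> \<in> borel_measurable M" for i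
    using l2D(1)[OF laplace_l2[OF \<psi>s]] l2D(1)[OF D_l2[OF \<psi>s, of "[i]"]] by simp_all
  \<comment> \<open>Dominates both cases: two gradient components of size C sqrt P each, or two
    products with the Laplacian of size C each.\<close>
  define B where "B = 2 * C * (1 + sqrt P)"
  have B: "B \<ge> 0" "2 * (C * sqrt P) \<le> B" "2 * C \<le> B" using C(1) P_pos by (auto simp: B_def algebra_simps)
  have "h1_bounded (form_Gamma \<Omega> \<psi> \<theta>) (B * energy_norm \<Omega> \<theta>) \<and> h1_bounded (form_Gamma \<Omega> \<theta> \<psi>) (B * energy_norm \<Omega> \<theta>)" if \<theta>: "\<theta> \<in> V \<Omega>" for \<theta>
  proof
    have \<theta>s: "\<theta> \<in> sobolev \<Omega> 2" by (rule sobolev0D[OF \<theta>])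
    have Dl: "D [i] \<theta> \<in> l2 M" for i using \<theta>s by (auto intro: D_l2)
    have Dn: "l2.nrm M (D [i] \<theta>) \<le> sqrt P * energy_norm \<Omega> \<theta>" for i
    proof -
      have "l2.nrm M (D [i] \<theta>) = sqrt (dn [i] \<theta>)" by (simp add: l2.nrm_def dn_def power2_eq_square)
      also have "\<dots> \<le> sqrt (P * (energy_norm \<Omega> \<theta>)\<^sup>2)" by (intro real_sqrt_le_mono dn1_le \<theta>)
      finally show ?thesis by (simp add: real_sqrt_mult)
    qed
    have eq: "(\<lambda>x. laplace \<Omega> \<psi> x * D [i] \<theta> x) = (\<lambda>x. D [i] \<theta> x * laplace \<Omega> \<psi> x)" for i by (simp add: mult.commute)
    note b1 = l2_bounded_mult[OF Dl m(1) C(2,1), folded eq]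
    have n1: "l2.nrm M (\<lambda>x. laplace \<Omega> \<psi> x * D [i] \<theta> x) \<le> C * sqrt P * energy_norm \<Omega> \<theta>" for i
      using b1(2)[of i] mult_left_mono[OF Dn[of i] C(1)] by (simp add: mult.assoc)
    have "2 * (C * sqrt P) * energy_norm \<Omega> \<theta> \<le> B * energy_norm \<Omega> \<theta>" using B by (intro mult_right_mono) auto
    then show "h1_bounded (form_Gamma \<Omega> \<psi> \<theta>) (B * energy_norm \<Omega> \<theta>)"
      using n1[of 1] n1[of 2] by (intro h1_bounded_Gamma b1) simp
    note b2 = l2_bounded_mult[OF laplace_l2[OF \<theta>s] m(2) C(3,1)]
    have "2 * C * energy_norm \<Omega> \<theta> \<le> B * energy_norm \<Omega> \<theta>" using B by (intro mult_right_mono) auto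
    then show "h1_bounded (form_Gamma \<Omega> \<theta> \<psi>) (B * energy_norm \<Omega> \<theta>)"
      using b2(2)[of 1] b2(2)[of 2] by (intro h1_bounded_Gamma b2) (simp add: laplace_nrm \<theta>)
  qed
  then show ?thesis using B(1) by blast
qed

lemma TF_dense:
  assumes "u \<in> V \<Omega>" "e > 0"
  shows "\<exists>\<psi>\<in>TF. energy_norm \<Omega> (u - \<psi>) < e"
proof -
  obtain \<psi> where \<psi>: "\<psi> \<in> TF" "sobolev_norm \<Omega> 2 (\<lambda>x. u x - \<psi> x) < e"
    using assms by (auto simp: sobolev0_def)
  have "(energy_norm \<Omega> (u - \<psi>))\<^sup>2 \<le> (sobolev_norm \<Omega> 2 (\<lambda>x. u x - \<psi> x))\<^sup>2"
    unfolding norm2_sq diff_eq by simp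
  then have "energy_norm \<Omega> (u - \<psi>) \<le> sobolev_norm \<Omega> 2 (\<lambda>x. u x - \<psi> x)" by (rule power2_le_imp_le) simp
  then show ?thesis using \<psi> by (intro bexI[of _ \<psi>]) auto
qed

end

section \<open>Finite element spaces\<close>

locale fe_family = bounded_domain +
  fixes s :: real and TT :: "plane set set set" and VC :: "plane set set \<Rightarrow> sfun set"
  assumes s: "1 / 2 < s" "s \<le> 1"
    and elliptic: "elliptic_regularity \<Omega> s"
    and triang: "\<And>\<T>. \<T> \<in> TT \<Longrightarrow> regular_triangulation \<Omega> \<T>"
    and conforming: "conforming_fe_family \<Omega> TT VC"
    and approximation: "approximation_property \<Omega> s TT VC"
    and nonempty: "\<Omega> \<noteq> {}"
begin

lemma VC:
  assumes "\<T> \<in> TT"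
  shows "subspace (VC \<T>)" "VC \<T> \<subseteq> V \<Omega>" "v \<in> VC \<T> \<Longrightarrow> continuous_on (closure \<Omega>) v" "v \<in> VC \<T> \<Longrightarrow> x \<notin> closure \<Omega> \<Longrightarrow> v x = 0"
proof -
  have c: "fun_subspace (VC \<T>) \<and> VC \<T> \<subseteq> C1_closure \<Omega> \<inter> V \<Omega> \<and> (\<forall>v\<in>VC \<T>. \<forall>x. x \<notin> closure \<Omega> \<longrightarrow> v x = 0)"
    using conforming assms unfolding conforming_fe_family_def by blast
  then have fs: "fun_subspace (VC \<T>)" by blast
  show "subspace (VC \<T>)"
    unfolding subspace_def
  proof (intro conjI ballI allI)
    show "0 \<in> VC \<T>" using fs by (simp add: fun_subspace_def zero_fun_def)
    have l: "(\<lambda>x. a * v x + b * w x) \<in> VC \<T>" if "v \<in> VC \<T>" "w \<in> VC \<T>" for v w a b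
      using fs that by (simp add: fun_subspace_def)
    show "v + w \<in> VC \<T>" if "v \<in> VC \<T>" "w \<in> VC \<T>" for v w using l[OF that, of 1 1] by (simp add: plus_fun_def)
    show "c *\<^sub>R v \<in> VC \<T>" if "v \<in> VC \<T>" for c v using l[OF that that, of c 0] by (simp add: scaleR_fun_def)
  qed
  show "VC \<T> \<subseteq> V \<Omega>" "v \<in> VC \<T> \<Longrightarrow> continuous_on (closure \<Omega>) v" "v \<in> VC \<T> \<Longrightarrow> x \<notin> closure \<Omega> \<Longrightarrow> v x = 0"
    using c by (auto simp: C1_closure_def)
qed

text \<open>A discrete function is determined by its shape function coefficients on the finitely
  many triangles. Extending each local shape function by zero gives a finite spanning set, whose
  size may depend on the mesh.\<close>

lemma VC_finite_dim:
  assumes T: "\<T> \<in> TT"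
  shows "\<exists>S. finite S \<and> VC \<T> \<subseteq> span S"
proof -
  from conforming[unfolded conforming_fe_family_def]
  obtain n :: nat and Q where nQ: "(\<forall>K. \<exists>b. Q K = {(\<lambda>x. \<Sum>i<n. c i * b i x) | c. True}) \<and>
      (\<forall>\<T>\<in>TT. fun_subspace (VC \<T>) \<and> VC \<T> \<subseteq> C1_closure \<Omega> \<inter> V \<Omega> \<and>
           (\<forall>v\<in>VC \<T>. (\<forall>x. x \<notin> closure \<Omega> \<longrightarrow> v x = 0) \<and> (\<forall>K\<in>\<T>. \<exists>p\<in>Q K. \<forall>x\<in>K. v x = p x)))"
    by (elim exE) (rule that)
  have Q: "\<forall>v\<in>VC \<T>. \<forall>K\<in>\<T>. \<exists>p\<in>Q K. \<forall>x\<in>K. v x = p x" using bspec[OF conjunct2[OF nQ] T] by simp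
  from choice[OF conjunct1[OF nQ]] obtain b where b: "\<forall>K. Q K = {(\<lambda>x. \<Sum>i<n. c i * b K i x) | c. True}" ..
  have fin: "finite \<T>" and cover: "\<Union>\<T> = closure \<Omega>"
    using triang[OF T] by (auto simp: regular_triangulation_def triangulation_def)
  \<comment> \<open>Triangles overlap along edges, so each point is assigned to a single one;
    otherwise its values would be counted repeatedly in the sum.\<close>
  define pick where "pick x = (SOME K. K \<in> \<T> \<and> x \<in> K)" for x
  have pick: "pick x \<in> \<T>" "x \<in> pick x" if "x \<in> closure \<Omega>" for x
  proof -
    have "\<exists>K. K \<in> \<T> \<and> x \<in> K" using that cover by blast
    then have "pick x \<in> \<T> \<and> x \<in> pick x" unfolding pick_def by (rule someI_ex)
    then show "pick x \<in> \<T>" "x \<in> pick x" by auto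
  qed
  define g where "g K i x = (if x \<in> closure \<Omega> \<and> pick x = K then b K i x else 0)" for K i x
  define S where "S = (\<lambda>(K, i). g K i) ` (\<T> \<times> {..<n})"
  have "v \<in> span S" if v: "v \<in> VC \<T>" for v
  proof -
    have "\<forall>K. \<exists>c. K \<in> \<T> \<longrightarrow> (\<forall>x\<in>K. v x = (\<Sum>i<n. c i * b K i x))"
    proof
      fix K
      show "\<exists>c. K \<in> \<T> \<longrightarrow> (\<forall>x\<in>K. v x = (\<Sum>i<n. c i * b K i x))"
      proof (cases "K \<in> \<T>")
        case True
        then obtain p where p: "p \<in> Q K" "\<forall>x\<in>K. v x = p x" using bspec[OF Q v] by auto
        from p(1) obtain c where "p = (\<lambda>x. \<Sum>i<n. c i * b K i x)" unfolding spec[OF b, of K] by auto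
        then show ?thesis using p(2) by (intro exI[of _ c]) simp
      qed simp
    qed
    from choice[OF this] obtain c where c': "\<forall>K. K \<in> \<T> \<longrightarrow> (\<forall>x\<in>K. v x = (\<Sum>i<n. c K i * b K i x))" ..
    have c: "v x = (\<Sum>i<n. c K i * b K i x)" if "K \<in> \<T>" "x \<in> K" for K x using c' that by simp
    have "v = (\<Sum>K\<in>\<T>. \<Sum>i<n. c K i *\<^sub>R g K i)"
    proof
      fix x
      have "(\<Sum>K\<in>\<T>. \<Sum>i<n. c K i *\<^sub>R g K i) x = (\<Sum>K\<in>\<T>. \<Sum>i<n. c K i * g K i x)" by (simp add: sum_fun_apply)
      also have "\<dots> = v x"
      proof (cases "x \<in> closure \<Omega>")
        case True
        have "(\<Sum>K\<in>\<T>. \<Sum>i<n. c K i * g K i x) = (\<Sum>K\<in>\<T>. if K = pick x then (\<Sum>i<n. c K i * b K i x) else 0)"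
          using True by (intro sum.cong) (auto simp: g_def)
        also have "\<dots> = (\<Sum>i<n. c (pick x) i * b (pick x) i x)" using fin pick(1)[OF True] by simp
        also have "\<dots> = v x" using c[OF pick[OF True]] by simp
        finally show ?thesis .
      next
        case False
        then show ?thesis using VC(4)[OF T v] by (simp add: g_def)
      qed
      finally show "v x = (\<Sum>K\<in>\<T>. \<Sum>i<n. c K i *\<^sub>R g K i) x" by simp
    qed
    also have "\<dots> \<in> span S" by (intro span_sum span_scale span_base) (auto simp: S_def)
    finally show ?thesis .
  qed
  moreover have "finite S" unfolding S_def using fin by blast
  ultimately show ?thesis by blast
qed

text \<open>A continuous function that is zero almost everywhere in an open set vanishes on its
  closure, and outside the closure discrete functions are zero by convention.\<close>

lemma VC_definite:
  assumes T: "\<T> \<in> TT" and w: "w \<in> VC \<T>" and z: "energy_norm \<Omega> w = 0"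
  shows "w = 0"
proof
  fix x
  have "AE x in M. w x = 0" using AE_zero_if_energy_zero[OF subsetD[OF VC(2)[OF T] w] z] .
  then have ae0: "AE x in lebesgue. x \<in> \<Omega> \<longrightarrow> w x = 0" by (subst (asm) AE_restrict_space_iff) auto
  define N where "N = {x \<in> closure \<Omega>. w x = 0}"
  from ae0 have ae: "AE x\<in>\<Omega> in lebesgue. x \<in> N"
    by (rule eventually_mono) (use closure_subset[of \<Omega>] in \<open>auto simp: N_def\<close>)
  have N: "closed N"
    unfolding N_def using continuous_closed_preimage_constant[OF VC(3)[OF T w] closed_closure] by (simp add: Collect_conj_eq[symmetric])
  have "\<Omega> \<subseteq> N" using mem_closed_if_AE_lebesgue_open[OF open_\<Omega> N ae] by blast
  then have "closure \<Omega> \<subseteq> N" using N by (rule closure_minimal)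
  then show "w x = 0 x" using VC(4)[OF T w, of x] by (cases "x \<in> closure \<Omega>") (auto simp: N_def)
qed

text \<open>\<Omega> is nonempty, so some triangle exists and \<open>Max\<close> ranges over a
  nonempty set. Monotonicity of \<open>powr\<close> needs a nonnegative mesh size.\<close>

lemma hmax_nonneg:
  assumes T: "\<T> \<in> TT"
  shows "0 \<le> hmax \<T>"
proof -
  have fin: "finite \<T>" and cover: "\<Union>\<T> = closure \<Omega>" and simp2: "\<forall>K\<in>\<T>. 2 simplex K"
    using triang[OF T] by (auto simp: regular_triangulation_def triangulation_def)
  obtain K where K: "K \<in> \<T>" using nonempty cover closure_subset[of \<Omega>] by blast
  have "bounded K" using simp2 K polytope_imp_bounded simplex_imp_polytope by blast
  then have "0 \<le> diameter K" by (rule diameter_ge_0)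
  also have "\<dots> \<le> hmax \<T>" unfolding hmax_def using fin K by (intro Max_ge) auto
  finally show ?thesis .
qed

lemma best_approx_less:
  assumes "\<T> \<in> TT" "best_approx \<Omega> (VC \<T>) z < e"
  shows "\<exists>v\<in>VC \<T>. energy_norm \<Omega> (z - v) < e"
proof -
  have "VC \<T> \<noteq> {}" using subspace_0[OF VC(1)[OF assms(1)]] by auto
  then show ?thesis using assms(2) cInf_lessD[of "(\<lambda>v. energy_norm \<Omega> (\<lambda>x. z x - v x)) ` VC \<T>" e]
    unfolding best_approx_def by (auto simp: diff_eq)
qed

text \<open>Elliptic regularity turns \<open>H\<^sup>-\<^sup>1\<close> data into a rate of approximation.\<close>

lemma h1_bounded_approx:
  "\<exists>C>0. \<forall>\<T>\<in>TT. \<forall>z\<in>V \<Omega>. \<forall>l B. h1_bounded l B \<longrightarrow> (\<forall>\<phi>\<in>V \<Omega>. form_a \<Omega> z \<phi> = l \<phi>) \<longrightarrow>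
     best_approx \<Omega> (VC \<T>) z \<le> C * hmax \<T> powr s * B"
proof -
  obtain Ce where Ce: "Ce > 0" "\<And>z l. z \<in> V \<Omega> \<Longrightarrow> l \<in> Hminus1 \<Omega> \<Longrightarrow> (\<And>\<phi>. \<phi> \<in> V \<Omega> \<Longrightarrow> form_a \<Omega> z \<phi> = l \<phi>) \<Longrightarrow>
      z \<in> sobolev_frac \<Omega> 2 s \<and> sobolev_frac_norm \<Omega> 2 s z \<le> Ce * Hminus1_norm \<Omega> l"
    using elliptic unfolding elliptic_regularity_def by blast
  obtain Ca where Ca: "Ca > 0" "\<And>\<T> z. \<T> \<in> TT \<Longrightarrow> z \<in> V \<Omega> \<Longrightarrow> z \<in> sobolev_frac \<Omega> 2 s \<Longrightarrow>
      best_approx \<Omega> (VC \<T>) z \<le> Ca * hmax \<T> powr s * sobolev_frac_norm \<Omega> 2 s z"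
    using approximation unfolding approximation_property_def by blast
  show ?thesis
  proof (intro exI[of _ "Ca * Ce"] conjI ballI allI impI)
    show "Ca * Ce > 0" using Ca Ce by simp
    fix \<T> z l B assume T: "\<T> \<in> TT" and z: "z \<in> V \<Omega>" and l: "h1_bounded l B" and eq: "\<forall>\<phi>\<in>V \<Omega>. form_a \<Omega> z \<phi> = l \<phi>"
    obtain w0 w1 w2 where w: "w0 \<in> l2 M" "w1 \<in> l2 M" "w2 \<in> l2 M" "\<And>\<phi>. \<phi> \<in> V \<Omega> \<Longrightarrow> l \<phi> = h1_form w0 w1 w2 \<phi>"
      "l2.nrm M w0 + l2.nrm M w1 + l2.nrm M w2 \<le> B" using l unfolding h1_bounded_def by blast
    have z': "z \<in> sobolev_frac \<Omega> 2 s" "sobolev_frac_norm \<Omega> 2 s z \<le> Ce * Hminus1_norm \<Omega> (h1_form w0 w1 w2)"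
      using Ce(2)[OF z h1_form_Hminus1(1)[OF w(1-3)]] eq w(4) by auto
    have "sobolev_frac_norm \<Omega> 2 s z \<le> Ce * B"
      by (rule order_trans[OF z'(2) mult_left_mono[OF order_trans[OF h1_form_Hminus1(2)[OF w(1-3)] w(5)]]]) (use Ce(1) in simp)
    then have "Ca * hmax \<T> powr s * sobolev_frac_norm \<Omega> 2 s z \<le> Ca * hmax \<T> powr s * (Ce * B)"
      using Ca(1) by (intro mult_left_mono) auto
    then show "best_approx \<Omega> (VC \<T>) z \<le> Ca * Ce * hmax \<T> powr s * B"
      using Ca(2)[OF T z z'(1)] by (simp add: mult_ac)
  qed
qed

lemma powr_small:
  assumes "C \<ge> 0" "e > 0"
  shows "\<exists>\<delta>>0. \<forall>h. 0 \<le> h \<longrightarrow> h \<le> \<delta> \<longrightarrow> C * h powr s < e"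
proof (intro exI conjI allI impI)
  \<comment> \<open>Chosen so that the s-th power of \<open>?\<delta>\<close> is e / (2 (C + 1));
    \<open>C + 1\<close> also covers \<open>C\<close> = 0.\<close>
  let ?\<delta> = "(e / (2 * (C + 1))) powr (1 / s)"
  show "?\<delta> > 0" using assms by simp
  fix h assume h: "0 \<le> h" "h \<le> ?\<delta>"
  have "h powr s \<le> ?\<delta> powr s" using h s by (intro powr_mono2) auto
  also have "\<dots> = e / (2 * (C + 1))" unfolding powr_powr using s assms by simp
  finally have "C * h powr s \<le> C * (e / (2 * (C + 1)))" using assms by (intro mult_left_mono) auto
  also have "\<dots> < e" using assms by (simp add: field_simps add_nonneg_pos)
  finally show "C * h powr s < e" .
qed

end

section \<open>Discrete stability\<close>

lemma (in semi_hilbert) riesz_bound: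
  assumes l: "linear_form V l" and bd: "\<And>x. x \<in> V \<Longrightarrow> \<bar>l x\<bar> \<le> C * nrm x" and C: "C \<ge> 0"
  shows "\<exists>z\<in>V. (\<forall>x\<in>V. ip z x = l x) \<and> nrm z \<le> C"
proof -
  obtain z where z: "z \<in> V" "\<And>x. x \<in> V \<Longrightarrow> ip z x = l x" using riesz[OF l bd] by blast
  have "nrm z * nrm z \<le> C * nrm z"
    using bd[OF z(1)] z(2)[OF z(1)] nrm_sq[OF z(1)] by (simp add: power2_eq_square)
  then have "nrm z \<le> C" using C nrm_nonneg[OF z(1)] by (cases "nrm z = 0") auto
  then show ?thesis using z by blast
qed

locale ns_problem = fe_family +
  fixes f u :: sfun
  assumes f: "f \<in> L2 \<Omega>" and regular: "regular_solution \<Omega> f u"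
begin

definition G :: real where "G = 4 * sqrt P"
abbreviation "\<Gamma> \<equiv> form_Gamma \<Omega>"

sublocale ns: ns_form "V \<Omega>" "form_a \<Omega>" \<Gamma> "load \<Omega> f" G
  by (rule ns_form_V[OF f, folded G_def])

lemma nrm_eq: "v \<in> V \<Omega> \<Longrightarrow> ns.nrm v = energy_norm \<Omega> v"
  using energy_norm_sqrt by (simp add: ns.nrm_def)

lemma NS_eq: "NS \<Omega> f = ns.N"
  by (simp add: fun_eq_iff NS_def ns.N_def)

lemma DNS_eq: "DNS \<Omega> = ns.DN"
  by (simp add: fun_eq_iff DNS_def ns.DN_def)

lemma uV: "u \<in> V \<Omega>" and u_sol: "v \<in> V \<Omega> \<Longrightarrow> ns.N u v = 0"
  and u_bij: "bijective_op \<Omega> (V \<Omega>) (ns.DN u)"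
  using regular by (auto simp: regular_solution_def NS_eq DNS_eq)

lemma G_nonneg: "0 \<le> G"
  using P_pos by (simp add: G_def)

lemma bounded_functional_linear: "l \<in> bounded_functionals n W \<Longrightarrow> linear_form W l"
  by (auto simp: bounded_functionals_def linear_form_def lin_comb_eq)

text \<open>Every \<open>form_a \<Omega> r\<close> is a bounded functional, so bijectivity solves
  the equation for each Riesz representative \<open>r\<close>, and uniqueness almost everywhere
  becomes a vanishing seminorm. These are the hypotheses of \<open>bounded_inverse\<close>.\<close>

lemma derivative_bounded_below:
  "\<exists>\<beta>>0. \<forall>x\<in>V \<Omega>. \<forall>c\<ge>0. (\<forall>\<phi>\<in>V \<Omega>. \<bar>ns.DN u x \<phi>\<bar> \<le> c * ns.nrm \<phi>) \<longrightarrow> \<beta> * ns.nrm x \<le> c"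
proof (rule ns.bounded_inverse)
  fix r assume r: "r \<in> V \<Omega>"
  have "\<forall>v\<in>V \<Omega>. \<bar>form_a \<Omega> r v\<bar> \<le> ns.nrm r * energy_norm \<Omega> v"
    using ns.cauchy_schwarz[OF r] nrm_eq by simp
  moreover have "linear_form (V \<Omega>) (form_a \<Omega> r)" by (rule ns.linear_form_ip[OF r order_refl])
  ultimately have "form_a \<Omega> r \<in> bounded_functionals (energy_norm \<Omega>) (V \<Omega>)"
    unfolding bounded_functionals_def linear_form_def lin_comb_eq by blast
  then show "\<exists>\<theta>\<in>V \<Omega>. \<forall>\<phi>\<in>V \<Omega>. ns.DN u \<theta> \<phi> = form_a \<Omega> r \<phi>"
    using u_bij unfolding bijective_op_def by blast
next
  show "linear_form (V \<Omega>) (ns.DN u \<theta>)" "linear_form (V \<Omega>) (\<lambda>x. ns.DN u x \<theta>)" if "\<theta> \<in> V \<Omega>" for \<theta>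
    by (rule ns.linear_form_DN[OF uV that])+
  show "\<bar>ns.DN u \<theta> \<phi>\<bar> \<le> (1 + 2 * G * ns.nrm u) * ns.nrm \<theta> * ns.nrm \<phi>" if "\<theta> \<in> V \<Omega>" "\<phi> \<in> V \<Omega>" for \<theta> \<phi>
    by (rule ns.DN_bound[OF uV that])
  fix \<theta> assume \<theta>: "\<theta> \<in> V \<Omega>" "\<And>\<phi>. \<phi> \<in> V \<Omega> \<Longrightarrow> ns.DN u \<theta> \<phi> = 0"
  have "ns.DN u 0 \<phi> = 0" if "\<phi> \<in> V \<Omega>" for \<phi>
    using linear_form_simps(4)[OF ns.linear_form_DN(2)[OF uV that] ns.subspace_V that that] .
  then have "ae_eq \<Omega> \<theta> 0" using u_bij \<theta> ns.V_zero unfolding bijective_op_def by metis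
  then show "ns.nrm \<theta> = 0" using ae_eq_iff_energy[OF \<theta>(1) ns.V_zero] \<theta>(1) by (simp add: nrm_eq)
qed

lemma fine_meshesD:
  assumes "\<T> \<in> fine_meshes TT \<delta>"
  shows "\<T> \<in> TT" "0 \<le> hmax \<T>" "hmax \<T> \<le> \<delta>"
  using assms hmax_nonneg by (auto simp: fine_meshes_def)

text \<open>For \<eta> = u the representative \<open>z\<close> is T \<theta>. A general \<eta> is
  allowed so that u can be split into a test function \<psi> and the small rest u - \<psi>.\<close>

lemma perturbation_riesz:
  assumes "\<eta> \<in> V \<Omega>" "\<theta> \<in> V \<Omega>"
  shows "\<exists>z\<in>V \<Omega>. (\<forall>\<phi>\<in>V \<Omega>. form_a \<Omega> z \<phi> = \<Gamma> \<eta> \<theta> \<phi> + \<Gamma> \<theta> \<eta> \<phi>) \<and> ns.nrm z \<le> 2 * G * ns.nrm \<eta> * ns.nrm \<theta>"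
proof (rule ns.riesz_bound)
  show "linear_form (V \<Omega>) (\<lambda>\<phi>. \<Gamma> \<eta> \<theta> \<phi> + \<Gamma> \<theta> \<eta> \<phi>)"
    using ns.\<Gamma>_lin(3)[OF assms] ns.\<Gamma>_lin(3)[OF assms(2,1)] by (simp add: linear_form_def algebra_simps)
  show "0 \<le> 2 * G * ns.nrm \<eta> * ns.nrm \<theta>" using G_nonneg assms by simp
  fix \<phi> assume \<phi>: "\<phi> \<in> V \<Omega>"
  have "\<bar>\<Gamma> \<eta> \<theta> \<phi> + \<Gamma> \<theta> \<eta> \<phi>\<bar> \<le> G * ns.nrm \<eta> * ns.nrm \<theta> * ns.nrm \<phi> + G * ns.nrm \<theta> * ns.nrm \<eta> * ns.nrm \<phi>"
    using ns.\<Gamma>_bound[OF assms \<phi>] ns.\<Gamma>_bound[OF assms(2,1) \<phi>] by linarith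
  then show "\<bar>\<Gamma> \<eta> \<theta> \<phi> + \<Gamma> \<theta> \<eta> \<phi>\<bar> \<le> 2 * G * ns.nrm \<eta> * ns.nrm \<theta> * ns.nrm \<phi>"
    by (simp add: mult_ac)
qed

lemma TF_V: "\<psi> \<in> TF \<Longrightarrow> \<psi> \<in> V \<Omega>"
  by (rule TF_sobolev0)

text \<open>For a test function \<open>\<psi>\<close> in place of \<open>u\<close> the perturbation lies in \<open>H\<^sup>-\<^sup>1\<close>, so its Riesz representative
  is approximated uniformly; the remainder is controlled by the distance from \<open>u\<close> to \<open>\<psi>\<close>.\<close>

lemma perturbation_approx:
  assumes \<epsilon>: "\<epsilon> > 0"
  shows "\<exists>\<delta>>0. \<forall>\<T>\<in>fine_meshes TT \<delta>. \<forall>\<theta>\<in>V \<Omega>. 0 < ns.nrm \<theta> \<longrightarrow>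
     (\<exists>z\<in>V \<Omega>. (\<forall>\<phi>\<in>V \<Omega>. form_a \<Omega> z \<phi> = \<Gamma> u \<theta> \<phi> + \<Gamma> \<theta> u \<phi>) \<and> (\<exists>v\<in>VC \<T>. ns.nrm (z - v) \<le> \<epsilon> * ns.nrm \<theta>))"
proof -
  \<comment> \<open>With this tolerance the part of T \<theta> that belongs to u - \<psi> has norm
    at most \<epsilon>/2 times that of \<theta>; the other half is left for the approximation on the
    mesh.\<close>
  have "0 < \<epsilon> / (4 * (G + 1))" using \<epsilon> G_nonneg by (intro divide_pos_pos mult_pos_pos add_nonneg_pos) auto
  then obtain \<psi> where \<psi>: "\<psi> \<in> TF" "energy_norm \<Omega> (u - \<psi>) < \<epsilon> / (4 * (G + 1))"
    using TF_dense[OF uV] by blast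
  note \<psi>V = TF_V[OF \<psi>(1)] and u\<psi>V = ns.V_diff[OF uV TF_V[OF \<psi>(1)]]
  obtain B where B: "B \<ge> 0" "\<forall>\<theta>\<in>V \<Omega>. h1_bounded (\<Gamma> \<psi> \<theta>) (B * energy_norm \<Omega> \<theta>) \<and> h1_bounded (\<Gamma> \<theta> \<psi>) (B * energy_norm \<Omega> \<theta>)"
    using TF_Gamma_h1_bounded[OF \<psi>(1)] by blast
  obtain C where C: "C > 0" "\<forall>\<T>\<in>TT. \<forall>z\<in>V \<Omega>. \<forall>l B. h1_bounded l B \<longrightarrow> (\<forall>\<phi>\<in>V \<Omega>. form_a \<Omega> z \<phi> = l \<phi>) \<longrightarrow>
     best_approx \<Omega> (VC \<T>) z \<le> C * hmax \<T> powr s * B"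
    using h1_bounded_approx by blast
  have CB: "C * (2 * B) \<ge> 0" "\<epsilon> / 2 > 0" using C(1) B(1) \<epsilon> by auto
  obtain \<delta> where \<delta>: "\<delta> > 0" "\<forall>h. 0 \<le> h \<longrightarrow> h \<le> \<delta> \<longrightarrow> C * (2 * B) * h powr s < \<epsilon> / 2"
    using powr_small[OF CB] by blast
  have "\<exists>z\<in>V \<Omega>. (\<forall>\<phi>\<in>V \<Omega>. form_a \<Omega> z \<phi> = \<Gamma> u \<theta> \<phi> + \<Gamma> \<theta> u \<phi>) \<and> (\<exists>v\<in>VC \<T>. ns.nrm (z - v) \<le> \<epsilon> * ns.nrm \<theta>)"
    if T: "\<T> \<in> fine_meshes TT \<delta>" and \<theta>: "\<theta> \<in> V \<Omega>" "0 < ns.nrm \<theta>" for \<T> \<theta>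
  proof -
    note T = fine_meshesD[OF T]
    obtain z1 where z1: "z1 \<in> V \<Omega>" "\<And>\<phi>. \<phi> \<in> V \<Omega> \<Longrightarrow> form_a \<Omega> z1 \<phi> = \<Gamma> \<psi> \<theta> \<phi> + \<Gamma> \<theta> \<psi> \<phi>"
      using perturbation_riesz[OF \<psi>V \<theta>(1)] by blast
    obtain z2 where z2: "z2 \<in> V \<Omega>" "\<And>\<phi>. \<phi> \<in> V \<Omega> \<Longrightarrow> form_a \<Omega> z2 \<phi> = \<Gamma> (u - \<psi>) \<theta> \<phi> + \<Gamma> \<theta> (u - \<psi>) \<phi>"
      "ns.nrm z2 \<le> 2 * G * ns.nrm (u - \<psi>) * ns.nrm \<theta>"
      using perturbation_riesz[OF u\<psi>V \<theta>(1)] by blast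
    have hb: "h1_bounded (\<lambda>\<phi>. 1 * \<Gamma> \<psi> \<theta> \<phi> + 1 * \<Gamma> \<theta> \<psi> \<phi>) (\<bar>1\<bar> * (B * energy_norm \<Omega> \<theta>) + \<bar>1\<bar> * (B * energy_norm \<Omega> \<theta>))"
      using bspec[OF B(2) \<theta>(1)] by (intro h1_bounded_lin) auto
    have "best_approx \<Omega> (VC \<T>) z1 \<le> C * hmax \<T> powr s * (\<bar>1\<bar> * (B * energy_norm \<Omega> \<theta>) + \<bar>1\<bar> * (B * energy_norm \<Omega> \<theta>))"
      by (rule C(2)[rule_format, OF T(1) z1(1) hb]) (simp add: z1(2))
    also have "\<dots> = C * (2 * B) * hmax \<T> powr s * ns.nrm \<theta>" using \<theta>(1) by (simp add: nrm_eq)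
    \<comment> \<open>Here the positivity of \<open>ns.nrm \<theta>\<close> matters: only a strict
      bound on the infimum \<open>best_approx\<close> produces an actual element of
      \<open>VC \<T>\<close>.\<close>
    also have "\<dots> < \<epsilon> / 2 * ns.nrm \<theta>" using \<delta>(2)[rule_format, OF T(2,3)] \<theta>(2) by (intro mult_strict_right_mono)
    finally obtain v where v: "v \<in> VC \<T>" "energy_norm \<Omega> (z1 - v) < \<epsilon> / 2 * ns.nrm \<theta>"
      using best_approx_less[OF T(1)] by blast
    have vV: "v \<in> V \<Omega>" using v(1) VC(2)[OF T(1)] by blast
    have "2 * G * ns.nrm (u - \<psi>) \<le> 2 * G * (\<epsilon> / (4 * (G + 1)))"
      using \<psi>(2) G_nonneg u\<psi>V by (intro mult_left_mono) (auto simp: nrm_eq)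
    also have "\<dots> \<le> \<epsilon> / 2" using \<epsilon> G_nonneg by (simp add: field_simps)
    finally have "2 * G * ns.nrm (u - \<psi>) * ns.nrm \<theta> \<le> \<epsilon> / 2 * ns.nrm \<theta>"
      using \<theta>(2) by (intro mult_right_mono) auto
    then have "ns.nrm z2 \<le> \<epsilon> / 2 * ns.nrm \<theta>" using z2(3) by linarith
    moreover have "ns.nrm (z1 - v) < \<epsilon> / 2 * ns.nrm \<theta>" using v(2) z1(1) vV by (simp add: nrm_eq)
    moreover have "ns.nrm ((z1 + z2) - v) \<le> ns.nrm (z1 - v) + ns.nrm z2"
      using ns.nrm_triangle[of "z1 - v" z2] z1(1) z2(1) vV by (simp add: algebra_simps)
    ultimately have "ns.nrm ((z1 + z2) - v) \<le> \<epsilon> * ns.nrm \<theta>" by linarith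
    moreover have "form_a \<Omega> (z1 + z2) \<phi> = \<Gamma> u \<theta> \<phi> + \<Gamma> \<theta> u \<phi>" if "\<phi> \<in> V \<Omega>" for \<phi>
      using z1(1,2) z2(1,2) that uV \<psi>V \<theta>(1) by (simp add: ns.ip_simps ns.\<Gamma>_simps)
    ultimately show ?thesis using z1(1) z2(1) v(1) by blast
  qed
  then show ?thesis using \<delta>(1) by blast
qed

text \<open>The data F - \<Gamma>(u, u, .) of u need not be in H^-1. With \<open>y\<close>
  representing \<Gamma>(u - \<psi>, u, .), the sum u + y satisfies a(u + y, .) = F -
  \<Gamma>(\<psi>, u, .), which is in H^-1, and \<open>y\<close> is small when the test function
  \<psi> is close to u.\<close>

lemma solution_approx:
  assumes \<epsilon>: "\<epsilon> > 0"
  shows "\<exists>\<delta>>0. \<forall>\<T>\<in>fine_meshes TT \<delta>. \<exists>w\<in>VC \<T>. ns.nrm (u - w) \<le> \<epsilon>"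
proof -
  have nu: "0 \<le> ns.nrm u" using uV by simp
  \<comment> \<open>This tolerance for \<psi> yields \<open>ns.nrm y\<close> \<le>
    \<epsilon>/2.\<close>
  have "0 < \<epsilon> / (2 * (G * ns.nrm u + 1))" using \<epsilon> G_nonneg nu by (intro divide_pos_pos mult_pos_pos add_nonneg_pos mult_nonneg_nonneg) auto
  then obtain \<psi> where \<psi>: "\<psi> \<in> TF" "energy_norm \<Omega> (u - \<psi>) < \<epsilon> / (2 * (G * ns.nrm u + 1))"
    using TF_dense[OF uV] by blast
  note \<psi>V = TF_V[OF \<psi>(1)] and u\<psi>V = ns.V_diff[OF uV TF_V[OF \<psi>(1)]]
  obtain B where B: "B \<ge> 0" "\<forall>\<theta>\<in>V \<Omega>. h1_bounded (\<Gamma> \<psi> \<theta>) (B * energy_norm \<Omega> \<theta>) \<and> h1_bounded (\<Gamma> \<theta> \<psi>) (B * energy_norm \<Omega> \<theta>)"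
    using TF_Gamma_h1_bounded[OF \<psi>(1)] by blast
  obtain C where C: "C > 0" "\<forall>\<T>\<in>TT. \<forall>z\<in>V \<Omega>. \<forall>l B. h1_bounded l B \<longrightarrow> (\<forall>\<phi>\<in>V \<Omega>. form_a \<Omega> z \<phi> = l \<phi>) \<longrightarrow>
     best_approx \<Omega> (VC \<T>) z \<le> C * hmax \<T> powr s * B"
    using h1_bounded_approx by blast
  have lf: "linear_form (V \<Omega>) (\<Gamma> (u - \<psi>) u)" by (rule ns.\<Gamma>_lin(3)[OF u\<psi>V uV])
  have bd: "\<bar>\<Gamma> (u - \<psi>) u \<phi>\<bar> \<le> (G * ns.nrm (u - \<psi>) * ns.nrm u) * ns.nrm \<phi>" if "\<phi> \<in> V \<Omega>" for \<phi>
    using ns.\<Gamma>_bound[OF u\<psi>V uV that] by simp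
  have nn: "0 \<le> G * ns.nrm (u - \<psi>) * ns.nrm u" using G_nonneg u\<psi>V nu by simp
  from ns.riesz_bound[OF lf bd nn] obtain y where y: "y \<in> V \<Omega>" "\<And>\<phi>. \<phi> \<in> V \<Omega> \<Longrightarrow> form_a \<Omega> y \<phi> = \<Gamma> (u - \<psi>) u \<phi>" "ns.nrm y \<le> G * ns.nrm (u - \<psi>) * ns.nrm u"
    by blast
  have "G * ns.nrm (u - \<psi>) * ns.nrm u = (G * ns.nrm u) * ns.nrm (u - \<psi>)" by simp
  also have "\<dots> \<le> (G * ns.nrm u) * (\<epsilon> / (2 * (G * ns.nrm u + 1)))"
    using \<psi>(2) G_nonneg nu u\<psi>V by (intro mult_left_mono) (auto simp: nrm_eq)
  also have "\<dots> \<le> \<epsilon> / 2"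
  proof -
    have "0 \<le> G * ns.nrm u" using G_nonneg nu by simp
    have "a * (\<epsilon> / (2 * (a + 1))) \<le> \<epsilon> / 2" if "0 \<le> a" for a using that \<epsilon> by (simp add: field_simps)
    from this[OF \<open>0 \<le> G * ns.nrm u\<close>] show ?thesis .
  qed
  finally have y2: "ns.nrm y \<le> \<epsilon> / 2" using y(3) by simp
  define L where "L = \<bar>1\<bar> * l2.nrm M f + \<bar>-1\<bar> * (B * energy_norm \<Omega> u)"
  have hb: "h1_bounded (\<lambda>\<phi>. 1 * load \<Omega> f \<phi> + (-1) * \<Gamma> \<psi> u \<phi>) L"
    unfolding L_def using bspec[OF B(2) uV] h1_bounded_load[OF f] by (intro h1_bounded_lin) auto
  have "f \<in> l2 M" using f by (simp add: L2_eq_l2)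
  then have L0: "0 \<le> L" unfolding L_def using B(1) by simp
  have z: "u + y \<in> V \<Omega>" using uV y(1) by simp
  have eq: "form_a \<Omega> (u + y) \<phi> = 1 * load \<Omega> f \<phi> + (-1) * \<Gamma> \<psi> u \<phi>" if "\<phi> \<in> V \<Omega>" for \<phi>
    using u_sol[OF that] y(1,2) uV \<psi>V that by (simp add: ns.ip_simps ns.\<Gamma>_simps ns.N_def)
  have CL: "C * L \<ge> 0" "\<epsilon> / 2 > 0" using C(1) L0 \<epsilon> by auto
  obtain \<delta> where \<delta>: "\<delta> > 0" "\<forall>h. 0 \<le> h \<longrightarrow> h \<le> \<delta> \<longrightarrow> C * L * h powr s < \<epsilon> / 2"
    using powr_small[OF CL] by blast
  have "\<exists>w\<in>VC \<T>. ns.nrm (u - w) \<le> \<epsilon>" if "\<T> \<in> fine_meshes TT \<delta>" for \<T>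
  proof -
    note T = fine_meshesD[OF that]
    have "best_approx \<Omega> (VC \<T>) (u + y) \<le> C * hmax \<T> powr s * L" by (rule C(2)[rule_format, OF T(1) z hb eq])
    also have "\<dots> < \<epsilon> / 2" using \<delta>(2)[rule_format, OF T(2,3)] by (simp add: mult_ac)
    finally obtain w where w: "w \<in> VC \<T>" "energy_norm \<Omega> (u + y - w) < \<epsilon> / 2"
      using best_approx_less[OF T(1)] by blast
    have wV: "w \<in> V \<Omega>" using w(1) VC(2)[OF T(1)] by blast
    have "ns.nrm (u - w) \<le> ns.nrm (u + y - w) + ns.nrm y"
      using ns.nrm_triangle_diff[of "u + y - w" y] uV y(1) wV by simp
    moreover have "ns.nrm (u + y - w) < \<epsilon> / 2" using w(2) uV y(1) wV by (simp add: nrm_eq)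
    ultimately have "ns.nrm (u - w) \<le> \<epsilon>" using y2 by linarith
    then show ?thesis using w(1) by blast
  qed
  then show ?thesis using \<delta>(1) by blast
qed

text \<open>With z = T \<theta> the derivative at u is the functional a(\<theta> + z, .), and its
  norm, that of \<theta> + z, is at least b times the norm of \<theta>. Using \<theta> + v from
  \<open>VC \<T>\<close> in place of \<theta> + z loses at most 2 e times the norm of \<theta>; the
  choice e = b/4 keeps b/2.\<close>

lemma discrete_infsup:
  "\<exists>\<beta>>0. \<exists>\<delta>>0. \<forall>\<T>\<in>fine_meshes TT \<delta>. \<forall>\<theta>\<in>VC \<T>. \<forall>c\<ge>0.
     (\<forall>\<phi>\<in>VC \<T>. \<bar>ns.DN u \<theta> \<phi>\<bar> \<le> c * ns.nrm \<phi>) \<longrightarrow> \<beta> * ns.nrm \<theta> \<le> c"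
proof -
  obtain b where b: "b > 0" "\<forall>x\<in>V \<Omega>. \<forall>c\<ge>0. (\<forall>\<phi>\<in>V \<Omega>. \<bar>ns.DN u x \<phi>\<bar> \<le> c * ns.nrm \<phi>) \<longrightarrow> b * ns.nrm x \<le> c"
    using derivative_bounded_below by blast
  define e where "e = b / 4"
  have e: "e > 0" using b(1) by (simp add: e_def)
  obtain \<delta> where \<delta>: "\<delta> > 0" "\<forall>\<T>\<in>fine_meshes TT \<delta>. \<forall>\<theta>\<in>V \<Omega>. 0 < ns.nrm \<theta> \<longrightarrow>
     (\<exists>z\<in>V \<Omega>. (\<forall>\<phi>\<in>V \<Omega>. form_a \<Omega> z \<phi> = \<Gamma> u \<theta> \<phi> + \<Gamma> \<theta> u \<phi>) \<and> (\<exists>v\<in>VC \<T>. ns.nrm (z - v) \<le> e * ns.nrm \<theta>))"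
    using perturbation_approx[OF e] by blast
  have "b / 2 * ns.nrm \<theta> \<le> c" if T: "\<T> \<in> fine_meshes TT \<delta>" and \<theta>: "\<theta> \<in> VC \<T>" and c: "c \<ge> 0"
      and bd: "\<And>\<phi>. \<phi> \<in> VC \<T> \<Longrightarrow> \<bar>ns.DN u \<theta> \<phi>\<bar> \<le> c * ns.nrm \<phi>" for \<T> \<theta> c
  proof (cases "0 < ns.nrm \<theta>")
    case True
    note W = VC(1,2)[OF fine_meshesD(1)[OF T]]
    have \<theta>V: "\<theta> \<in> V \<Omega>" using \<theta> W(2) by blast
    obtain z v where z: "z \<in> V \<Omega>" "\<And>\<phi>. \<phi> \<in> V \<Omega> \<Longrightarrow> form_a \<Omega> z \<phi> = \<Gamma> u \<theta> \<phi> + \<Gamma> \<theta> u \<phi>"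
      and v: "v \<in> VC \<T>" "ns.nrm (z - v) \<le> e * ns.nrm \<theta>"
      using \<delta>(2)[rule_format, OF T \<theta>V True] by blast
    have vV: "v \<in> V \<Omega>" using v(1) W(2) by blast
    have wW: "\<theta> + v \<in> VC \<T>" using W(1) \<theta> v(1) by (rule subspace_add)
    have wV: "\<theta> + v \<in> V \<Omega>" using wW W(2) by blast
    have DN: "ns.DN u \<theta> \<phi> = form_a \<Omega> (\<theta> + z) \<phi>" if "\<phi> \<in> V \<Omega>" for \<phi>
      using z \<theta>V that by (simp add: ns.DN_def ns.ip_simps)
    \<comment> \<open>The test function \<theta> + v imitates \<theta> + T \<theta>, so the
      derivative tested with it is nearly its own squared norm.\<close>
    have "(ns.nrm (\<theta> + v))\<^sup>2 = ns.DN u \<theta> (\<theta> + v) - form_a \<Omega> (z - v) (\<theta> + v)"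
      using DN[OF wV] z(1) \<theta>V vV wV by (simp add: ns.nrm_sq ns.ip_simps)
    also have "\<dots> \<le> c * ns.nrm (\<theta> + v) + e * ns.nrm \<theta> * ns.nrm (\<theta> + v)"
    proof -
      have "\<bar>form_a \<Omega> (z - v) (\<theta> + v)\<bar> \<le> ns.nrm (z - v) * ns.nrm (\<theta> + v)"
        using z(1) vV wV by (intro ns.cauchy_schwarz) auto
      also have "\<dots> \<le> e * ns.nrm \<theta> * ns.nrm (\<theta> + v)" using v(2) wV by (intro mult_right_mono) auto
      finally show ?thesis using bd[OF wW] by linarith
    qed
    finally have sq: "ns.nrm (\<theta> + v) * ns.nrm (\<theta> + v) \<le> (c + e * ns.nrm \<theta>) * ns.nrm (\<theta> + v)"
      by (simp add: power2_eq_square distrib_right)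
    have le: "ns.nrm (\<theta> + v) \<le> c + e * ns.nrm \<theta>"
    proof (cases "ns.nrm (\<theta> + v) = 0")
      case True then show ?thesis using c e \<theta>V by simp
    next
      case False
      then have "0 < ns.nrm (\<theta> + v)" using ns.nrm_nonneg[OF wV] by linarith
      then show ?thesis using sq by simp
    qed
    have "ns.nrm (\<theta> + z) \<le> ns.nrm (\<theta> + v) + ns.nrm (z - v)"
      using ns.nrm_triangle[of "\<theta> + v" "z - v"] \<theta>V vV z(1) by simp
    then have tz: "ns.nrm (\<theta> + z) \<le> c + 2 * e * ns.nrm \<theta>" using le v(2) by linarith
    have "b * ns.nrm \<theta> \<le> ns.nrm (\<theta> + z)"
    proof (rule b(2)[rule_format, OF \<theta>V])
      show "0 \<le> ns.nrm (\<theta> + z)" using \<theta>V z(1) by simp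
      show "\<bar>ns.DN u \<theta> \<phi>\<bar> \<le> ns.nrm (\<theta> + z) * ns.nrm \<phi>" if "\<phi> \<in> V \<Omega>" for \<phi>
        unfolding DN[OF that] using \<theta>V z(1) that by (intro ns.cauchy_schwarz) auto
    qed
    then show ?thesis using tz by (simp add: e_def)
  next
    case False
    have "ns.nrm \<theta> \<ge> 0" using \<theta> VC(2)[OF fine_meshesD(1)[OF T]] by auto
    then have "ns.nrm \<theta> = 0" using False by linarith
    then show ?thesis using c by simp
  qed
  then show ?thesis using b(1) \<delta>(1) by (intro exI[of _ "b / 2"] conjI exI[of _ \<delta>] ballI allI impI) auto
qed

lemma dist_eq: "w \<in> V \<Omega> \<Longrightarrow> v \<in> V \<Omega> \<Longrightarrow> energy_norm \<Omega> (\<lambda>x. w x - v x) = ns.nrm (w - v)"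
  using ns.V_diff[of w v] by (simp add: diff_eq nrm_eq)

text \<open>All constants depend only on \<beta>, G and u; the mesh enters through the hypotheses
  alone, so the result is uniform over meshes that share \<beta>. The radius for Newton can be
  \<epsilon> because a start within \<epsilon> of \<open>uC\<close> is within 2 \<epsilon> of
  u.\<close>

lemma mesh_result:
  fixes \<beta> :: real
  defines "\<epsilon> \<equiv> \<beta> / (8 * (G + 1))"
  assumes T: "\<T> \<in> TT" and \<beta>: "\<beta> > 0"
    and infsup: "\<forall>\<theta>\<in>VC \<T>. \<forall>c\<ge>0. (\<forall>\<phi>\<in>VC \<T>. \<bar>ns.DN u \<theta> \<phi>\<bar> \<le> c * ns.nrm \<phi>) \<longrightarrow> \<beta> * ns.nrm \<theta> \<le> c"
    and v0: "v0 \<in> VC \<T>" "ns.nrm (u - v0) \<le> \<epsilon> / 2" "(1 + 2 * G * ns.nrm u) * ns.nrm (u - v0) \<le> \<beta> * \<epsilon> / 4"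
  shows "(\<exists>!uC. discrete_solution \<Omega> f (VC \<T>) uC \<and> energy_norm \<Omega> (\<lambda>x. u x - uC x) \<le> \<epsilon>) \<and>
    (\<forall>uC. discrete_solution \<Omega> f (VC \<T>) uC \<and> energy_norm \<Omega> (\<lambda>x. u x - uC x) \<le> \<epsilon> \<longrightarrow>
       (\<forall>w0\<in>VC \<T>. energy_norm \<Omega> (\<lambda>x. uC x - w0 x) \<le> \<epsilon> \<longrightarrow>
          newton_converges \<Omega> f (VC \<T>) w0 uC) \<and>
       energy_norm \<Omega> (\<lambda>x. u x - uC x) \<le> 2 * (1 + (1 + 2 * G * ns.nrm u) / \<beta>) * best_approx \<Omega> (VC \<T>) u)"
proof -
  let ?W = "VC \<T>"
  obtain S where S: "finite S" "?W \<subseteq> span S" using VC_finite_dim[OF T] by blast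
  note W = VC(1,2)[OF T]
  have WV: "w \<in> V \<Omega>" if "w \<in> ?W" for w using W(2) that by blast
  interpret d: ns_discrete "V \<Omega>" "form_a \<Omega>" \<Gamma> "load \<Omega> f" G ?W S u \<beta>
  proof (intro ns_discrete.intro ns.ns_form_axioms ns_discrete_axioms.intro)
    show "subspace ?W" "?W \<subseteq> V \<Omega>" "?W \<subseteq> span S" "finite S" "u \<in> V \<Omega>" "\<beta> > 0" using W S uV \<beta> by auto
    show "w = 0" if "w \<in> ?W" "ns.nrm w = 0" for w
      using VC_definite[OF T that(1)] that(2) WV[OF that(1)] by (simp add: nrm_eq)
    show "ns.N u v = 0" if "v \<in> V \<Omega>" for v using u_sol[OF that] .
    show "\<beta> * ns.nrm \<theta> \<le> c" if "\<theta> \<in> ?W" "c \<ge> 0" "\<And>\<phi>. \<phi> \<in> ?W \<Longrightarrow> \<bar>ns.DN u \<theta> \<phi>\<bar> \<le> c * ns.nrm \<phi>" for \<theta> c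
      using infsup[rule_format, OF that] .
  qed
  have \<epsilon>: "d.\<epsilon> = \<epsilon>" by (simp add: d.\<epsilon>_def \<epsilon>_def)
  have sol: "discrete_solution \<Omega> f ?W w \<longleftrightarrow> w \<in> ?W \<and> (\<forall>v\<in>?W. ns.N w v = 0)" for w
    by (simp add: discrete_solution_def NS_eq)
  have dist: "energy_norm \<Omega> (\<lambda>x. u x - w x) = ns.nrm (u - w)" if "w \<in> ?W" for w
    using dist_eq[OF uV WV[OF that]] .
  have ex: "\<exists>!uC. discrete_solution \<Omega> f ?W uC \<and> energy_norm \<Omega> (\<lambda>x. u x - uC x) \<le> \<epsilon>"
  proof -
    obtain w where w: "w \<in> ?W" "\<forall>\<phi>\<in>?W. ns.N w \<phi> = 0" "ns.nrm (u - w) \<le> \<epsilon>"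
      using d.discrete_exists[OF v0(1)] v0(2,3) unfolding \<epsilon> by blast
    show ?thesis
    proof (rule ex1I[of _ w])
      show "discrete_solution \<Omega> f ?W w \<and> energy_norm \<Omega> (\<lambda>x. u x - w x) \<le> \<epsilon>" using w by (simp add: sol dist)
      fix v assume v: "discrete_solution \<Omega> f ?W v \<and> energy_norm \<Omega> (\<lambda>x. u x - v x) \<le> \<epsilon>"
      then have v': "v \<in> ?W" "\<forall>\<phi>\<in>?W. ns.N v \<phi> = 0" by (auto simp: sol)
      then have "ns.nrm (u - v) \<le> \<epsilon>" using v by (simp add: dist)
      then show "v = w" using d.discrete_unique[of v w] v' w by (simp add: \<epsilon>)
    qed
  qed
  have newton: "newton_converges \<Omega> f ?W w0 uC"
    if uC: "uC \<in> ?W" "\<forall>v\<in>?W. ns.N uC v = 0" "ns.nrm (u - uC) \<le> \<epsilon>" and w0: "w0 \<in> ?W" "ns.nrm (uC - w0) \<le> \<epsilon>" for uC w0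
  proof -
    have step: "\<exists>\<theta>. \<theta> \<in> ?W \<and> DNS_inv \<Omega> ?W w (NS \<Omega> f w) = \<theta> \<and>
        ns.nrm (uC - (w - \<theta>)) \<le> (2 * G / \<beta>) * (ns.nrm (uC - w))\<^sup>2 \<and> ns.nrm (uC - (w - \<theta>)) \<le> ns.nrm (uC - w) / 4"
      and bij: "bijective_op \<Omega> ?W (DNS \<Omega> w)" if w: "w \<in> ?W" "ns.nrm (uC - w) \<le> \<epsilon>" for w
    proof -
      note V = WV[OF w(1)] WV[OF uC(1)]
      have "ns.nrm (w - u) \<le> ns.nrm (w - uC) + ns.nrm (uC - u)" by (rule ns.nrm_triangle_mid[OF V uV])
      then have near: "ns.nrm (w - u) \<le> 2 * d.\<epsilon>"
        using w(2) uC(3) ns.nrm_minus_commute[OF V] ns.nrm_minus_commute[OF uV V(2)] by (simp add: \<epsilon>)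
      note b = d.DN_bij[OF V(1) near]
      have "linear_form ?W (ns.N w)" by (rule ns.linear_form_subset[OF ns.linear_form_N[OF V(1)] W(2)])
      from theI'[OF b[OF this]]
      have \<theta>: "DNS_inv \<Omega> ?W w (NS \<Omega> f w) \<in> ?W" "\<forall>\<phi>\<in>?W. ns.DN w (DNS_inv \<Omega> ?W w (NS \<Omega> f w)) \<phi> = ns.N w \<phi>"
        unfolding DNS_inv_def DNS_eq NS_eq by auto
      show "\<exists>\<theta>. \<theta> \<in> ?W \<and> DNS_inv \<Omega> ?W w (NS \<Omega> f w) = \<theta> \<and>
          ns.nrm (uC - (w - \<theta>)) \<le> (2 * G / \<beta>) * (ns.nrm (uC - w))\<^sup>2 \<and> ns.nrm (uC - (w - \<theta>)) \<le> ns.nrm (uC - w) / 4"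
        using d.newton_step[OF uC(1) _ _ w(1) _ \<theta>(1)] uC(2,3) w(2) \<theta> by (auto simp: \<epsilon>)
      show "bijective_op \<Omega> ?W (DNS \<Omega> w)"
        unfolding bijective_op_def DNS_eq
      proof (intro conjI ballI impI)
        fix l assume "l \<in> bounded_functionals (energy_norm \<Omega>) ?W"
        from b[OF bounded_functional_linear[OF this]] show "\<exists>\<theta>\<in>?W. \<forall>\<phi>\<in>?W. ns.DN w \<theta> \<phi> = l \<phi>" by blast
      next
        fix \<theta> \<theta>' assume th: "\<theta> \<in> ?W" "\<theta>' \<in> ?W" "\<forall>\<phi>\<in>?W. ns.DN w \<theta> \<phi> = ns.DN w \<theta>' \<phi>"
        have "linear_form ?W (ns.DN w \<theta>')" by (rule ns.linear_form_subset[OF ns.linear_form_DN(1)[OF V(1) WV[OF th(2)]] W(2)])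
        from b[OF this] have "\<theta> = \<theta>'" using th by blast
        then show "ae_eq \<Omega> \<theta> \<theta>'" by (simp add: ae_eq_def)
      qed
    qed
    define X where "X = newton \<Omega> f ?W w0"
    have XS: "X (Suc j) = X j - DNS_inv \<Omega> ?W (X j) (NS \<Omega> f (X j))" for j
      by (simp add: X_def diff_eq)
    \<comment> \<open>Staying within \<epsilon> of \<open>uC\<close> keeps the derivative bijective
      at every iterate, so that \<open>DNS_inv\<close> is well defined there; the geometric bound
      gives convergence.\<close>
    have inv: "X j \<in> ?W \<and> ns.nrm (uC - X j) \<le> \<epsilon> \<and> ns.nrm (uC - X j) \<le> (1 / 4) ^ j * ns.nrm (uC - w0)" for j
    proof (induction j)
      case 0
      have "X 0 = w0" by (simp add: X_def)
      then show ?case using w0 by (simp only: power_0 mult_1 order_refl simp_thms)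
    next
      case (Suc j)
      then obtain \<theta> where \<theta>: "\<theta> \<in> ?W" "DNS_inv \<Omega> ?W (X j) (NS \<Omega> f (X j)) = \<theta>" "ns.nrm (uC - (X j - \<theta>)) \<le> ns.nrm (uC - X j) / 4"
        using step[of "X j"] by blast
      have "X (Suc j) = X j - \<theta>" using \<theta>(2) XS by simp
      moreover have "X j - \<theta> \<in> ?W" using Suc \<theta>(1) d.W_closed(3) by blast
      moreover have "0 \<le> ns.nrm (uC - X j)" using Suc WV uC(1) by auto
      moreover have "ns.nrm (uC - X j) / 4 \<le> (1 / 4) ^ Suc j * ns.nrm (uC - w0)" using Suc by (simp only: power_Suc) linarith
      moreover have "ns.nrm (uC - X j) \<le> \<epsilon>" using Suc by blast
      ultimately show ?case using \<theta>(3) by (intro conjI; (simp only:; fail)?; linarith?)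
    qed
    have e: "energy_norm \<Omega> (\<lambda>x. uC x - X j x) = ns.nrm (uC - X j)" for j
      using dist_eq[OF WV[OF uC(1)] WV] inv by blast
    have lim: "(\<lambda>j. ns.nrm (uC - X j)) \<longlonglongrightarrow> 0"
    proof (rule Lim_null_comparison)
      have "0 \<le> ns.nrm (uC - X j)" for j using inv WV uC(1) by auto
      then show "\<forall>\<^sub>F j in sequentially. norm (ns.nrm (uC - X j)) \<le> (1 / 4) ^ j * ns.nrm (uC - w0)"
        using inv by (intro always_eventually) simp
      have "(\<lambda>j. (1 / 4) ^ j * ns.nrm (uC - w0)) \<longlonglongrightarrow> 0 * ns.nrm (uC - w0)"
        by (intro tendsto_intros LIMSEQ_realpow_zero) auto
      then show "(\<lambda>j. (1 / 4) ^ j * ns.nrm (uC - w0)) \<longlonglongrightarrow> 0" by simp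
    qed
    \<comment> \<open>The added 1 makes the constant positive, as
      \<open>converges_quadratically\<close> requires, from \<open>G\<close> \<ge> 0 alone.\<close>
    have quad: "ns.nrm (uC - X (Suc j)) \<le> (2 * G / \<beta> + 1) * (ns.nrm (uC - X j))\<^sup>2" for j
    proof -
      obtain \<theta> where \<theta>: "DNS_inv \<Omega> ?W (X j) (NS \<Omega> f (X j)) = \<theta>" "ns.nrm (uC - (X j - \<theta>)) \<le> (2 * G / \<beta>) * (ns.nrm (uC - X j))\<^sup>2"
        using step[of "X j"] inv[of j] by blast
      have "X (Suc j) = X j - \<theta>" using \<theta>(1) XS by simp
      then show ?thesis using \<theta>(2) by (simp add: distrib_right) (smt (verit) zero_le_power2)
    qed
    have "0 < 2 * G / \<beta> + 1" using G_nonneg \<beta> by (intro add_nonneg_pos divide_nonneg_pos) auto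
    then have "converges_quadratically \<Omega> X uC"
      unfolding converges_quadratically_def e using lim quad by blast
    then show ?thesis
      unfolding newton_converges_def X_def[symmetric] using inv bij by blast
  qed
  have qo: "ns.nrm (u - uC) \<le> 2 * (1 + (1 + 2 * G * ns.nrm u) / \<beta>) * best_approx \<Omega> ?W u"
    if uC: "uC \<in> ?W" "\<forall>v\<in>?W. ns.N uC v = 0" "ns.nrm (u - uC) \<le> \<epsilon>" for uC
  proof -
    let ?C = "2 * (1 + (1 + 2 * G * ns.nrm u) / \<beta>)"
    have "0 \<le> (1 + 2 * G * ns.nrm u) / \<beta>" using G_nonneg \<beta> uV by simp
    then have C: "?C > 0" by (intro mult_pos_pos add_pos_nonneg) auto
    have "ns.nrm (u - uC) / ?C \<le> best_approx \<Omega> ?W u"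
      unfolding best_approx_def
    proof (rule cINF_greatest)
      show "?W \<noteq> {}" using uC(1) by auto
      fix v assume v: "v \<in> ?W"
      have "ns.nrm (u - uC) \<le> ?C * ns.nrm (u - v)"
        using d.quasi_optimal[OF uC(1) _ _ v] uC(2,3) by (simp add: \<epsilon>)
      then show "ns.nrm (u - uC) / ?C \<le> energy_norm \<Omega> (\<lambda>x. u x - v x)"
        unfolding dist[OF v] using C by (simp only: pos_divide_le_eq mult.commute)
    qed
    then show ?thesis using C by (simp only: pos_divide_le_eq mult.commute)
  qed
  show ?thesis
  proof (intro conjI ex allI impI ballI)
    fix uC assume "discrete_solution \<Omega> f ?W uC \<and> energy_norm \<Omega> (\<lambda>x. u x - uC x) \<le> \<epsilon>"
    then have uC: "uC \<in> ?W" "\<forall>v\<in>?W. ns.N uC v = 0" "ns.nrm (u - uC) \<le> \<epsilon>"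
      using dist by (auto simp: sol)
    show "newton_converges \<Omega> f ?W w0 uC" if "w0 \<in> ?W" "energy_norm \<Omega> (\<lambda>x. uC x - w0 x) \<le> \<epsilon>" for w0
      using newton[OF uC that(1)] that(2) dist_eq[OF WV[OF uC(1)] WV[OF that(1)]] by simp
    show "energy_norm \<Omega> (\<lambda>x. u x - uC x) \<le> 2 * (1 + (1 + 2 * G * ns.nrm u) / \<beta>) * best_approx \<Omega> ?W u"
      unfolding dist[OF uC(1)] by (rule qo[OF uC])
  qed
qed

lemma main_result:
  "\<exists>\<epsilon>>0. \<exists>\<delta>>0. \<exists>\<rho>>0. \<exists>Cqo>0. \<forall>\<T>\<in>fine_meshes TT \<delta>.
    (\<exists>!uC. discrete_solution \<Omega> f (VC \<T>) uC \<and> energy_norm \<Omega> (\<lambda>x. u x - uC x) \<le> \<epsilon>) \<and>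
    (\<forall>uC. discrete_solution \<Omega> f (VC \<T>) uC \<and> energy_norm \<Omega> (\<lambda>x. u x - uC x) \<le> \<epsilon> \<longrightarrow>
       (\<forall>w0\<in>VC \<T>. energy_norm \<Omega> (\<lambda>x. uC x - w0 x) \<le> \<rho> \<longrightarrow>
          newton_converges \<Omega> f (VC \<T>) w0 uC) \<and>
       energy_norm \<Omega> (\<lambda>x. u x - uC x) \<le> Cqo * best_approx \<Omega> (VC \<T>) u)"
proof -
  obtain \<beta> \<delta>1 where \<beta>: "\<beta> > 0" and \<delta>1: "\<delta>1 > 0" "\<forall>\<T>\<in>fine_meshes TT \<delta>1. \<forall>\<theta>\<in>VC \<T>. \<forall>c\<ge>0.
     (\<forall>\<phi>\<in>VC \<T>. \<bar>ns.DN u \<theta> \<phi>\<bar> \<le> c * ns.nrm \<phi>) \<longrightarrow> \<beta> * ns.nrm \<theta> \<le> c"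
    using discrete_infsup by blast
  define \<epsilon> where "\<epsilon> = \<beta> / (8 * (G + 1))"
  define K where "K = 1 + 2 * G * ns.nrm u"
  have K: "K \<ge> 1" using G_nonneg uV by (simp add: K_def)
  have \<epsilon>: "\<epsilon> > 0" unfolding \<epsilon>_def using \<beta> G_nonneg by (intro divide_pos_pos mult_pos_pos add_nonneg_pos) auto
  \<comment> \<open>The two entries of the minimum are the two closeness conditions on
    \<open>v0\<close> in \<open>mesh_result\<close>.\<close>
  define \<eta> where "\<eta> = min (\<epsilon> / 2) (\<beta> * \<epsilon> / (4 * K))"
  have \<eta>: "\<eta> > 0" using \<epsilon> \<beta> K by (simp add: \<eta>_def)
  obtain \<delta>2 where \<delta>2: "\<delta>2 > 0" "\<forall>\<T>\<in>fine_meshes TT \<delta>2. \<exists>w\<in>VC \<T>. ns.nrm (u - w) \<le> \<eta>"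
    using solution_approx[OF \<eta>] by blast
  have "0 \<le> K / \<beta>" using K \<beta> by simp
  then have C: "2 * (1 + K / \<beta>) > 0" by (intro mult_pos_pos add_pos_nonneg) auto
  have \<delta>: "min \<delta>1 \<delta>2 > 0" using \<delta>1(1) \<delta>2(1) by simp
  \<comment> \<open>The witnesses are \<open>min \<delta>1 \<delta>2\<close> for the mesh size,
    \<epsilon> for both radii, and \<open>2 * (1 + K / \<beta>)\<close> for
    \<open>Cqo\<close>.\<close>
  show ?thesis
  proof (intro exI conjI ballI)
    fix \<T> assume fine: "\<T> \<in> fine_meshes TT (min \<delta>1 \<delta>2)"
    then have T: "\<T> \<in> TT" "\<T> \<in> fine_meshes TT \<delta>1" "\<T> \<in> fine_meshes TT \<delta>2" by (auto simp: fine_meshes_def)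
    obtain w where w: "w \<in> VC \<T>" "ns.nrm (u - w) \<le> \<eta>" using \<delta>2(2) T(3) by blast
    have w1: "ns.nrm (u - w) \<le> \<epsilon> / 2" using w(2) by (simp add: \<eta>_def)
    have "K * ns.nrm (u - w) \<le> K * (\<beta> * \<epsilon> / (4 * K))" using w(2) K by (intro mult_left_mono) (auto simp: \<eta>_def)
    also have "\<dots> = \<beta> * \<epsilon> / 4" using K by (simp add: field_simps)
    finally have w2: "K * ns.nrm (u - w) \<le> \<beta> * \<epsilon> / 4" .
    note res = mesh_result[OF T(1) \<beta> bspec[OF \<delta>1(2) T(2)] w(1), folded \<epsilon>_def K_def, OF w1 w2]
    from res show "\<exists>!uC. discrete_solution \<Omega> f (VC \<T>) uC \<and> energy_norm \<Omega> (\<lambda>x. u x - uC x) \<le> \<epsilon>" by (rule conjunct1)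
    from res show "\<forall>uC. discrete_solution \<Omega> f (VC \<T>) uC \<and> energy_norm \<Omega> (\<lambda>x. u x - uC x) \<le> \<epsilon> \<longrightarrow>
       (\<forall>w0\<in>VC \<T>. energy_norm \<Omega> (\<lambda>x. uC x - w0 x) \<le> \<epsilon> \<longrightarrow> newton_converges \<Omega> f (VC \<T>) w0 uC) \<and>
       energy_norm \<Omega> (\<lambda>x. u x - uC x) \<le> 2 * (1 + K / \<beta>) * best_approx \<Omega> (VC \<T>) u" by (rule conjunct2)
  qed (use \<epsilon> \<delta> C in auto)
qed

end

theorem theorem4p1:
  fixes \<Omega> :: "(real^2) set" and f u :: "real^2 \<Rightarrow> real" and s :: real
    and TT :: "(real^2) set set set"
    and VC :: "(real^2) set set \<Rightarrow> (real^2 \<Rightarrow> real) set"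
  assumes "polygonal_lipschitz_domain \<Omega>"
    and "f \<in> L2 \<Omega>"
    and "regular_solution \<Omega> f u"
    and "1 / 2 < s" and "s \<le> 1" and "elliptic_regularity \<Omega> s"
    and "\<forall>\<T>\<in>TT. regular_triangulation \<Omega> \<T>" and "uniformly_shape_regular TT"
    and "conforming_fe_family \<Omega> TT VC"
    and "approximation_property \<Omega> s TT VC"
  shows "\<exists>\<epsilon>>0. \<exists>\<delta>>0. \<exists>\<rho>>0. \<exists>Cqo>0. \<forall>\<T>\<in>fine_meshes TT \<delta>.
    (\<exists>!uC. discrete_solution \<Omega> f (VC \<T>) uC \<and> energy_norm \<Omega> (\<lambda>x. u x - uC x) \<le> \<epsilon>) \<and>
    (\<forall>uC. discrete_solution \<Omega> f (VC \<T>) uC \<and> energy_norm \<Omega> (\<lambda>x. u x - uC x) \<le> \<epsilon> \<longrightarrow>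
       (\<forall>w0\<in>VC \<T>. energy_norm \<Omega> (\<lambda>x. uC x - w0 x) \<le> \<rho> \<longrightarrow>
          newton_converges \<Omega> f (VC \<T>) w0 uC) \<and>
       energy_norm \<Omega> (\<lambda>x. u x - uC x) \<le> Cqo * best_approx \<Omega> (VC \<T>) u)"
proof -
  interpret ns_problem \<Omega> s TT VC f u
    by unfold_locales (use assms in \<open>auto simp: polygonal_lipschitz_domain_def\<close>)
  show ?thesis by (rule main_result)
qed

end
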